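(* Let $S_k(n)$ denote the number of multiplicative $k$-Sidon subsets of $[n]=\{1,\ldots,n\}$. Then, as $n\to\infty$, $$S_k(n)=\begin{cases}(2^{\alpha}+o(1))^{\pi(n)}, & \text{if } k\ge 4 \text{ is even};\\ (\beta_k+o(1))^{\pi(n)}, & \text{if } k\ge 5 \text{ is odd},\end{cases}$$ for some constants $\beta_k>0$. Furthermore, $$\beta\ge\beta_5\ge\beta_7\ge\cdots\ge\beta^{-}.$$ Here $$\alpha:=\sum_{i=1}^{\infty}\frac{1}{i}\log_2\!\left(1+\frac{1}{i}\right),\qquad \beta:=\sup_{G}\prod_{k=1}^{\infty}\bigl(e(G_k)+k+1\bigr)^{\frac{1}{k^2+k}},$$ where the supremum is over all product-free graphs $G$, and $$\beta^{-}:=\prod_{k=1}^{\infty}\left(\frac{k^2}{4}-\frac{L(k)^2}{4}+k+1\right)^{\frac{1}{k^2+k}}.$$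
   Context: For an integer $k\ge 2$, a set $A\subseteq\mathbb{N}$ is multiplicative $k$-Sidon if $A$ does not contain $2k$ distinct elements $a_1,\ldots,a_k,b_1,\ldots,b_k$ with $a_1\cdots a_k=b_1\cdots b_k$. $\pi(n)$ is the number of primes at most $n$. A graph $G$ on vertex set $\mathbb{N}=\{1,2,\ldots\}$ is product-free if for any three (not necessarily distinct) edges $a_1b_1,a_2b_2,a_3b_3$ of $G$ (with any choice of labelling of the endpoints of each edge) one has $\frac{a_1}{b_1}\cdot\frac{a_2}{b_2}\ne\frac{a_3}{b_3}$. For such $G$, $G_k$ denotes the induced subgraph of $G$ on $\{1,\ldots,k\}$ and $e(G_k)$ its number of edges. $\Omega(m)$ is the number of prime divisors of $m$ counted with multiplicity, and $L(k):=\sum_{i=1}^{k}(-1)^{\Omega(i)}$ is the summatory Liouville function. Numerically $\alpha\approx 1.8146$ and $\beta^{-}\approx 5.2366$. *)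

theory Defs
  imports "HOL-Analysis.Analysis" "HOL-Computational_Algebra.Primes"
begin

definition mult_k_Sidon :: "nat \<Rightarrow> nat set \<Rightarrow> bool" where
  "mult_k_Sidon k A \<longleftrightarrow>
     \<not> (\<exists>a b :: nat \<Rightarrow> nat.
           inj_on a {..<k} \<and> inj_on b {..<k} \<and>
           a ` {..<k} \<subseteq> A \<and> b ` {..<k} \<subseteq> A \<and>
           a ` {..<k} \<inter> b ` {..<k} = {} \<and>
           (\<Prod>i<k. a i) = (\<Prod>i<k. b i))"

definition S :: "nat \<Rightarrow> nat \<Rightarrow> nat" where
  "S k n = card {A. A \<subseteq> {1..n} \<and> mult_k_Sidon k A}"

definition prime_pi :: "nat \<Rightarrow> nat" where
  "prime_pi n = card {p. prime p \<and> p \<le> n}"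

definition alpha :: real where
  "alpha = (\<Sum>i. (1 / real (Suc i)) * log 2 (1 + 1 / real (Suc i)))"

definition graph_on_pos :: "(nat \<Rightarrow> nat \<Rightarrow> bool) \<Rightarrow> bool" where
  "graph_on_pos E \<longleftrightarrow> (\<forall>a b. E a b \<longrightarrow> E b a \<and> a \<noteq> b \<and> 0 < a \<and> 0 < b)"

definition product_free :: "(nat \<Rightarrow> nat \<Rightarrow> bool) \<Rightarrow> bool" where
  "product_free E \<longleftrightarrow> graph_on_pos E \<and>
     (\<forall>a1 b1 a2 b2 a3 b3. E a1 b1 \<and> E a2 b2 \<and> E a3 b3 \<longrightarrow>
        (of_nat a1 / of_nat b1) * (of_nat a2 / of_nat b2) \<noteq> (of_nat a3 / of_nat b3 :: rat))"

definition edges_upto :: "(nat \<Rightarrow> nat \<Rightarrow> bool) \<Rightarrow> nat \<Rightarrow> nat" where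
  "edges_upto E k = card {(a, b). 1 \<le> a \<and> a < b \<and> b \<le> k \<and> E a b}"

definition beta :: real where
  "beta = Sup {(\<Prod>k. (real (edges_upto E (Suc k)) + real (Suc k) + 1)
                        powr (1 / (real (Suc k) ^ 2 + real (Suc k))))
               | E. product_free E}"

definition Omega :: "nat \<Rightarrow> nat" where
  "Omega m = size (prime_factorization m)"

definition liouville_L :: "nat \<Rightarrow> int" where
  "liouville_L k = (\<Sum>i=1..k. (-1) ^ Omega i)"

definition beta_minus :: real where
  "beta_minus = (\<Prod>k. (real (Suc k) ^ 2 / 4 - (of_int (liouville_L (Suc k)))^2 / 4
                         + real (Suc k) + 1) powr (1 / (real (Suc k) ^ 2 + real (Suc k))))"

end

theory Submission
  imports Defs "HOL-Complex_Analysis.Complex_Analysis" "HOL-Number_Theory.Number_Theory" "HOL-Real_Asymp.Real_Asymp"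
begin

text \<open>Almost all the freedom in choosing a \<open>k\<close>-Sidon set \<open>A\<close> comes from the elements \<open>i * p\<close> with \<open>p\<close> a
  large prime; let \<open>N(p)\<close> be the set of the cofactors \<open>i \<le> n/p\<close> with \<open>i * p \<in> A\<close>. If three given cofactors
  occur together for \<open>k\<close> primes, a closed walk of length \<open>k\<close> on the triangle they form yields a forbidden solution,
  so \<open>N(p)\<close> has at most two elements for nearly all \<open>p\<close>; and the pairs that occur for many primes form a graph
  in which no product of \<open>k\<close> ratios along edges is \<open>1\<close>. The elements with small prime factors
  only are edges of a bipartite graph, and the same triangle argument, applied to blocks of consecutive vertices,
  shows that they are too few to matter. Conversely every such graph gives rise to \<open>k\<close>-Sidon sets by choosing,
  for every large \<open>p\<close>, \<open>N(p)\<close> empty, a singleton or an edge. Hence the growth rate is the supremum of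
  \<open>\<Prod>\<^sub>i (e(G\<^sub>i) + i + 1) powr (1/(i\<^sup>2+i))\<close> over these graphs, where the exponents come from
  \<open>\<pi>(n/i) - \<pi>(n/(i+1)) \<sim> \<pi>(n)/(i\<^sup>2+i)\<close>, that is, from the prime number theorem. For even \<open>k\<close> only the empty
  graph is admissible; for odd \<open>k\<close> the admissible graphs are product-free, decrease with \<open>k\<close>, and include the
  graph joining numbers of opposite Liouville sign.\<close>

section \<open>Newman's Tauberian theorem\<close>

text \<open>On the scale of \<open>prime_pi n\<close> an error factor exp(o(n / ln n)) is free, and
  nothing larger is. Chebyshev's bounds would lose constant factors on each layer n/(i+1) < p <=
  n/i, and these would enter the base; hence the prime number theorem is proved here, from the
  Dirichlet series of psi(n) - n and the non-vanishing of zeta on Re s = 1. The second obstacle is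
  uniformity: the graph of frequent pairs depends on the Sidon set and changes with n, so the upper
  estimate must hold for all graphs at once. It does because e(G_i) + i + 1 <= (i+1)^2 for every
  graph, which makes the contribution of i >= K uniformly small. A Sidon set is then encoded by its
  graph on vertices below some T, one admissible cofactor set for each large prime, and a leftover
  set. There are at most 2^(T^2) graphs, and a leftover of size s costs a factor (n+1)^s, so s must
  be o(n / (ln n)^2); letting T be a small power of n saves a power of n in s.\<close>

lemma powr_tail_step:
  fixes x y :: real
  assumes "x > 0" "y > 0"
  shows "(x + 1) powr (-y - 1) \<le> (x powr (-y) - (x + 1) powr (-y)) / y"
proof -
  have "\<exists>\<xi>. x < \<xi> \<and> \<xi> < x + 1 \<and> (x + 1) powr (-y) - x powr (-y) = (x + 1 - x) * ((-y) * \<xi> powr (-y - 1))"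
    using assms by (intro MVT2) (auto intro!: derivative_eq_intros)
  then obtain \<xi> where \<xi>: "x < \<xi>" "\<xi> < x + 1" "(x + 1) powr (-y) - x powr (-y) = (-y) * \<xi> powr (-y - 1)"
    by auto
  have "(x + 1) powr (-y - 1) \<le> \<xi> powr (-y - 1)"
    using \<xi> assms by (intro powr_mono2') auto
  also have "\<dots> = (x powr (-y) - (x + 1) powr (-y)) / y"
    using \<xi>(3) assms by (simp add: field_simps)
  finally show ?thesis .
qed

text \<open>Comparison with the integral of t^(x-1): the integrand decreases for x <= 1 and
  increases for x > 1, and only then does the last term enter. It serves to bound the Dirichlet
  polynomial on the left half circle, with x = - Re w.\<close>

lemma sum_powr_le:
  fixes x :: real
  assumes "x > 0" "N > 0"
  shows "(\<Sum>n=1..N. real n powr (x - 1)) \<le> real N powr x / x + real N powr (x - 1)"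
proof (cases "x \<le> 1")
  case True
  have "(\<Sum>n=1..M. real n powr (x - 1)) \<le> real M powr x / x" for M
  proof (induction M)
    case (Suc M)
    have "(real M + 1) powr (x - 1) \<le> ((real M + 1) powr x - real M powr x) / x"
    proof (cases "M = 0")
      case True thus ?thesis using assms \<open>x \<le> 1\<close> by simp
    next
      case False
      have "\<exists>\<xi>. real M < \<xi> \<and> \<xi> < real M + 1 \<and> (real M + 1) powr x - real M powr x = (real M + 1 - real M) * (x * \<xi> powr (x - 1))"
        using False by (intro MVT2) (auto intro!: derivative_eq_intros)
      then obtain \<xi> where \<xi>: "real M < \<xi>" "\<xi> < real M + 1" "(real M + 1) powr x - real M powr x = x * \<xi> powr (x - 1)"
        by auto
      have "(real M + 1) powr (x - 1) \<le> \<xi> powr (x - 1)"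
        using \<xi> True False by (intro powr_mono2') auto
      thus ?thesis using \<xi>(3) assms by (simp add: field_simps)
    qed
    with Suc show ?case by (simp add: diff_divide_distrib add.commute)
  qed (use assms in auto)
  from this[of N] show ?thesis by (smt (verit) powr_ge_zero)
next
  case False
  have "(\<Sum>n=1..M. real n powr (x - 1)) \<le> real M powr x / x + real M powr (x - 1)" if "M > 0" for M
    using that
  proof (induction M rule: nat_induct_non_zero)
    case (Suc M)
    have "\<exists>\<xi>. real M < \<xi> \<and> \<xi> < real M + 1 \<and> (real M + 1) powr x - real M powr x = (real M + 1 - real M) * (x * \<xi> powr (x - 1))"
      using Suc.hyps by (intro MVT2) (auto intro!: derivative_eq_intros)
    then obtain \<xi> where \<xi>: "real M < \<xi>" "\<xi> < real M + 1" "(real M + 1) powr x - real M powr x = x * \<xi> powr (x - 1)"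
      by auto
    have "real M powr (x - 1) \<le> \<xi> powr (x - 1)"
      using \<xi> False by (intro powr_mono2) auto
    hence "real M powr (x - 1) \<le> ((real M + 1) powr x - real M powr x) / x"
      using \<xi>(3) assms by (simp add: field_simps)
    with Suc show ?case by (simp add: diff_divide_distrib add.commute)
  qed (use assms in auto)
  from this[of N] assms show ?thesis by simp
qed

section \<open>Half circles, Cauchy's formula and estimates on the contour\<close>

lemma part_circlepath_0_eq: "part_circlepath 0 R a b x = of_real R * cis ((1 - x) * a + x * b)"
  by (simp add: part_circlepath_def linepath_def cis_conv_exp)

lemma right_half_circle:
  assumes "R > 0" "w \<in> path_image (part_circlepath 0 R (-pi/2) (pi/2))"
  shows "norm w = R" "Re w \<ge> 0"
proof -
  obtain x where x: "0 \<le> x" "x \<le> 1" "w = of_real R * cis ((1 - x) * (-pi/2) + x * (pi/2))"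
    using assms(2) unfolding path_image_def part_circlepath_0_eq by auto
  have "x * pi \<le> 1 * pi" using x by (intro mult_right_mono) auto
  hence "0 \<le> cos ((1 - x) * (-pi/2) + x * (pi/2))"
    using x by (intro cos_ge_zero) (auto simp: field_simps)
  thus "norm w = R" "Re w \<ge> 0" using assms x(3) by (auto simp: norm_mult)
qed

lemma left_half_circle:
  assumes "R > 0" "w \<in> path_image (part_circlepath 0 R (3*pi/2) (pi/2))"
  shows "norm w = R" "Re w \<le> 0"
proof -
  obtain x where x: "0 \<le> x" "x \<le> 1" "w = of_real R * cis ((1 - x) * (3*pi/2) + x * (pi/2))"
    using assms(2) unfolding path_image_def part_circlepath_0_eq by auto
  have "x * pi \<le> 1 * pi" using x by (intro mult_right_mono) auto
  hence "0 \<le> cos ((1 - x) * (3*pi/2) + x * (pi/2) - pi)"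
    using x by (intro cos_ge_zero) (auto simp: field_simps)
  hence "cos ((1 - x) * (3*pi/2) + x * (pi/2)) \<le> 0" by (simp add: cos_diff)
  thus "norm w = R" "Re w \<le> 0" using assms x(3) by (auto simp: norm_mult mult_nonneg_nonpos)
qed

lemma half_circle_ends:
  "pathstart (part_circlepath 0 R (-pi/2) (pi/2)) = - (\<i> * R)"
  "pathfinish (part_circlepath 0 R (-pi/2) (pi/2)) = \<i> * R"
  "pathstart (part_circlepath 0 R (3*pi/2) (pi/2)) = - (\<i> * R)"
  "pathfinish (part_circlepath 0 R (3*pi/2) (pi/2)) = \<i> * R"
proof -
  have "cos (3 * pi / 2) = 0" "sin (3 * pi / 2) = -1"
    using cos_3over2_pi sin_3over2_pi by (simp_all add: field_simps)
  thus "pathstart (part_circlepath 0 R (-pi/2) (pi/2)) = - (\<i> * R)"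
    "pathfinish (part_circlepath 0 R (-pi/2) (pi/2)) = \<i> * R"
    "pathstart (part_circlepath 0 R (3*pi/2) (pi/2)) = - (\<i> * R)"
    "pathfinish (part_circlepath 0 R (3*pi/2) (pi/2)) = \<i> * R"
    unfolding pathstart_def pathfinish_def part_circlepath_0_eq by (simp_all add: complex_eq_iff)
qed

text \<open>Write F(w)/w = q(w) + F(0)/w with q holomorphic. The integrals of q along both paths
  agree by Cauchy's theorem, and 1/w has the primitive \<open>Ln w\<close> on the right path and
  \<open>Ln (- w)\<close> on the left one. Their changes are pi i and - pi i, which yields 2 pi i
  without a winding number.\<close>

lemma half_circle_Cauchy:
  fixes F :: "complex \<Rightarrow> complex"
  assumes F: "F holomorphic_on V" and V: "open V" "convex V" "0 \<in> V"
    and R: "R > 0"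
    and A: "path_image (part_circlepath 0 R (-pi/2) (pi/2)) \<subseteq> V"
    and B: "valid_path B" "path_image B \<subseteq> V" "path_image B \<inter> \<real>\<^sub>\<ge>\<^sub>0 = {}"
      "pathstart B = - (\<i> * R)" "pathfinish B = \<i> * R"
  shows "contour_integral (part_circlepath 0 R (-pi/2) (pi/2)) (\<lambda>w. F w / w) - contour_integral B (\<lambda>w. F w / w) = 2 * pi * \<i> * F 0"
proof -
  define A where "A = part_circlepath 0 R (-pi/2) (pi/2)"
  have vA: "valid_path A" by (simp add: A_def)
  have AV: "path_image A \<subseteq> V" using A by (simp add: A_def)
  have sA: "pathstart A = - (\<i> * R)" and fA: "pathfinish A = \<i> * R"
    unfolding A_def by (rule half_circle_ends)+
  have A_pos: "Re w > 0 \<or> Im w \<noteq> 0" if "w \<in> path_image A" for w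
  proof -
    have "norm w = R" "Re w \<ge> 0" using right_half_circle[OF R] that by (auto simp: A_def)
    thus ?thesis using R by (cases "w = 0") (auto simp: complex_eq_iff)
  qed
  define q where "q = (\<lambda>z. if z = 0 then deriv F 0 else (F z - F 0) / (z - 0))"
  have q: "q holomorphic_on V" unfolding q_def by (rule pole_lemma_open) (use F V in auto)
  have "(q has_contour_integral 0) (A +++ reversepath B)"
    using AV B vA sA fA
    by (intro Cauchy_theorem_convex_simple[OF q V(2)]) (auto simp: path_image_join)
  moreover have cq: "continuous_on V q" using q holomorphic_on_imp_continuous_on by blast
  have iqA: "q contour_integrable_on A" 
    by (intro contour_integrable_holomorphic_simple[OF q V(1) vA]) (use AV in auto)
  moreover have iqB: "q contour_integrable_on B" 
    by (intro contour_integrable_holomorphic_simple[OF q V(1) B(1)]) (use B in auto)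
  ultimately have eq: "contour_integral A q = contour_integral B q"
    using vA B contour_integral_unique[of q 0 "A +++ reversepath B"]
    by (simp add: contour_integrable_reversepath contour_integral_reversepath)
  have iA: "((\<lambda>w. 1 / w) has_contour_integral (Ln (pathfinish A) - Ln (pathstart A))) A"
  proof (rule contour_integral_primitive[where f = Ln])
    show "path_image A \<subseteq> - \<real>\<^sub>\<le>\<^sub>0"
      using A_pos by (force simp: complex_nonpos_Reals_iff)
    fix x :: complex assume "x \<in> - \<real>\<^sub>\<le>\<^sub>0"
    thus "(Ln has_field_derivative 1 / x) (at x within - \<real>\<^sub>\<le>\<^sub>0)"
      by (auto intro!: derivative_eq_intros simp: divide_inverse)
  qed fact
  have iB: "((\<lambda>w. 1 / w) has_contour_integral (Ln (- pathfinish B) - Ln (- pathstart B))) B"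
  proof (rule contour_integral_primitive[where f = "\<lambda>x. Ln (-x)"])
    show "path_image B \<subseteq> - \<real>\<^sub>\<ge>\<^sub>0" using B by auto
    fix x :: complex assume x: "x \<in> - \<real>\<^sub>\<ge>\<^sub>0"
    hence "- x \<notin> \<real>\<^sub>\<le>\<^sub>0" by (auto simp: complex_nonpos_Reals_iff complex_nonneg_Reals_iff)
    thus "((\<lambda>x. Ln (-x)) has_field_derivative 1 / x) (at x within - \<real>\<^sub>\<ge>\<^sub>0)"
      by (auto intro!: derivative_eq_intros simp: divide_inverse)
  qed fact
  have "Ln (of_real R * \<i>) = of_real (ln R) + Ln \<i>" "Ln (of_real R * (- \<i>)) = of_real (ln R) + Ln (- \<i>)"
    using Ln_times_of_real[OF R, of "\<i>"] Ln_times_of_real[OF R, of "-\<i>"] R by (simp_all add: Ln_of_real)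
  hence L: "Ln (\<i> * R) = ln R + \<i> * pi / 2" "Ln (- (\<i> * R)) = ln R - \<i> * pi / 2"
    by (simp_all add: mult.commute)
  have *: "((\<lambda>w. F w / w) has_contour_integral (contour_integral \<gamma> q + F 0 * I)) \<gamma>"
    if "q contour_integrable_on \<gamma>" "((\<lambda>w. 1 / w) has_contour_integral I) \<gamma>" "0 \<notin> path_image \<gamma>" for \<gamma> I
  proof -
    have "((\<lambda>w. q w + F 0 * (1 / w)) has_contour_integral (contour_integral \<gamma> q + F 0 * I)) \<gamma>"
      by (intro has_contour_integral_add has_contour_integral_lmul that has_contour_integral_integral)
    thus ?thesis
      by (rule has_contour_integral_eq) (use that in \<open>auto simp: q_def field_simps\<close>)
  qed
  have "0 \<notin> path_image A" using A_pos by force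
  moreover have "0 \<notin> path_image B" using B by auto
  ultimately show ?thesis
    unfolding A_def[symmetric] using *[OF iqA iA, THEN contour_integral_unique] *[OF iqB iB, THEN contour_integral_unique] eq
    by (simp add: sA fA B L algebra_simps)
qed

text \<open>At parameter x of the segment, |N^w| = exp (- delta x ln N), and integrating this
  exponential gains a factor 1 / ln N. The constant M is independent of N, as the contour is fixed
  before N grows.\<close>

lemma segment_decay:
  fixes H :: "complex \<Rightarrow> complex"
  assumes H: "continuous_on (closed_segment a b) H" and "Re a = 0" "Re b = -\<delta>" "\<delta> > 0"
  obtains M where "\<And>N::nat. N > 1 \<Longrightarrow> norm (contour_integral (linepath a b) (\<lambda>w. H w * of_nat N powr w)) \<le> M / ln N"
proof -
  have "compact (H ` closed_segment a b)" by (intro compact_continuous_image H compact_segment)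
  hence "bounded (H ` closed_segment a b)" by (rule compact_imp_bounded)
  then obtain M where M: "M > 0" "\<And>w. w \<in> closed_segment a b \<Longrightarrow> norm (H w) \<le> M"
    unfolding bounded_pos by auto
  show ?thesis
  proof (rule that[of "M * norm (b - a) / \<delta>"])
    fix N :: nat assume N: "N > 1"
    define c where "c = \<delta> * ln N"
    have c: "c > 0" using N assms by (simp add: c_def)
    have cont: "continuous_on (closed_segment a b) (\<lambda>w. H w * of_nat N powr w)"
      using N by (intro continuous_intros H) auto
    have "((\<lambda>w. H w * of_nat N powr w) has_contour_integral
         (contour_integral (linepath a b) (\<lambda>w. H w * of_nat N powr w))) (linepath a b)"
      by (intro has_contour_integral_integral contour_integrable_continuous_linepath cont)
    hence I: "((\<lambda>x. H (linepath a b x) * of_nat N powr linepath a b x * (b - a)) has_integral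
         (contour_integral (linepath a b) (\<lambda>w. H w * of_nat N powr w))) {0..1}"
      by (simp add: has_contour_integral_linepath)
    have "((\<lambda>x. M * norm (b - a) * exp (- c * x)) has_integral
            (M * norm (b - a) * (- exp (- c * 1) / c) - M * norm (b - a) * (- exp (- c * 0) / c))) {0..1}"
      by (intro fundamental_theorem_of_calculus)
         (use c in \<open>auto intro!: derivative_eq_intros simp flip: has_real_derivative_iff_has_vector_derivative\<close>)
    hence J: "((\<lambda>x. M * norm (b - a) * exp (- c * x)) has_integral M * norm (b - a) * ((1 - exp (- c)) / c)) {0..1}"
      by (simp add: field_simps diff_divide_distrib)
    have "norm (contour_integral (linepath a b) (\<lambda>w. H w * of_nat N powr w)) \<le> M * norm (b - a) * ((1 - exp (- c)) / c)"
    proof -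
      have "norm (H (linepath a b x) * of_nat N powr linepath a b x * (b - a)) \<le> M * norm (b - a) * exp (- c * x)"
        if x: "x \<in> {0..1}" for x
      proof -
        have "norm (of_nat N powr linepath a b x) = exp (- c * x)"
          using N assms by (simp add: linepath_def norm_powr_real_powr powr_def c_def)
        moreover have "norm (H (linepath a b x)) \<le> M"
          by (intro M) (use x in \<open>auto simp: linepath_in_path\<close>)
        ultimately show ?thesis
          by (simp add: norm_mult mult_right_mono)
      qed
      from integral_norm_bound_integral[OF has_integral_integrable[OF I] has_integral_integrable[OF J] this]
      show ?thesis unfolding integral_unique[OF I] integral_unique[OF J] by simp
    qed
    also have "\<dots> \<le> M * norm (b - a) * (1 / c)"
      using c M by (intro mult_left_mono divide_right_mono) auto
    finally show "norm (contour_integral (linepath a b) (\<lambda>w. H w * of_nat N powr w)) \<le> M * norm (b - a) / \<delta> / ln N"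
      by (simp add: c_def)
  qed
qed


text \<open>The coefficients are O(1/n), so the tail is at most C times the sum of n^(-x-1) over n >
  N, which \<open>powr_tail_step\<close> telescopes.\<close>

lemma dirichlet_remainder_bound:
  fixes c :: "nat \<Rightarrow> complex"
  assumes c: "\<And>n. norm (c n) * real n \<le> C" "c 0 = 0" and w: "Re w > 0" and N: "N > 0"
    and G: "(\<lambda>n. c n * of_nat n powr (-w)) sums g"
  shows "norm (g - (\<Sum>n=1..N. c n * of_nat n powr (-w))) \<le> C * N powr (- Re w) / Re w"
proof -
  define x where "x = Re w"
  define f where "f = (\<lambda>M. \<Sum>n=1..M. c n * of_nat n powr (-w))"
  have C: "C \<ge> 0" using c(1)[of 0] by simp
  have term_bd: "norm (c n * of_nat n powr (-w)) \<le> C * n powr (-x - 1)" if "n > 0" for n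
  proof -
    have "norm (c n * of_nat n powr (-w)) = norm (c n) * real n * real n powr (-x - 1)"
      using that by (simp add: norm_mult norm_powr_real_powr x_def powr_diff field_simps)
    also have "\<dots> \<le> C * n powr (-x - 1)" by (intro mult_right_mono c) auto
    finally show ?thesis .
  qed
  have "norm (f M - f N) \<le> C * (N powr (-x) - M powr (-x)) / x" if "M \<ge> N" for M
    using that
  proof (induction rule: dec_induct)
    case (step M)
    have "norm (f (Suc M) - f N) = norm (f M - f N + c (Suc M) * of_nat (Suc M) powr (-w))"
      by (simp add: f_def algebra_simps)
    also have "\<dots> \<le> norm (f M - f N) + norm (c (Suc M) * of_nat (Suc M) powr (-w))"
      by (rule norm_triangle_ineq)
    also have "norm (c (Suc M) * of_nat (Suc M) powr (-w)) \<le> C * (real M + 1) powr (-x - 1)"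
      using term_bd[of "Suc M"] by (simp add: add.commute)
    also have "\<dots> \<le> C * ((real M powr (-x) - (real M + 1) powr (-x)) / x)"
      using step N w C by (intro mult_left_mono powr_tail_step) (auto simp: x_def)
    finally show ?case using step.IH by (simp add: algebra_simps diff_divide_distrib)
  qed auto
  moreover have "C * (N powr (-x) - M powr (-x)) / x \<le> C * N powr (-x) / x" for M
    using C w by (auto simp: x_def intro!: divide_right_mono mult_left_mono)
  ultimately have "norm (f M - f N) \<le> C * N powr (-x) / x" if "M \<ge> N" for M
    using that order_trans by blast
  moreover have "(\<lambda>M. norm (f M - f N)) \<longlonglongrightarrow> norm (g - f N)"
  proof -
    have "f M = (\<Sum>n<Suc M. c n * of_nat n powr (-w))" for M
      unfolding f_def by (rule sum.mono_neutral_left) (auto simp: c Suc_le_eq)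
    moreover have "(\<lambda>M. \<Sum>n<Suc M. c n * of_nat n powr (-w)) \<longlonglongrightarrow> g"
      using G unfolding sums_def by (rule LIMSEQ_Suc)
    ultimately have "f \<longlonglongrightarrow> g" by presburger
    thus ?thesis by (intro tendsto_intros)
  qed
  ultimately have "norm (g - f N) \<le> C * N powr (-x) / x"
    by (intro tendsto_upperbound[where F = sequentially]) (auto intro!: eventually_sequentiallyI)
  thus ?thesis by (simp add: f_def x_def)
qed

text \<open>A compact half disc has a margin e inside \<open>U\<close>, and a ball cut by the line
  Re w = -e is convex. So Cauchy's theorem for convex sets applies, and the segments leading to
  -delta stay in the region of holomorphy.\<close>

lemma convex_nbhd_of_half_disc:
  fixes U :: "complex set"
  assumes U: "open U" "{w. Re w \<ge> 0} \<subseteq> U" and R: "R > 0"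
  obtains \<delta> V where "\<delta> > 0" "open V" "convex V" "V \<subseteq> U" "0 \<in> V" "- of_real \<delta> \<in> V"
    "\<And>w. norm w = R \<Longrightarrow> Re w \<ge> 0 \<Longrightarrow> w \<in> V"
proof -
  define K where "K = cball 0 (2 * R) \<inter> {w::complex. Re w \<ge> 0}"
  have "compact K" unfolding K_def
    by (intro compact_Int_closed compact_cball closed_halfspace_Re_ge)
  moreover have "K \<subseteq> U" using U by (auto simp: K_def)
  ultimately obtain e where e: "e > 0" "(\<Union>x\<in>K. ball x e) \<subseteq> U"
    using compact_subset_open_imp_ball_epsilon_subset[of K U] U by auto
  define V where "V = ball 0 (2 * R) \<inter> {w. Re w > -e}"
  show ?thesis
  proof (rule that[of "min (e / 2) R" V])
    show "open V" unfolding V_def by (intro open_Int open_ball open_halfspace_Re_gt)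
    show "convex V" unfolding V_def by (intro convex_Int convex_ball convex_halfspace_Re_gt)
    show "V \<subseteq> U"
    proof
      fix w assume w: "w \<in> V"
      show "w \<in> U"
      proof (cases "Re w \<ge> 0")
        case False
        have "dist (\<i> * Im w) w = \<bar>Re w\<bar>" by (simp add: dist_norm cmod_def)
        moreover have "norm (\<i> * Im w) \<le> norm w" by (simp add: norm_mult abs_Im_le_cmod)
        ultimately have "\<i> * Im w \<in> K" "w \<in> ball (\<i> * Im w) e"
          using w False by (auto simp: V_def K_def)
        thus ?thesis using e by blast
      qed (use U in auto)
    qed
  qed (use e R in \<open>auto simp: V_def\<close>)
qed

text \<open>Newman's contour argument. On \<open>|w| = R\<close> the kernel \<open>(1 + w\<^sup>2 / R\<^sup>2) / w\<close> equals
  \<open>2 Re w / R\<^sup>2\<close>, which cancels the blow-up of the remainder near the imaginary axis.\<close>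

theorem newman_tauberian:
  fixes c :: "nat \<Rightarrow> complex"
  assumes c: "\<And>n. norm (c n) * real n \<le> C" "c 0 = 0"
    and U: "open U" "{w. Re w \<ge> 0} \<subseteq> U" and G: "G holomorphic_on U"
    and sums: "\<And>w. Re w > 0 \<Longrightarrow> (\<lambda>n. c n * of_nat n powr (-w)) sums G w"
  shows "c sums G 0"
proof -
  define f where "f = (\<lambda>M w. \<Sum>n=1..M. c n * of_nat n powr (-w))"
  have C: "C \<ge> 0" using c(1)[of 0] by simp
  \<comment> \<open>M depends on R but not on N: R is chosen first to make 3 C / R small, then N
    grows.\<close>
  have *: "\<exists>M. \<forall>\<^sub>F N in sequentially. norm (G 0 - f N 0) \<le> 3 * C / R + M / ln (real N)" if R: "R > 0" for R
  proof -
    obtain \<delta> V where V: "\<delta> > 0" "open V" "convex V" "V \<subseteq> U" "0 \<in> V" "- of_real \<delta> \<in> V"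
      "\<And>w. norm w = R \<Longrightarrow> Re w \<ge> 0 \<Longrightarrow> w \<in> V"
      using convex_nbhd_of_half_disc[OF U R] by metis
    have GV: "G holomorphic_on V" using G V holomorphic_on_subset by blast
    define K where "K = (\<lambda>w::complex. (1 + w\<^sup>2 / of_real (R\<^sup>2)))"
    have K: "norm (K w / w) = 2 * \<bar>Re w\<bar> / R\<^sup>2" if "norm w = R" for w
    proof -
      have "w \<noteq> 0" using that R by auto
      have "cnj w * w = of_real (R\<^sup>2)" using that by (metis complex_norm_square mult.commute)
      hence "K w / w = (cnj w + w) / of_real (R\<^sup>2)"
        using \<open>w \<noteq> 0\<close> R by (simp add: K_def field_simps power2_eq_square)
      also have "cnj w + w = of_real (2 * Re w)" by (simp add: complex_eq_iff)
      finally show ?thesis by (simp add: norm_divide norm_power)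
    qed
    define A where "A = part_circlepath 0 R (-pi/2) (pi/2)"
    define A' where "A' = part_circlepath 0 R (3*pi/2) (pi/2)"
    have A_ends: "pathstart A = - (\<i> * R)" "pathfinish A = \<i> * R" "pathstart A' = - (\<i> * R)" "pathfinish A' = \<i> * R"
      unfolding A_def A'_def by (rule half_circle_ends)+
    have vA: "valid_path A" "valid_path A'" by (simp_all add: A_def A'_def)
    have A_im: "norm w = R \<and> Re w \<ge> 0" if "w \<in> path_image A" for w
      using right_half_circle[OF R] that by (auto simp: A_def)
    have A'_im: "norm w = R \<and> Re w \<le> 0" if "w \<in> path_image A'" for w
      using left_half_circle[OF R] that by (auto simp: A'_def)
    define l1 where "l1 = linepath (- (\<i> * R)) (- of_real \<delta>)"
    define l2 where "l2 = linepath (- of_real \<delta>) (\<i> * R)"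
    have Rin: "\<i> * R \<in> V" "- (\<i> * R) \<in> V" using V(7)[of "\<i> * R"] V(7)[of "-(\<i> * R)"] R by (auto simp: norm_mult)
    have seg: "closed_segment (- (\<i> * R)) (- of_real \<delta>) \<subseteq> V - \<real>\<^sub>\<ge>\<^sub>0" "closed_segment (\<i> * R) (- of_real \<delta>) \<subseteq> V - \<real>\<^sub>\<ge>\<^sub>0"
    proof -
      have "closed_segment a (- of_real \<delta>) \<inter> \<real>\<^sub>\<ge>\<^sub>0 = {}" if "Re a = 0" "a \<noteq> 0" for a
        using that V(1) by (auto simp: closed_segment_def complex_nonneg_Reals_iff complex_eq_iff algebra_simps mult_le_0_iff)
      from this[of "-(\<i> * R)"] this[of "\<i> * R"]
      show "closed_segment (- (\<i> * R)) (- of_real \<delta>) \<subseteq> V - \<real>\<^sub>\<ge>\<^sub>0" "closed_segment (\<i> * R) (- of_real \<delta>) \<subseteq> V - \<real>\<^sub>\<ge>\<^sub>0"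
        using closed_segment_subset[OF Rin(2) V(6) V(3)] closed_segment_subset[OF Rin(1) V(6) V(3)] R by auto
    qed
    have decay: "\<exists>M. \<forall>N::nat. N > 1 \<longrightarrow> norm (contour_integral (linepath a (- of_real \<delta>)) (\<lambda>w. G w * K w / w * of_nat N powr w)) \<le> M / ln N"
      if a: "closed_segment a (- of_real \<delta>) \<subseteq> V - \<real>\<^sub>\<ge>\<^sub>0" "Re a = 0" for a
    proof -
      have "continuous_on (closed_segment a (- of_real \<delta>)) (\<lambda>w. G w * K w / w)"
        unfolding K_def using R a
        by (intro continuous_intros holomorphic_on_imp_continuous_on[OF holomorphic_on_subset[OF GV]]) auto
      from segment_decay[OF this a(2) _ V(1)] show ?thesis
        by (metis Re_complex_of_real uminus_complex.sel(1))
    qed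
    obtain M1 M2 where M: "\<And>N::nat. N > 1 \<Longrightarrow> norm (contour_integral l1 (\<lambda>w. G w * K w / w * of_nat N powr w)) \<le> M1 / ln N"
       "\<And>N::nat. N > 1 \<Longrightarrow> norm (contour_integral (linepath (\<i> * R) (- of_real \<delta>)) (\<lambda>w. G w * K w / w * of_nat N powr w)) \<le> M2 / ln N"
      using decay[OF seg(1)] decay[OF seg(2)] unfolding l1_def by auto
    have "norm (G 0 - f N 0) \<le> 3 * C / R + (M1 + M2) / ln (real N)" if N: "N > 1" "N \<ge> R" for N :: nat
    proof -
      define F1 where "F1 = (\<lambda>w. G w * of_nat N powr w * K w)"
      define F2 where "F2 = (\<lambda>w. f N w * of_nat N powr w * K w)"
      have hF1: "F1 holomorphic_on V" unfolding F1_def K_def using N R by (intro holomorphic_intros GV) auto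
      have hF2: "F2 holomorphic_on X" for X unfolding F2_def f_def K_def using N R by (intro holomorphic_intros) auto
      have I1: "contour_integral A (\<lambda>w. F1 w / w) - contour_integral (l1 +++ l2) (\<lambda>w. F1 w / w) = 2 * pi * \<i> * F1 0"
        unfolding A_def
      proof (rule half_circle_Cauchy[OF hF1 V(2,3,5) R])
        show "path_image (part_circlepath 0 R (- pi / 2) (pi / 2)) \<subseteq> V"
          using A_im V(7) by (auto simp: A_def)
        show "path_image (l1 +++ l2) \<subseteq> V" "path_image (l1 +++ l2) \<inter> \<real>\<^sub>\<ge>\<^sub>0 = {}"
          using seg by (auto simp: l1_def l2_def path_image_join closed_segment_commute)
      qed (auto simp: l1_def l2_def)
      have I2: "contour_integral A (\<lambda>w. F2 w / w) - contour_integral A' (\<lambda>w. F2 w / w) = 2 * pi * \<i> * F2 0"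
        unfolding A_def
      proof (rule half_circle_Cauchy[OF hF2[of UNIV] open_UNIV convex_UNIV UNIV_I R])
        have "w \<notin> \<real>\<^sub>\<ge>\<^sub>0" if "w \<in> path_image A'" for w
          using A'_im[OF that] R by (auto simp: complex_nonneg_Reals_iff complex_eq_iff cmod_def)
        thus "path_image A' \<inter> \<real>\<^sub>\<ge>\<^sub>0 = {}" by auto
      qed (use A_ends in \<open>auto simp: A'_def\<close>)
      have int: "(\<lambda>w. F w / w) contour_integrable_on \<gamma>" 
        if "F holomorphic_on X" "open X" "valid_path \<gamma>" "path_image \<gamma> \<subseteq> X - {0}" for F \<gamma> X
        by (rule contour_integrable_holomorphic_simple[of _ "X - {0}"])
           (use that in \<open>auto intro!: holomorphic_intros intro: holomorphic_on_subset\<close>)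
      have intA: "(\<lambda>w. F1 w / w) contour_integrable_on A" "(\<lambda>w. F2 w / w) contour_integrable_on A"
         "(\<lambda>w. F2 w / w) contour_integrable_on A'"
      proof -
        have "path_image A \<subseteq> V - {0}" "path_image A \<subseteq> UNIV - {0}" "path_image A' \<subseteq> UNIV - {0}"
          using R A_im A'_im V(7) by force+
        thus "(\<lambda>w. F1 w / w) contour_integrable_on A" "(\<lambda>w. F2 w / w) contour_integrable_on A"
          "(\<lambda>w. F2 w / w) contour_integrable_on A'"
          by (auto intro: int[OF hF1 V(2)] int[OF hF2[of UNIV] open_UNIV] simp: vA)
      qed
      have intl: "(\<lambda>w. F1 w / w) contour_integrable_on l1" "(\<lambda>w. F1 w / w) contour_integrable_on l2"
        using seg by (auto intro!: int[OF hF1 V(2)] simp: l1_def l2_def closed_segment_commute)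
      have "norm (contour_integral A (\<lambda>w. (F1 w - F2 w) / w)) \<le> 2 * C / R\<^sup>2 * R * \<bar>pi / 2 - - pi / 2\<bar>"
        unfolding A_def
      proof (rule contour_integral_bound_part_circlepath)
        show "(\<lambda>w. (F1 w - F2 w) / w) contour_integrable_on part_circlepath 0 R (- pi / 2) (pi / 2)"
          using contour_integrable_diff[OF intA(1,2)] by (simp add: A_def diff_divide_distrib)
        fix w assume "w \<in> path_image (part_circlepath 0 R (- pi / 2) (pi / 2))"
        hence w: "norm w = R" "Re w \<ge> 0" using A_im by (auto simp: A_def)
        have "norm ((F1 w - F2 w) / w) = norm (G w - f N w) * N powr Re w * (2 * Re w / R\<^sup>2)"
        proof -
          have *: "(F1 w - F2 w) / w = (G w - f N w) * of_nat N powr w * (K w / w)"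
            by (simp add: F1_def F2_def algebra_simps diff_divide_distrib)
          show ?thesis unfolding * norm_mult K[OF w(1)] using w N by (simp add: norm_powr_real_powr)
        qed
        also have "\<dots> \<le> 2 * C / R\<^sup>2"
        proof (cases "Re w = 0")
          case False
          hence wp: "Re w > 0" using w by simp
          have "norm (G w - f N w) \<le> C * N powr (- Re w) / Re w"
            unfolding f_def by (rule dirichlet_remainder_bound[OF c wp _ sums[OF wp]]) (use N in auto)
          hence "norm (G w - f N w) * N powr Re w * (2 * Re w / R\<^sup>2)
                  \<le> C * N powr (- Re w) / Re w * N powr Re w * (2 * Re w / R\<^sup>2)"
            using w by (intro mult_right_mono) auto
          also have "\<dots> = 2 * C / R\<^sup>2" using wp N by (simp add: powr_minus field_simps)
          finally show ?thesis .
        qed (use C in auto)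
        finally show "norm ((F1 w - F2 w) / w) \<le> 2 * C / R\<^sup>2" .
      qed (use C R in auto)
      also have "\<dots> = 2 * pi * C / R" using R by (simp add: field_simps power2_eq_square)
      finally have B1: "norm (contour_integral A (\<lambda>w. (F1 w - F2 w) / w)) \<le> 2 * pi * C / R" .
      have "norm (contour_integral A' (\<lambda>w. F2 w / w)) \<le> 4 * C / R\<^sup>2 * R * \<bar>pi / 2 - 3 * pi / 2\<bar>"
        unfolding A'_def
      proof (rule contour_integral_bound_part_circlepath)
        show "(\<lambda>w. F2 w / w) contour_integrable_on part_circlepath 0 R (3 * pi / 2) (pi / 2)"
          using intA(3) by (simp add: A'_def)
        fix w assume "w \<in> path_image (part_circlepath 0 R (3 * pi / 2) (pi / 2))"
        hence w: "norm w = R" "Re w \<le> 0" using A'_im by (auto simp: A'_def)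
        define x where "x = - Re w"
        have x: "x \<ge> 0" "x \<le> R" using w abs_Re_le_cmod[of w] by (auto simp: x_def)
        have "norm (F2 w / w) = norm (f N w) * N powr (-x) * (2 * x / R\<^sup>2)"
        proof -
          have *: "F2 w / w = f N w * of_nat N powr w * (K w / w)" by (simp add: F2_def)
          show ?thesis unfolding * norm_mult K[OF w(1)] using w N by (simp add: norm_powr_real_powr x_def)
        qed
        also have "\<dots> \<le> 4 * C / R\<^sup>2"
        proof (cases "x = 0")
          case False
          have "norm (f N w) \<le> (\<Sum>n=1..N. C * real n powr (x - 1))"
            unfolding f_def
          proof (rule sum_norm_le)
            fix n assume n: "n \<in> {1..N}"
            have "norm (c n * of_nat n powr (-w)) = norm (c n) * real n * real n powr (x - 1)"
              using n by (simp add: norm_mult norm_powr_real_powr x_def powr_diff field_simps)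
            also have "\<dots> \<le> C * n powr (x - 1)" by (intro mult_right_mono c) auto
            finally show "norm (c n * of_nat n powr (-w)) \<le> C * n powr (x - 1)" .
          qed
          also have "\<dots> \<le> C * (real N powr x / x + real N powr (x - 1))"
            unfolding sum_distrib_left[symmetric] using x False N C by (intro mult_left_mono sum_powr_le) auto
          finally have "norm (f N w) * N powr (-x) * (2 * x / R\<^sup>2) \<le>
              C * (real N powr x / x + real N powr (x - 1)) * N powr (-x) * (2 * x / R\<^sup>2)"
            using x by (intro mult_right_mono) auto
          also have "\<dots> = C * (1 + x / N) * (2 / R\<^sup>2)"
            using x False N by (simp add: powr_minus powr_diff field_simps)
          \<comment> \<open>This is where N >= R enters: x <= R gives x / N <= 1.\<close>
          also have "\<dots> \<le> C * (1 + 1) * (2 / R\<^sup>2)"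
            using x N C by (intro mult_right_mono mult_left_mono add_mono) auto
          finally show ?thesis by simp
        qed (use C in auto)
        finally show "norm (F2 w / w) \<le> 4 * C / R\<^sup>2" .
      qed (use C R in auto)
      also have "\<dots> = 4 * pi * C / R" using R by (simp add: field_simps power2_eq_square)
      finally have B2: "norm (contour_integral A' (\<lambda>w. F2 w / w)) \<le> 4 * pi * C / R" .
      have l: "contour_integral (l1 +++ l2) (\<lambda>w. F1 w / w) = contour_integral l1 (\<lambda>w. F1 w / w) + contour_integral l2 (\<lambda>w. F1 w / w)"
        using intl by (intro contour_integral_join) (auto simp: l1_def l2_def)
      have F1eq: "(\<lambda>w. F1 w / w) = (\<lambda>w. G w * K w / w * of_nat N powr w)"
        by (auto simp: F1_def)
      have "contour_integral l2 (\<lambda>w. F1 w / w) = - contour_integral (linepath (\<i> * R) (- of_real \<delta>)) (\<lambda>w. F1 w / w)"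
        unfolding l2_def by (subst reversepath_linepath[symmetric], rule contour_integral_reversepath) auto
      hence "norm (contour_integral l2 (\<lambda>w. F1 w / w)) \<le> M2 / ln N"
        using M(2)[OF N(1)] by (simp add: F1eq)
      moreover have "norm (contour_integral l1 (\<lambda>w. F1 w / w)) \<le> M1 / ln N"
        using M(1)[OF N(1)] by (simp add: F1eq)
      ultimately have B3: "norm (contour_integral (l1 +++ l2) (\<lambda>w. F1 w / w)) \<le> (M1 + M2) / ln N"
        unfolding l add_divide_distrib by (intro norm_triangle_mono) auto
      \<comment> \<open>Both Cauchy formulas contain the right arc \<open>A\<close>. Their
        difference leaves the remainder G - f there, f alone on \<open>A'\<close> and G alone on the
        segments.\<close>
      have "2 * pi * \<i> * (F1 0 - F2 0) = contour_integral A (\<lambda>w. (F1 w - F2 w) / w)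
             + contour_integral A' (\<lambda>w. F2 w / w) - contour_integral (l1 +++ l2) (\<lambda>w. F1 w / w)"
        using I1 I2 contour_integral_diff[OF intA(1,2)]
        by (simp add: diff_divide_distrib algebra_simps)
      hence "norm (2 * pi * \<i> * (F1 0 - F2 0)) \<le> 2 * pi * C / R + 4 * pi * C / R + (M1 + M2) / ln N"
        using norm_triangle_le_diff[OF add_mono[OF norm_triangle_mono[OF B1 B2] B3]] by simp
      also have "norm (2 * pi * \<i> * (F1 0 - F2 0)) = 2 * pi * norm (G 0 - f N 0)"
        using N by (simp add: norm_mult F1_def F2_def K_def)
      finally have "norm (G 0 - f N 0) \<le> (2 * pi * C / R + 4 * pi * C / R + (M1 + M2) / ln N) / (2 * pi)"
        by (subst pos_le_divide_eq) (auto simp: mult_ac)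
      also have "\<dots> = 3 * C / R + (M1 + M2) / ln N / (2 * pi)"
      proof -
        have "(2 * pi * C / R + 4 * pi * C / R) / (2 * pi) = 3 * C / R" using R by (simp add: divide_simps)
        thus ?thesis by (subst add_divide_distrib) simp
      qed
      also have "(M1 + M2) / ln N / (2 * pi) \<le> (M1 + M2) / ln N"
      proof -
        have "0 \<le> (M1 + M2) / ln N" using B3 norm_ge_zero order_trans by blast
        moreover have "2 * pi \<ge> 1" using pi_ge_two by linarith
        ultimately show ?thesis using divide_left_mono[of 1 "2 * pi" "(M1 + M2) / ln N"] by simp
      qed
      finally show ?thesis by simp
    qed
    moreover have "\<forall>\<^sub>F N in sequentially. N > 1 \<and> real N \<ge> R"
      by (intro eventually_conj eventually_gt_at_top) real_asymp
    ultimately show ?thesis by (intro exI[of _ "M1 + M2"]) (auto elim: eventually_mono)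
  qed
  have "(\<lambda>N. f N 0) \<longlonglongrightarrow> G 0"
  proof (rule tendstoI)
    fix e :: real assume e: "e > 0"
    \<comment> \<open>Makes 3 C / R <= e / 2; the summand 1 keeps R positive when C = 0.\<close>
    define R where "R = 6 * (C + 1) / e"
    have R: "R > 0" using e C by (simp add: R_def)
    obtain M where M: "\<forall>\<^sub>F N in sequentially. norm (G 0 - f N 0) \<le> 3 * C / R + M / ln (real N)"
      using *[OF R] by blast
    have "(\<lambda>N. M / ln (real N)) \<longlonglongrightarrow> 0" by real_asymp
    hence "\<forall>\<^sub>F N in sequentially. M / ln (real N) < e / 2" using e by (intro order_tendstoD) auto
    with M show "\<forall>\<^sub>F N in sequentially. dist (f N 0) (G 0) < e"
    proof eventually_elim
      case (elim N)
      have "3 * C / R \<le> e / 2" using e C by (simp add: R_def field_simps)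
      hence "norm (G 0 - f N 0) < e" using elim by argo
      thus ?case by (simp add: dist_norm norm_minus_commute)
    qed
  qed
  moreover have "f N 0 = (\<Sum>n<Suc N. c n)" for N
    unfolding f_def by (rule sum.mono_neutral_cong_left) (auto simp: c Suc_le_eq)
  ultimately show ?thesis unfolding sums_def by (subst filterlim_sequentially_Suc[symmetric]) simp
qed

section \<open>Series of holomorphic functions and Dirichlet products\<close>

lemma holomorphic_suminf:
  fixes f :: "nat \<Rightarrow> complex \<Rightarrow> complex"
  assumes A: "open A" and f: "\<And>n. f n holomorphic_on A"
    and bd: "\<And>z. z \<in> A \<Longrightarrow> \<exists>d>0. \<exists>M. cball z d \<subseteq> A \<and> summable M \<and> (\<forall>n. \<forall>w\<in>cball z d. norm (f n w) \<le> M n)"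
  shows "(\<lambda>z. \<Sum>n. f n z) holomorphic_on A" "\<And>z. z \<in> A \<Longrightarrow> summable (\<lambda>n. f n z)"
proof -
  show "(\<lambda>z. \<Sum>n. f n z) holomorphic_on A"
  proof (rule holomorphic_uniform_sequence[OF A, where f = "\<lambda>N z. \<Sum>n<N. f n z"])
    fix z assume z: "z \<in> A"
    obtain d M where "d > 0" "cball z d \<subseteq> A" "summable M" "\<forall>n. \<forall>w\<in>cball z d. norm (f n w) \<le> M n"
      using bd[OF z] by auto
    thus "\<exists>d>0. cball z d \<subseteq> A \<and> uniform_limit (cball z d) (\<lambda>N z. \<Sum>n<N. f n z) (\<lambda>z. \<Sum>n. f n z) sequentially"
      by (intro exI[of _ d] conjI Weierstrass_m_test) auto
  qed (intro holomorphic_intros f)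
  fix z assume z: "z \<in> A"
  obtain d M where dM: "d > 0" "summable M" "\<forall>n. \<forall>w\<in>cball z d. norm (f n w) \<le> M n"
    using bd[OF z] by auto
  have "norm (f n z) \<le> M n" for n using dM(1) by (intro dM(3)[rule_format]) simp
  thus "summable (\<lambda>n. f n z)" by (rule summable_comparison_test'[OF dM(2)])
qed

lemma summable_Suc_powr: "x < -1 \<Longrightarrow> summable (\<lambda>n. real (Suc n) powr x)"
  using summable_real_powr_iff[of x] summable_Suc_iff[of "\<lambda>n. real n powr x"] by simp

text \<open>First order Taylor expansion of x^a on the segment from n to n + 1. For Re a <= 2 the
  second derivative is largest at the left end, whence the power n^(Re a - 2).\<close>

lemma powr_Taylor_bound:
  fixes a :: complex
  assumes n: "n > 0" and a: "Re a \<le> 2"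
  shows "norm (of_nat (Suc n) powr a - of_nat n powr a - a * of_nat n powr (a - 1))
           \<le> norm a * norm (a - 1) * real n powr (Re a - 2)"
proof -
  define A where "A = closed_segment (of_nat n :: complex) (of_nat (Suc n))"
  define f where "f = (\<lambda>i x :: complex. if i = 0 then x powr a else if i = Suc 0 then a * x powr (a - 1)
        else a * (a - 1) * x powr (a - 2))"
  have A: "\<exists>t. t \<ge> real n \<and> x = of_real t" if x: "x \<in> A" for x
  proof -
    obtain u where u: "0 \<le> u" "x = (1 - u) *\<^sub>R of_nat n + u *\<^sub>R of_nat (Suc n)"
      using x by (auto simp: A_def closed_segment_def)
    hence "x = of_real (real n + u)" by (simp add: scaleR_conv_of_real algebra_simps)
    thus ?thesis using u(1) by (intro exI[of _ "real n + u"]) auto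
  qed
  have A': "x \<notin> \<real>\<^sub>\<le>\<^sub>0" if "x \<in> A" for x
    using A[OF that] n by (auto simp: complex_nonpos_Reals_iff)
  have "norm (f 0 (of_nat (Suc n)) - (\<Sum>i\<le>1. f i (of_nat n) * (of_nat (Suc n) - of_nat n) ^ i / fact i))
         \<le> norm a * norm (a - 1) * real n powr (Re a - 2) * norm (of_nat (Suc n) - of_nat n :: complex) ^ Suc 1 / fact 1"
  proof (rule complex_Taylor[where S = A and f = f and n = 1 and w = "of_nat n" and z = "of_nat (Suc n)"
        and B = "norm a * norm (a - 1) * real n powr (Re a - 2)"])
    fix i x assume x: "x \<in> A" and i: "i \<le> (1::nat)"
    have D: "((\<lambda>x. x powr b) has_field_derivative b * x powr (b - 1)) (at x within A)" for b
      by (rule has_field_derivative_at_within[OF has_field_derivative_powr[OF A'[OF x]]])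
    have "((\<lambda>x. x powr a) has_field_derivative a * x powr (a - 1)) (at x within A)"
      "((\<lambda>x. a * x powr (a - 1)) has_field_derivative a * ((a - 1) * x powr (a - 1 - 1))) (at x within A)"
      by (rule D DERIV_cmult[OF D])+
    moreover have "i = 0 \<or> i = 1" using i by auto
    ultimately show "(f i has_field_derivative f (Suc i) x) (at x within A)"
      by (auto simp: f_def algebra_simps)
  next
    fix x assume x: "x \<in> A"
    obtain t where t: "t \<ge> real n" "x = of_real t" using A[OF x] by auto
    have "norm (x powr (a - 2)) = t powr (Re a - 2)" using t n by (simp add: norm_powr_real_powr)
    also have "\<dots> \<le> real n powr (Re a - 2)" using a n t by (intro powr_mono2') auto
    finally show "norm (f (Suc 1) x) \<le> norm a * norm (a - 1) * real n powr (Re a - 2)"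
      by (simp add: f_def norm_mult mult_left_mono)
  qed (auto simp only: A_def ends_in_segment convex_closed_segment)
  moreover have "(\<Sum>i\<le>1. f i (of_nat n) * (of_nat (Suc n) - of_nat n) ^ i / fact i) = of_nat n powr a + a * of_nat n powr (a - 1)"
    by (simp add: f_def)
  moreover have "f 0 (of_nat (Suc n)) = of_nat (Suc n) powr a" by (simp add: f_def)
  moreover have "norm (of_nat (Suc n) - of_nat n :: complex) ^ Suc 1 / fact 1 = 1" by simp
  ultimately show ?thesis by (simp only: diff_diff_eq times_divide_eq_right[symmetric] mult_1_right)
qed

text \<open>Without its linear part the n-th term is O(n^r * n^(-r - Re s - 1)), summable for Re s >
  0 locally uniformly in s. Coefficients 1 with r = 0 give (s - 1) zeta(s); coefficients psi(n) - n
  with r = 1 give the correction series for psi.\<close>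

lemma Taylor_series_holomorphic:
  fixes c :: "nat \<Rightarrow> complex"
  assumes c: "\<And>n. norm (c n) \<le> K * real (Suc n) ^ r"
  defines "f \<equiv> (\<lambda>n s. c n * (of_nat (Suc (Suc n)) powr (1 - of_nat r - s) - of_nat (Suc n) powr (1 - of_nat r - s)
              - (1 - of_nat r - s) * of_nat (Suc n) powr (- of_nat r - s)))"
  shows "(\<lambda>s. \<Sum>n. f n s) holomorphic_on {s. Re s > 0}" "\<And>s. Re s > 0 \<Longrightarrow> summable (\<lambda>n. f n s)"
proof -
  have K: "K \<ge> 0" using order_trans[OF norm_ge_zero c[of 0]] by simp
  have bd: "norm (f n s) \<le> K * (norm s + r + 1)\<^sup>2 * real (Suc n) powr (- Re s - 1)" if "Re s > 0" for n s
  proof -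
    have "1 - of_nat r - s - 1 = - of_nat r - s" by simp
    hence "norm (f n s) \<le> (K * real (Suc n) ^ r) * (norm (1 - of_nat r - s) * norm (- of_nat r - s) * real (Suc n) powr (Re (1 - of_nat r - s) - 2))"
      unfolding f_def norm_mult[of "c n"] using that powr_Taylor_bound[of "Suc n" "1 - of_nat r - s"]
      by (intro mult_mono c) (auto simp: K)
    also have "\<dots> = K * (norm (1 - of_nat r - s) * norm (- of_nat r - s)) * (real (Suc n) powr r * real (Suc n) powr (- real r - Re s - 1))"
    proof -
      have "Re (1 - of_nat r - s) - 2 = - real r - Re s - 1" by simp
      thus ?thesis by (simp add: powr_realpow)
    qed
    also have "real (Suc n) powr r * real (Suc n) powr (- real r - Re s - 1) = real (Suc n) powr (- Re s - 1)"
      by (simp add: powr_add[symmetric])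
    also have "norm (1 - of_nat r - s) * norm (- of_nat r - s) \<le> (norm s + r + 1) * (norm s + r + 1)"
    proof -
      have "norm (1 - of_nat r - s) \<le> norm (1 - of_nat r :: complex) + norm s" by (rule norm_triangle_ineq4)
      also have "norm (1 - of_nat r :: complex) \<le> norm (1::complex) + norm (of_nat r :: complex)" by (rule norm_triangle_ineq4)
      finally have "norm (1 - of_nat r - s) \<le> norm s + r + 1" by simp
      moreover have "norm (- of_nat r - s) \<le> norm s + r + 1" using norm_triangle_ineq4[of "- of_nat r" s] by simp
      ultimately show ?thesis by (auto intro!: mult_mono)
    qed
    finally show ?thesis using K by (simp add: mult_right_mono mult_left_mono power2_eq_square)
  qed
  have 1: "f n holomorphic_on {s. Re s > 0}" for n unfolding f_def by (intro holomorphic_intros)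
  have 2: "\<exists>d>0. \<exists>M. cball z d \<subseteq> {s. Re s > 0} \<and> summable M \<and> (\<forall>n. \<forall>w\<in>cball z d. norm (f n w) \<le> M n)"
    if z: "z \<in> {s. Re s > 0}" for z
  proof -
    define d where "d = Re z / 2"
    have d: "d > 0" using z by (simp add: d_def)
    have w: "Re w \<ge> d \<and> norm w \<le> norm z + d" if "w \<in> cball z d" for w
    proof -
      have "\<bar>Re (z - w)\<bar> \<le> d" "norm (w - z) \<le> d" using that abs_Re_le_cmod[of "z - w"]
        by (auto simp: dist_norm norm_minus_commute)
      moreover from this(1) have "Re z - Re w \<le> d" by simp
      ultimately show ?thesis using norm_triangle_ineq[of z "w - z"] by (auto simp: d_def)
    qed
    define M where "M = (\<lambda>n. K * (norm z + d + r + 1)\<^sup>2 * real (Suc n) powr (- d - 1))"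
    have "norm (f n w) \<le> M n" if "w \<in> cball z d" for n w
    proof -
      have "norm (f n w) \<le> K * (norm w + r + 1)\<^sup>2 * real (Suc n) powr (- Re w - 1)"
        by (rule bd) (use w[OF that] d in auto)
      also have "\<dots> \<le> M n" unfolding M_def using w[OF that] d K
        by (intro mult_mono mult_left_mono power_mono powr_mono) auto
      finally show ?thesis .
    qed
    moreover have "summable M" unfolding M_def using d by (intro summable_mult summable_Suc_powr) auto
    moreover have "cball z d \<subseteq> {s. Re s > 0}"
    proof
      fix s assume "s \<in> cball z d"
      from w[OF this] d show "s \<in> {s. Re s > 0}" by simp
    qed
    ultimately show ?thesis using d by (intro exI[of _ d] conjI exI[of _ M] allI ballI)
  qed
  show "(\<lambda>s. \<Sum>n. f n s) holomorphic_on {s. Re s > 0}"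
    by (rule holomorphic_suminf(1)[OF open_halfspace_Re_gt 1 2])
  show "summable (\<lambda>n. f n s)" if "Re s > 0" for s
  proof -
    have "s \<in> {s. Re s > 0}" using that by simp
    thus ?thesis by (rule holomorphic_suminf(2)[OF open_halfspace_Re_gt 1 2, rotated -1])
  qed
qed

section \<open>Dirichlet convolution of absolutely convergent series\<close>

lemma has_sum_pos_nat:
  fixes f :: "nat \<Rightarrow> 'a :: banach"
  assumes "summable (\<lambda>n. norm (f n))" "f 0 = 0"
  shows "(f has_sum suminf f) {0<..}"
proof -
  have "(f has_sum suminf f) UNIV"
    using assms(1) summable_sums[OF summable_norm_cancel[OF assms(1)]] by (rule norm_summable_imp_has_sum)
  also have "?this \<longleftrightarrow> ?thesis" using assms by (intro has_sum_cong_neutral) auto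
  finally show ?thesis .
qed

text \<open>Absolute convergence allows the double sum over (d, e) to be regrouped by N = d * e.
  Index 0 is kept apart since every d divides 0: its divisor sum runs over an infinite set and is 0
  by convention.\<close>

lemma dirichlet_product_sums:
  fixes f g :: "nat \<Rightarrow> complex"
  assumes f: "summable (\<lambda>n. norm (f n))" "f 0 = 0" and g: "summable (\<lambda>n. norm (g n))" "g 0 = 0"
  shows "(\<lambda>N. \<Sum>d | d dvd N. f d * g (N div d)) sums (suminf f * suminf g)"
proof -
  define A where "A = {0::nat<..} \<times> {0::nat<..}"
  have "(\<lambda>p. norm (f (fst p)) * norm (g (snd p))) summable_on A"
    unfolding A_def
  proof (rule summable_on_SigmaI)
    fix x :: nat
    show "((\<lambda>y. norm (f (fst (x, y))) * norm (g (snd (x, y)))) has_sum (norm (f x) * suminf (\<lambda>n. norm (g n)))) {0<..}"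
      unfolding fst_conv snd_conv by (rule has_sum_cmult_right[OF has_sum_pos_nat]) (use g in auto)
    show "(\<lambda>x. norm (f x) * suminf (\<lambda>n. norm (g n))) summable_on {0<..}"
      by (rule summable_on_cmult_left[OF has_sum_imp_summable[OF has_sum_pos_nat]]) (use f in auto)
  qed auto
  hence "(\<lambda>p. f (fst p) * g (snd p)) summable_on A"
    
    by (intro abs_summable_summable[of "\<lambda>p. f (fst p) * g (snd p)" A, unfolded norm_mult])
  hence sm: "(\<lambda>p. f (fst p) * g (snd p)) summable_on {0<..} \<times> {0<..}" unfolding A_def .
  have "((\<lambda>p. f (fst p) * g (snd p)) has_sum (suminf f * suminf g)) A"
    unfolding A_def
  proof (rule has_sum_SigmaI[OF _ _ sm])
    show "((\<lambda>x. f x * suminf g) has_sum suminf f * suminf g) {0<..}"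
      by (intro has_sum_cmult_left has_sum_pos_nat f)
    show "((\<lambda>y. f (fst (x, y)) * g (snd (x, y))) has_sum f x * suminf g) {0<..}" for x
      unfolding fst_conv snd_conv by (intro has_sum_cmult_right has_sum_pos_nat g)
  qed
  also have "?this \<longleftrightarrow> ((\<lambda>p. f (snd p) * g (fst p div snd p)) has_sum (suminf f * suminf g)) (Sigma {0<..} (\<lambda>N. {d. d dvd N}))"
    unfolding A_def
    by (rule has_sum_reindex_bij_witness[of _ "\<lambda>p. (snd p, fst p div snd p)" "\<lambda>p. (fst p * snd p, fst p)"])
       (auto elim!: dvdE simp del: One_nat_def)
  finally have "((\<lambda>N. \<Sum>d | d dvd N. f d * g (N div d)) has_sum (suminf f * suminf g)) {0<..}"
  proof (rule has_sum_Sigma')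
    fix N :: nat assume "N \<in> {0<..}"
    thus "((\<lambda>y. f (snd (N, y)) * g (fst (N, y) div snd (N, y))) has_sum (\<Sum>d | d dvd N. f d * g (N div d))) {d. d dvd N}"
      by (intro has_sum_finiteI) auto
  qed
  also have "?this \<longleftrightarrow> ((\<lambda>N. \<Sum>d | d dvd N. f d * g (N div d)) has_sum (suminf f * suminf g)) UNIV"
    by (intro has_sum_cong_neutral) auto
  finally show ?thesis by (rule has_sum_imp_sums)
qed

section \<open>The zeta function on the line Re s = 1\<close>

lemma norm_nat_powr: "norm (of_nat n powr s :: complex) = real n powr Re s"
  by (cases "n = 0") (simp_all add: norm_powr_real_powr)

lemma summable_ln_powr:
  assumes "\<sigma> > 1"
  shows "summable (\<lambda>n. ln (real n) * real n powr (-\<sigma>))"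
proof (rule summable_comparison_test_bigo)
  show "(\<lambda>n. ln (real n) * real n powr (-\<sigma>)) \<in> O(\<lambda>n. real n powr (-(1 + \<sigma>) / 2))"
    using assms by real_asymp
  show "summable (\<lambda>n. norm (real n powr (-(1 + \<sigma>) / 2)))"
    using assms by (simp add: summable_real_powr_iff)
qed

lemma mangoldt_le_ln: "mangoldt n \<le> ln (real n)"
  by (cases "n = 0") (auto intro: mangoldt_le)

lemma summable_norm_nat_powr:
  "Re s > 1 \<Longrightarrow> summable (\<lambda>n. norm (of_nat n powr (-s) :: complex))"
  by (simp add: norm_nat_powr summable_real_powr_iff)

lemma summable_norm_mangoldt_powr:
  assumes "Re s > 1"
  shows "summable (\<lambda>n. norm (mangoldt n * of_nat n powr (-s) :: complex))"
proof (rule summable_comparison_test'[OF summable_ln_powr[OF assms]])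
  fix n :: nat
  show "norm (norm (mangoldt n * of_nat n powr (-s) :: complex)) \<le> ln (real n) * real n powr (- Re s)"
    by (simp add: norm_mult norm_nat_powr abs_mult mangoldt_le_ln mult_right_mono)
qed

definition zeta_series :: "complex \<Rightarrow> complex" where
  "zeta_series s = (\<Sum>n. of_nat n powr (-s))"

definition mangoldt_series :: "complex \<Rightarrow> complex" where
  "mangoldt_series s = (\<Sum>n. mangoldt n * of_nat n powr (-s))"

text \<open>This is \<open>(s - 1) \<zeta>(s)\<close>, with \<open>\<integral> x\<^sup>-\<^sup>s dx\<close> subtracted from each \<open>n\<^sup>-\<^sup>s\<close> so that the series
  converges for \<open>Re s > 0\<close>.\<close>
definition zeta1 :: "complex \<Rightarrow> complex" where
  "zeta1 s = 1 + (\<Sum>n. of_nat (Suc (Suc n)) powr (1 - s) - of_nat (Suc n) powr (1 - s)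
                       - (1 - s) * of_nat (Suc n) powr (- s))"

lemma zeta1_holomorphic: "zeta1 holomorphic_on {s. Re s > 0}"
  unfolding zeta1_def using Taylor_series_holomorphic(1)[of "\<lambda>_. 1" 1 0]
  by (intro holomorphic_on_add[OF holomorphic_on_const]) simp

lemma zeta1_1: "zeta1 1 = 1"
proof -
  have "of_nat (Suc n) \<noteq> (0 :: complex)" for n by (rule of_nat_neq_0)
  thus ?thesis by (simp add: zeta1_def del: of_nat_Suc)
qed

lemma tendsto_nat_powr_0:
  assumes "Re s < 0"
  shows "(\<lambda>n. of_nat n powr s :: complex) \<longlonglongrightarrow> 0"
proof -
  have "(\<lambda>n. real n powr Re s) \<longlonglongrightarrow> 0" using assms by real_asymp
  thus ?thesis by (subst tendsto_norm_zero_iff[symmetric]) (simp add: norm_nat_powr)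
qed

text \<open>The differences of n^(1-s) telescope to -1, which cancels the leading 1 of
  \<open>zeta1\<close>.\<close>

lemma zeta1_eq:
  assumes s: "Re s > 1"
  shows "zeta1 s = (s - 1) * zeta_series s"
proof -
  have "summable (\<lambda>n. of_nat n powr (-s) :: complex)"
    by (rule summable_norm_cancel[OF summable_norm_nat_powr[OF s]])
  hence "(\<lambda>n. of_nat n powr (-s) :: complex) sums zeta_series s"
    unfolding zeta_series_def by (rule summable_sums)
  hence "(\<lambda>n. of_nat (Suc n) powr (-s) :: complex) sums zeta_series s"
    by (subst sums_Suc_iff) simp
  hence "(\<lambda>n. (s - 1) * of_nat (Suc n) powr (-s)) sums ((s - 1) * zeta_series s)"
    by (rule sums_mult)
  moreover have "(\<lambda>n. of_nat (Suc n) powr (1 - s) :: complex) \<longlonglongrightarrow> 0"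
    by (rule LIMSEQ_Suc[OF tendsto_nat_powr_0]) (use s in simp)
  from telescope_sums[OF this]
  have "(\<lambda>n. of_nat (Suc (Suc n)) powr (1 - s) - of_nat (Suc n) powr (1 - s) :: complex) sums (- 1)"
    by simp
  ultimately have "(\<lambda>n. (of_nat (Suc (Suc n)) powr (1 - s) - of_nat (Suc n) powr (1 - s)) + (s - 1) * of_nat (Suc n) powr (-s))
     sums (- 1 + (s - 1) * zeta_series s)"
    by (intro sums_add)
  hence "(\<lambda>n. of_nat (Suc (Suc n)) powr (1 - s) - of_nat (Suc n) powr (1 - s) - (1 - s) * of_nat (Suc n) powr (-s))
     sums (- 1 + (s - 1) * zeta_series s)"
    by (rule sums_cong[THEN iffD1, rotated]) (simp add: algebra_simps)
  from sums_unique[OF this, symmetric] show ?thesis unfolding zeta1_def by simp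
qed

text \<open>The convolution identity behind it: Lambda(d) summed over the divisors d of n is ln
  n.\<close>

lemma zeta_mangoldt_sums:
  assumes s: "Re s > 1"
  shows "(\<lambda>n. of_real (ln (real n)) * of_nat n powr (-s)) sums (mangoldt_series s * zeta_series s)"
proof -
  have "(\<lambda>N. \<Sum>d | d dvd N. mangoldt d * of_nat d powr (-s) * of_nat (N div d) powr (-s) :: complex)
          sums (mangoldt_series s * zeta_series s)"
    unfolding mangoldt_series_def zeta_series_def
    by (rule dirichlet_product_sums[OF summable_norm_mangoldt_powr[OF s] _ summable_norm_nat_powr[OF s]]) simp_all
  moreover have "(\<Sum>d | d dvd N. mangoldt d * of_nat d powr (-s) * of_nat (N div d) powr (-s) :: complex)
      = of_real (ln (real N)) * of_nat N powr (-s)" for N :: nat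
  proof (cases "N = 0")
    case False
    have "(\<Sum>d | d dvd N. mangoldt d * of_nat d powr (-s) * of_nat (N div d) powr (-s) :: complex)
       = (\<Sum>d | d dvd N. mangoldt d * of_nat N powr (-s))"
    proof (rule sum.cong[OF refl])
      fix d assume "d \<in> {d. d dvd N}"
      hence "N = d * (N div d)" by simp
      hence "(of_nat N :: complex) = of_nat d * of_nat (N div d)" by (metis of_nat_mult)
      moreover have "(of_nat d * of_nat (N div d) :: complex) powr (-s) = of_nat d powr (-s) * of_nat (N div d) powr (-s)"
        by (rule powr_times_real) auto
      ultimately show "mangoldt d * of_nat d powr (-s) * of_nat (N div d) powr (-s) = (mangoldt d * of_nat N powr (-s) :: complex)"
        by simp
    qed
    also have "\<dots> = (\<Sum>d | d dvd N. mangoldt d) * of_nat N powr (-s)" by (simp add: sum_distrib_right)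
    finally show ?thesis using False by (simp add: mangoldt_sum)
  qed simp
  ultimately show ?thesis by simp
qed

text \<open>Termwise differentiation produces the coefficients - ln n, so by
  \<open>zeta_mangoldt_sums\<close> the function \<open>mangoldt_series\<close> is -
  zeta'/zeta.\<close>

lemma zeta_series_deriv:
  assumes s: "Re s > 1"
  shows "(zeta_series has_field_derivative (- (mangoldt_series s * zeta_series s))) (at s)"
proof -
  define X where "X = {s. Re s > 1}"
  have X: "open X" unfolding X_def by (rule open_halfspace_Re_gt)
  have "\<exists>g g'. \<forall>x\<in>X. ((\<lambda>n. of_nat n powr (-x)) sums g x) \<and>
      ((\<lambda>n. - (of_real (ln (real n)) * of_nat n powr (-x))) sums g' x) \<and> (g has_field_derivative g' x) (at x)"
  proof (rule series_and_derivative_comparison_complex[OF X])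
    fix n :: nat and x assume "x \<in> X"
    show "((\<lambda>x. of_nat n powr (-x)) has_field_derivative (- (of_real (ln (real n)) * of_nat n powr (-x)))) (at x)"
    proof (cases "n = 0")
      case False
      thus ?thesis by (auto simp: powr_def intro!: derivative_eq_intros simp flip: Ln_of_nat)
    qed simp
  next
    fix x assume x: "x \<in> X"
    define d where "d = (Re x - 1) / 2"
    have d: "d > 0" using x by (simp add: d_def X_def)
    define h where "h = (\<lambda>n. of_real (real n powr (- (1 + d))) :: complex)"
    have "summable h" unfolding h_def
      by (rule summable_of_real) (use d in \<open>simp add: summable_real_powr_iff\<close>)
    moreover have "range h \<subseteq> \<real>\<^sub>\<ge>\<^sub>0" by (auto simp: h_def)
    moreover have "\<forall>y\<in>ball x d \<inter> X. norm (of_nat n powr (-y) :: complex) \<le> norm (h n)" if "n > 0" for n :: nat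
    proof
      fix y assume "y \<in> ball x d \<inter> X"
      hence "\<bar>Re (x - y)\<bar> < d" using abs_Re_le_cmod[of "x - y"] by (auto simp: dist_norm)
      hence "Re x - Re y < d" by simp
      hence "- Re y \<le> - (1 + d)" by (simp add: d_def field_simps)
      thus "norm (of_nat n powr (-y) :: complex) \<le> norm (h n)"
        using that by (simp add: norm_nat_powr h_def powr_mono)
    qed
    hence "\<forall>\<^sub>F n in sequentially. \<forall>y\<in>ball x d \<inter> X. norm (of_nat n powr (-y) :: complex) \<le> norm (h n)"
      by (intro eventually_sequentiallyI[of 1]) auto
    ultimately show "\<exists>d (h :: nat \<Rightarrow> complex). 0 < d \<and> summable h \<and> range h \<subseteq> \<real>\<^sub>\<ge>\<^sub>0 \<and>
         (\<forall>\<^sub>F n in sequentially. \<forall>y\<in>ball x d \<inter> X. norm (of_nat n powr (-y) :: complex) \<le> norm (h n))"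
      using d by (intro exI[of _ d] exI[of _ h] conjI)
  qed
  then obtain g g' where g: "\<And>x. x \<in> X \<Longrightarrow> (\<lambda>n. of_nat n powr (-x)) sums g x"
      "\<And>x. x \<in> X \<Longrightarrow> (\<lambda>n. - (of_real (ln (real n)) * of_nat n powr (-x))) sums g' x"
      "\<And>x. x \<in> X \<Longrightarrow> (g has_field_derivative g' x) (at x)" by auto
  have sX: "s \<in> X" using s by (simp add: X_def)
  have "g' s = - (mangoldt_series s * zeta_series s)"
    by (rule sums_unique2[OF g(2)[OF sX] sums_minus[OF zeta_mangoldt_sums[OF s]]])
  moreover have "(zeta_series has_field_derivative g' s) (at s)"
    by (rule has_field_derivative_transform_within_open[OF g(3)[OF sX] X sX])
       (use g(1) in \<open>auto simp: zeta_series_def sums_iff\<close>)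
  ultimately show ?thesis by simp
qed

text \<open>A logarithmic derivative without quotients, as it is used before zeros of
  \<open>zeta1\<close> are excluded.\<close>

lemma zeta1_logderiv:
  assumes s: "Re s > 1"
  shows "deriv zeta1 s * (s - 1) = zeta1 s * (1 - (s - 1) * mangoldt_series s)"
proof -
  have "((\<lambda>s. (s - 1) * zeta_series s) has_field_derivative
      (zeta_series s + (s - 1) * (- (mangoldt_series s * zeta_series s)))) (at s)"
    by (auto intro!: derivative_eq_intros zeta_series_deriv s)
  hence "(zeta1 has_field_derivative (zeta_series s + (s - 1) * (- (mangoldt_series s * zeta_series s)))) (at s)"
    by (rule has_field_derivative_transform_within_open[OF _ open_halfspace_Re_gt[of 1]])
       (use s in \<open>auto simp: zeta1_eq\<close>)
  hence *: "deriv zeta1 s = zeta_series s + (s - 1) * (- (mangoldt_series s * zeta_series s))"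
    by (rule DERIV_imp_deriv)
  show ?thesis unfolding * zeta1_eq[OF s] by (simp add: algebra_simps)
qed

section \<open>Orders of zeros read off from logarithmic derivatives\<close>

abbreviation scaled_logderiv :: "(complex \<Rightarrow> complex) \<Rightarrow> complex \<Rightarrow> real \<Rightarrow> complex" where
  "scaled_logderiv f s h \<equiv> of_real h * deriv f (s + of_real h) / f (s + of_real h)"

text \<open>Factoring f(w) = (w - s0)^m g(w) with g(s0) nonzero shows that h f'/f tends to m, the
  order of vanishing at s0. The point \<open>a\<close> ensures that f is not identically
  zero.\<close>

lemma logderiv_limit:
  assumes f: "f holomorphic_on X" "open X" "connected X" "s0 \<in> X" and nz: "a \<in> X" "f a \<noteq> 0"
  obtains m :: nat where "m = 0 \<longleftrightarrow> f s0 \<noteq> 0" "(scaled_logderiv f s0 \<longlongrightarrow> of_nat m) (at_right 0)"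
    "\<forall>\<^sub>F h in at_right 0. f (s0 + of_real h) \<noteq> 0"
proof -
  obtain g r n where gr: "n = 0 \<longleftrightarrow> f s0 \<noteq> 0" "0 < r" "g holomorphic_on ball s0 r"
     "\<And>w. w \<in> ball s0 r \<Longrightarrow> f w = (w - s0) ^ n * g w" "\<And>w. w \<in> ball s0 r \<Longrightarrow> g w \<noteq> 0"
  proof (cases "f s0 = 0")
    case True
    have "\<not> f constant_on X" using True nz f(4) unfolding constant_on_def by metis
    then obtain g r n where "0 < n" "0 < r" "g holomorphic_on ball s0 r"
       "\<And>w. w \<in> ball s0 r \<Longrightarrow> f w = (w - s0) ^ n * g w" "\<And>w. w \<in> ball s0 r \<Longrightarrow> g w \<noteq> 0"
      using holomorphic_factor_zero_nonconstant[OF f(1-3) f(4) True] by metis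
    thus thesis using that[of n r g] True by simp
  next
    case False
    have "open (X \<inter> f -` (- {0}))"
      by (rule continuous_open_preimage[OF holomorphic_on_imp_continuous_on[OF f(1)] f(2)]) auto
    moreover have "s0 \<in> X \<inter> f -` (- {0})" using f(4) False by simp
    ultimately obtain r where r: "0 < r" "ball s0 r \<subseteq> X \<inter> f -` (- {0})" by (meson open_contains_ball)
    have "f holomorphic_on ball s0 r" by (rule holomorphic_on_subset[OF f(1)]) (use r(2) in blast)
    moreover have "f w \<noteq> 0" if "w \<in> ball s0 r" for w using r(2) that by blast
    ultimately show thesis using that[of 0 r f] r(1) False by simp
  qed
  have ev: "\<forall>\<^sub>F h in at_right (0::real). 0 < h \<and> s0 + of_real h \<in> ball s0 r"
    using eventually_at_right_less[of 0] eventually_at_right_real[OF gr(2)]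
    by eventually_elim (auto simp: dist_norm)
  have lim: "((\<lambda>h. \<phi> (s0 + of_real h)) \<longlongrightarrow> \<phi> s0) (at_right 0)" if \<phi>: "\<phi> holomorphic_on ball s0 r" for \<phi>
  proof -
    have "isCont \<phi> s0"
      using holomorphic_on_imp_continuous_on[OF \<phi>] gr(2) by (simp add: continuous_on_eq_continuous_at)
    moreover have "((\<lambda>h. s0 + of_real h) \<longlongrightarrow> s0 + of_real 0) (at_right 0)" by (intro tendsto_intros)
    ultimately show ?thesis using isCont_tendsto_compose[of s0 \<phi> "\<lambda>h. s0 + of_real h"] by simp
  qed
  have s0b: "s0 \<in> ball s0 r" using gr by simp
  have fd: "deriv f w = of_nat n * (w - s0) ^ (n - 1) * g w + (w - s0) ^ n * deriv g w" if w: "w \<in> ball s0 r" for w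
  proof -
    have "(g has_field_derivative deriv g w) (at w)" by (rule holomorphic_derivI[OF gr(3) open_ball w])
    hence "((\<lambda>w. (w - s0) ^ n * g w) has_field_derivative (of_nat n * (w - s0) ^ (n - 1) * g w + (w - s0) ^ n * deriv g w)) (at w)"
      by (auto intro!: derivative_eq_intros)
    hence "(f has_field_derivative (of_nat n * (w - s0) ^ (n - 1) * g w + (w - s0) ^ n * deriv g w)) (at w)"
      by (rule has_field_derivative_transform_within_open[OF _ open_ball w]) (use gr(4) in auto)
    thus ?thesis by (rule DERIV_imp_deriv)
  qed
  show ?thesis
  proof (rule that[OF gr(1)])
    have "((\<lambda>h. of_nat n + scaled_logderiv g s0 h) \<longlongrightarrow> of_nat n + of_real 0 * deriv g s0 / g s0) (at_right 0)"
      by (intro tendsto_intros lim gr(3) holomorphic_deriv[OF gr(3) open_ball] gr(5) s0b)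
    moreover have "\<forall>\<^sub>F h in at_right 0. of_nat n + scaled_logderiv g s0 h = scaled_logderiv f s0 h"
      using ev
    proof eventually_elim
      case (elim h)
      have "g (s0 + of_real h) \<noteq> 0" using gr(5) elim by blast
      thus ?case using elim by (cases n) (simp_all add: fd gr(4) field_simps)
    qed
    ultimately show "(scaled_logderiv f s0 \<longlongrightarrow> of_nat n) (at_right 0)"
      using Lim_transform_eventually by force
    show "\<forall>\<^sub>F h in at_right 0. f (s0 + of_real h) \<noteq> 0"
      using ev by eventually_elim (use gr in auto)
  qed
qed

abbreviation scaled_mangoldt :: "complex \<Rightarrow> real \<Rightarrow> complex" where
  "scaled_mangoldt s h \<equiv> of_real h * mangoldt_series (s + of_real h)"

text \<open>From - zeta'/zeta = 1/(s-1) - zeta1'/zeta1: the pole at 1 contributes 1, a zero of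
  \<open>zeta1\<close> subtracts its order m.\<close>

lemma mangoldt_series_residue:
  assumes s0: "Re s0 \<ge> 1"
  obtains m :: nat where "m = 0 \<longleftrightarrow> zeta1 s0 \<noteq> 0"
    "(scaled_mangoldt s0 \<longlongrightarrow> (if s0 = 1 then 1 else 0) - of_nat m) (at_right 0)"
proof -
  have conn: "connected {s. Re s > 0}" by (intro convex_connected convex_halfspace_Re_gt)
  have in0: "s0 \<in> {s. Re s > 0}" "1 \<in> {s. Re s > 0}" "zeta1 1 \<noteq> 0" using s0 zeta1_1 by auto
  obtain m where m: "m = 0 \<longleftrightarrow> zeta1 s0 \<noteq> 0"
    "(scaled_logderiv zeta1 s0 \<longlongrightarrow> of_nat m) (at_right 0)"
    "\<forall>\<^sub>F h in at_right 0. zeta1 (s0 + of_real h) \<noteq> 0"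
    using logderiv_limit[OF zeta1_holomorphic open_halfspace_Re_gt conn in0] by metis
  have "((\<lambda>h. of_real h / (s0 + of_real h - 1)) \<longlongrightarrow> (if s0 = 1 then 1 else 0)) (at_right 0)"
  proof (cases "s0 = 1")
    case True
    have "\<forall>\<^sub>F h in at_right (0::real). 1 = of_real h / (s0 + of_real h - 1)"
      using eventually_at_right_less[of 0] by eventually_elim (use True in auto)
    from Lim_transform_eventually[OF tendsto_const this] show ?thesis using True by simp
  next
    case False
    have "((\<lambda>h. of_real h / (s0 + of_real h - 1)) \<longlongrightarrow> of_real 0 / (s0 + of_real 0 - 1)) (at_right 0)"
      by (intro tendsto_intros) (use False in simp)
    thus ?thesis using False by simp
  qed
  from tendsto_diff[OF this m(2)]
  have "(scaled_mangoldt s0 \<longlongrightarrow> (if s0 = 1 then 1 else 0) - of_nat m) (at_right 0)"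
  proof (rule Lim_transform_eventually)
    show "\<forall>\<^sub>F h in at_right 0. of_real h / (s0 + of_real h - 1) - of_real h * deriv zeta1 (s0 + of_real h) / zeta1 (s0 + of_real h)
        = scaled_mangoldt s0 h"
      using m(3) eventually_at_right_less[of 0]
    proof eventually_elim
      case (elim h)
      define s where "s = s0 + of_real h"
      have s: "Re s > 1" using s0 elim by (simp add: s_def)
      have s1: "s - 1 \<noteq> 0" using s by auto
      have z: "zeta1 s \<noteq> 0" using elim by (simp add: s_def)
      have "deriv zeta1 s = zeta1 s * (1 - (s - 1) * mangoldt_series s) / (s - 1)"
        using zeta1_logderiv[OF s] s1 by (simp add: eq_divide_eq)
      hence "deriv zeta1 s / zeta1 s = 1 / (s - 1) - mangoldt_series s"
        using s1 z by (simp add: field_simps)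
      hence "of_real h * (deriv zeta1 s / zeta1 s) = of_real h * (1 / (s - 1) - mangoldt_series s)" by simp
      thus ?case by (simp add: s_def[symmetric] algebra_simps)
    qed
  qed
  with m(1) show ?thesis by (rule that)
qed

lemma mangoldt_series_sums:
  "Re s > 1 \<Longrightarrow> (\<lambda>n. mangoldt n * of_nat n powr (-s)) sums mangoldt_series s"
  unfolding mangoldt_series_def
  by (rule summable_sums[OF summable_norm_cancel[OF summable_norm_mangoldt_powr]])

text \<open>The bound is uniform in h, so after multiplication by h the series tends to 0; this
  excludes zeros with Re s > 1 without an Euler product.\<close>

lemma norm_mangoldt_series_le:
  assumes s: "Re s > 1" and h: "h \<ge> 0"
  shows "norm (mangoldt_series (s + of_real h)) \<le> (\<Sum>n. norm (mangoldt n * of_nat n powr (-s) :: complex))"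
proof -
  have s': "Re (s + of_real h) > 1" using s h by simp
  have "norm (mangoldt_series (s + of_real h)) \<le> (\<Sum>n. norm (mangoldt n * of_nat n powr (-(s + of_real h)) :: complex))"
    unfolding mangoldt_series_def by (rule summable_norm[OF summable_norm_mangoldt_powr[OF s']])
  also have "\<dots> \<le> (\<Sum>n. norm (mangoldt n * of_nat n powr (-s) :: complex))"
  proof (rule suminf_le[OF _ summable_norm_mangoldt_powr[OF s'] summable_norm_mangoldt_powr[OF s]])
    fix n :: nat
    have "real n powr (- Re (s + of_real h)) \<le> real n powr (- Re s)"
      by (cases "n = 0") (use h in \<open>auto intro!: powr_mono\<close>)
    thus "norm (mangoldt n * of_nat n powr (-(s + of_real h)) :: complex) \<le> norm (mangoldt n * of_nat n powr (-s) :: complex)"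
      by (simp add: norm_mult norm_nat_powr mult_left_mono mangoldt_nonneg)
  qed
  finally show ?thesis .
qed

text \<open>The inequality 3 + 4 cos x + cos (2 x) = 2 (1 + cos x)^2 >= 0 at x = t ln n, weighted
  with Lambda(n) n^(-sigma).\<close>

lemma mertens_341:
  assumes \<sigma>: "\<sigma> > 1"
  shows "3 * Re (mangoldt_series (of_real \<sigma>)) + 4 * Re (mangoldt_series (of_real \<sigma> + \<i> * of_real t))
          + Re (mangoldt_series (of_real \<sigma> + \<i> * of_real (2 * t))) \<ge> 0"
proof -
  define w where "w = (\<lambda>n. mangoldt n * real n powr (-\<sigma>))"
  have sm: "(\<lambda>n. w n * cos (u * ln (real n))) sums Re (mangoldt_series (of_real \<sigma> + \<i> * of_real u))" for u
  proof -
    have "(\<lambda>n. Re (mangoldt n * of_nat n powr (-(of_real \<sigma> + \<i> * of_real u)))) sums Re (mangoldt_series (of_real \<sigma> + \<i> * of_real u))"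
      by (rule sums_Re[OF mangoldt_series_sums]) (use \<sigma> in simp)
    moreover have "Re (mangoldt n * of_nat n powr (-(of_real \<sigma> + \<i> * of_real u))) = w n * cos (u * ln (real n))" for n :: nat
    proof (cases "n = 0")
      case False
      hence "Re (of_nat n powr (-(of_real \<sigma> + \<i> * of_real u))) = real n powr (-\<sigma>) * cos (u * ln (real n))"
        by (simp add: powr_def Re_exp Ln_of_nat)
      thus ?thesis by (simp only: times_complex.sel Re_mangoldt Im_mangoldt mult_zero_left diff_zero mult.assoc w_def)
    qed (simp add: w_def)
    ultimately show ?thesis by (simp only:)
  qed
  have A: "(\<lambda>n. 3 * (w n * cos (0 * ln (real n))) + 4 * (w n * cos (t * ln (real n)))
           + w n * cos ((2 * t) * ln (real n))) sums
      (3 * Re (mangoldt_series (of_real \<sigma> + \<i> * of_real 0)) + 4 * Re (mangoldt_series (of_real \<sigma> + \<i> * of_real t))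
          + Re (mangoldt_series (of_real \<sigma> + \<i> * of_real (2 * t))))"
    by (intro sums_add sums_mult sm)
  have B: "0 \<le> 3 * (w n * cos (0 * ln (real n))) + 4 * (w n * cos (t * ln (real n)))
           + w n * cos ((2 * t) * ln (real n))" for n :: nat
  proof -
    have *: "cos ((2 * t) * ln (real n)) = 2 * (cos (t * ln (real n)))\<^sup>2 - 1"
      using cos_double_cos[of "t * ln (real n)"] by (simp add: mult_ac)
    have "3 * (w n * cos (0 * ln (real n))) + 4 * (w n * cos (t * ln (real n)))
           + w n * cos ((2 * t) * ln (real n)) = w n * (2 * (1 + cos (t * ln (real n)))\<^sup>2)"
      unfolding * by (simp add: algebra_simps power2_eq_square)
    thus ?thesis by (simp add: w_def mangoldt_nonneg)
  qed
  show ?thesis using sums_le[OF B sums_zero A] by simp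
qed

text \<open>For Re s > 1 the scaled series tends to 0, so the order of vanishing is 0. On the line,
  \<open>mertens_341\<close> times h becomes 3 - 4 m1 - m2 >= 0 in the limit, where m1 and m2 are
  the orders at 1 + it and 1 + 2it; a zero would cost at least 4 against the 3 gained from the
  pole.\<close>

theorem zeta1_nonzero:
  assumes s: "Re s \<ge> 1"
  shows "zeta1 s \<noteq> 0"
proof (cases "Re s > 1")
  case True
  obtain m where m: "m = 0 \<longleftrightarrow> zeta1 s \<noteq> 0"
    "(scaled_mangoldt s \<longlongrightarrow> (if s = 1 then 1 else 0) - of_nat m) (at_right 0)"
    using mangoldt_series_residue[OF s] by metis
  have s1: "s \<noteq> 1" using True by auto
  define B where "B = (\<Sum>n. norm (mangoldt n * of_nat n powr (-s) :: complex))"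
  have "(scaled_mangoldt s \<longlongrightarrow> 0) (at_right 0)"
  proof (rule Lim_null_comparison)
    show "\<forall>\<^sub>F h in at_right 0. norm (scaled_mangoldt s h) \<le> h * B"
      using eventually_at_right_less[of 0]
    proof eventually_elim
      case (elim h)
      thus ?case using norm_mangoldt_series_le[OF True, of h]
        by (simp add: norm_mult B_def mult_left_mono)
    qed
    show "((\<lambda>h. h * B) \<longlongrightarrow> 0) (at_right 0)"
      by (rule tendsto_eq_rhs[OF tendsto_mult[OF tendsto_ident_at tendsto_const]]) simp
  qed
  from tendsto_unique[OF _ this m(2)] s1 have "m = 0" by simp
  thus ?thesis using m by simp
next
  case False
  with s have Re: "Re s = 1" by simp
  define t where "t = Im s"
  have s_eq: "s = 1 + \<i> * of_real t" using Re by (simp add: complex_eq_iff t_def)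
  show ?thesis
  proof (cases "t = 0")
    case True
    thus ?thesis using zeta1_1 s_eq by simp
  next
    case t: False
    obtain m1 where m1: "m1 = 0 \<longleftrightarrow> zeta1 s \<noteq> 0"
      "(scaled_mangoldt s \<longlongrightarrow> (if s = 1 then 1 else 0) - of_nat m1) (at_right 0)"
      using mangoldt_series_residue[OF s] by metis
    define s2 where "s2 = 1 + \<i> * of_real (2 * t)"
    have s2: "Re s2 \<ge> 1" by (simp add: s2_def)
    obtain m2 where m2: "m2 = 0 \<longleftrightarrow> zeta1 s2 \<noteq> 0"
      "(scaled_mangoldt s2 \<longlongrightarrow> (if s2 = 1 then 1 else 0) - of_nat m2) (at_right 0)"
      using mangoldt_series_residue[OF s2] by metis
    define s0 :: complex where "s0 = 1"
    have "Re s0 \<ge> 1" by (simp add: s0_def)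
    from mangoldt_series_residue[OF this]
    obtain m0 where m0: "m0 = 0 \<longleftrightarrow> zeta1 s0 \<noteq> 0"
      "(scaled_mangoldt s0 \<longlongrightarrow> (if s0 = 1 then 1 else 0) - of_nat m0) (at_right 0)"
      by metis
    have ne: "s \<noteq> 1" "s2 \<noteq> 1" using t by (auto simp: s_eq s2_def complex_eq_iff)
    have "m0 = 0" using m0 zeta1_1 by (simp add: s0_def)
    have "((\<lambda>h. 3 * Re (scaled_mangoldt s0 h) + 4 * Re (scaled_mangoldt s h)
         + Re (scaled_mangoldt s2 h)) \<longlongrightarrow> 3 * Re ((if s0 = 1 then 1 else 0) - of_nat m0) + 4 * Re ((if s = 1 then 1 else 0) - of_nat m1)
         + Re ((if s2 = 1 then 1 else 0) - of_nat m2)) (at_right 0)"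
      by (intro tendsto_intros m0 m1 m2)
    moreover have "\<forall>\<^sub>F h in at_right (0::real). 0 \<le> 3 * Re (scaled_mangoldt s0 h) + 4 * Re (scaled_mangoldt s h)
         + Re (scaled_mangoldt s2 h)"
      using eventually_at_right_less[of 0]
    proof eventually_elim
      case (elim h)
      have "0 \<le> h * (3 * Re (mangoldt_series (of_real (1 + h))) + 4 * Re (mangoldt_series (of_real (1 + h) + \<i> * of_real t))
          + Re (mangoldt_series (of_real (1 + h) + \<i> * of_real (2 * t))))"
        using elim by (intro mult_nonneg_nonneg mertens_341) auto
      thus ?case by (simp add: s_eq s2_def s0_def algebra_simps)
    qed
    ultimately have "0 \<le> 3 * Re ((if s0 = 1 then 1 else 0) - of_nat m0) + 4 * Re ((if s = 1 then 1 else 0) - of_nat m1)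
         + Re ((if s2 = 1 then 1 else 0) - of_nat m2)"
      by (rule tendsto_lowerbound) simp
    hence "4 * real m1 + real m2 \<le> 3" using ne \<open>m0 = 0\<close> by (simp add: s0_def)
    hence "m1 = 0" by linarith
    thus ?thesis using m1 by simp
  qed
qed

section \<open>The prime number theorem\<close>

definition cheb_psi :: "nat \<Rightarrow> real" where
  "cheb_psi n = (\<Sum>k=1..n. mangoldt k)"

lemma cheb_psi_0 [simp]: "cheb_psi 0 = 0"
  by (simp add: cheb_psi_def)

lemma cheb_psi_Suc: "cheb_psi (Suc n) = cheb_psi n + mangoldt (Suc n)"
  by (simp add: cheb_psi_def)

lemma cheb_psi_mono: "m \<le> n \<Longrightarrow> cheb_psi m \<le> cheb_psi n"
  unfolding cheb_psi_def by (intro sum_mono2) (auto simp: mangoldt_nonneg)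

lemma cheb_psi_nonneg: "cheb_psi n \<ge> 0"
  unfolding cheb_psi_def by (intro sum_nonneg) (auto simp: mangoldt_nonneg)

lemma card_multiples: "d > 0 \<Longrightarrow> card {m\<in>{1..n}. d dvd m} = n div d" for d n :: nat
proof -
  assume d: "d > 0"
  have "{m\<in>{1..n}. d dvd m} = (\<lambda>k. d * k) ` {1..n div d}"
  proof (intro equalityI subsetI)
    fix m assume m: "m \<in> {m\<in>{1..n}. d dvd m}"
    then obtain k where k: "m = d * k" by auto
    hence "k \<ge> 1" "k \<le> n div d" using m d by (auto simp: less_eq_div_iff_mult_less_eq mult.commute Suc_le_eq)
    thus "m \<in> (\<lambda>k. d * k) ` {1..n div d}" using k by auto
  next
    fix m assume "m \<in> (\<lambda>k. d * k) ` {1..n div d}"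
    then obtain k where "m = d * k" "k \<in> {1..n div d}" by (elim imageE)
    hence k: "m = d * k" "1 \<le> k" "k \<le> n div d" by simp_all
    hence "d * k \<le> n" using d by (simp add: less_eq_div_iff_mult_less_eq mult.commute)
    thus "m \<in> {m\<in>{1..n}. d dvd m}" using k d by (auto simp: Suc_le_eq)
  qed
  moreover have "inj_on (\<lambda>k. d * k) {1..n div d}" using d by (auto simp: inj_on_def)
  ultimately show ?thesis by (simp add: card_image)
qed

lemma ln_fact_eq: "ln (fact n) = (\<Sum>d=1..n. mangoldt d * real (n div d))"
proof -
  have "ln (fact n) = (\<Sum>m=1..n. ln (real m))"
    unfolding fact_prod of_nat_prod by (rule ln_prod) auto
  also have "\<dots> = (\<Sum>m=1..n. \<Sum>d | d dvd m. mangoldt d)"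
    by (intro sum.cong refl) (simp add: mangoldt_sum)
  also have "\<dots> = (\<Sum>m=1..n. \<Sum>d | d \<in> {1..n} \<and> d dvd m. mangoldt d)"
  proof (intro sum.cong refl)
    fix m assume "m \<in> {1..n}"
    thus "{d. d dvd m} = {d. d \<in> {1..n} \<and> d dvd m}"
      by (auto dest: dvd_imp_le simp: Suc_le_eq intro: Nat.gr0I)
  qed
  also have "\<dots> = (\<Sum>d=1..n. \<Sum>m | m \<in> {1..n} \<and> d dvd m. mangoldt d)"
    by (rule sum.swap_restrict) auto
  also have "\<dots> = (\<Sum>d=1..n. mangoldt d * real (n div d))"
    by (intro sum.cong refl) (use card_multiples in auto)
  finally show ?thesis .
qed

text \<open>The logarithm of the binomial coefficient (2n choose n) is the sum of Lambda(d)
  (floor(2n/d) - 2 floor(n/d)). These coefficients are nonnegative and equal 1 for n < d <= 2n,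
  while the binomial coefficient is at most 4^n.\<close>

lemma cheb_psi_double: "cheb_psi (2 * n) - cheb_psi n \<le> 2 * real n"
proof -
  have "cheb_psi (2 * n) - cheb_psi n = (\<Sum>d=n+1..2*n. mangoldt d)"
  proof -
    have "{1..2*n} = {1..n} \<union> {n+1..2*n}" by auto
    thus ?thesis unfolding cheb_psi_def by (simp add: sum.union_disjoint)
  qed
  also have "\<dots> = (\<Sum>d=n+1..2*n. mangoldt d * (real (2 * n div d) - 2 * real (n div d)))"
  proof (intro sum.cong refl)
    fix d assume d: "d \<in> {n+1..2*n}"
    have "2 * n div d = 1" using d by (intro div_nat_eqI) auto
    thus "mangoldt d = mangoldt d * (real (2 * n div d) - 2 * real (n div d))" using d by simp
  qed
  also have "\<dots> \<le> (\<Sum>d=1..2*n. mangoldt d * (real (2 * n div d) - 2 * real (n div d)))"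
  proof (intro sum_mono2)
    fix d assume "d \<in> {1..2*n} - {n+1..2*n}"
    have "2 * (n div d) \<le> 2 * n div d"
      by (cases "d = 0") (auto simp: less_eq_div_iff_mult_less_eq algebra_simps)
    hence "real (2 * n div d) - 2 * real (n div d) \<ge> 0" by linarith
    thus "0 \<le> mangoldt d * (real (2 * n div d) - 2 * real (n div d))"
      by (simp add: mangoldt_nonneg)
  qed auto
  also have "\<dots> = ln (fact (2 * n)) - 2 * (\<Sum>d=1..2*n. mangoldt d * real (n div d))"
    by (simp add: ln_fact_eq algebra_simps sum_subtractf sum_distrib_left)
  also have "(\<Sum>d=1..2*n. mangoldt d * real (n div d)) = ln (fact n)"
    unfolding ln_fact_eq by (rule sum.mono_neutral_right) auto
  also have "ln (fact (2 * n)) - 2 * ln (fact n) = ln (real ((2 * n) choose n))"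
  proof -
    have "real ((2 * n) choose n) = fact (2 * n) / (fact n * fact n)"
      using binomial_fact[of n "2 * n", where ?'a = real] by (simp add: mult_2)
    thus ?thesis by (simp add: ln_div ln_mult)
  qed
  also have "\<dots> \<le> ln (2 ^ (2 * n))"
  proof -
    have "(2 * n) choose n \<le> 2 ^ (2 * n)" by (rule binomial_le_pow2)
    hence "real ((2 * n) choose n) \<le> 2 ^ (2 * n)" by (metis of_nat_le_iff of_nat_numeral of_nat_power)
    thus ?thesis by (subst ln_le_cancel_iff) auto
  qed
  also have "\<dots> = 2 * real n * ln 2" by (simp add: ln_realpow)
  also have "\<dots> \<le> 2 * real n * 1" using ln_2_less_1 by (intro mult_left_mono) auto
  finally show ?thesis by simp
qed

lemma cheb_psi_le: "cheb_psi n \<le> 4 * real n"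
proof (induction n rule: less_induct)
  case (less n)
  consider "n = 0" | "n = 1" | m where "m \<ge> 1" "n = 2 * m" | m where "m \<ge> 1" "n = 2 * m + 1"
  proof -
    have "n = 2 * (n div 2) \<or> n = 2 * (n div 2) + 1" by auto
    thus thesis using that by (cases "n div 2 = 0") (auto simp: Suc_le_eq)
  qed
  thus ?case
  proof cases
    case 2
    thus ?thesis by (simp add: cheb_psi_def)
  next
    case (3 m)
    have "cheb_psi m \<le> 4 * real m" using 3 by (intro less) auto
    thus ?thesis using cheb_psi_double[of m] 3 by simp
  next
    case (4 m)
    have "cheb_psi n \<le> cheb_psi (2 * (m + 1))" using 4 by (intro cheb_psi_mono) auto
    also have "\<dots> \<le> cheb_psi (m + 1) + 2 * real (m + 1)" using cheb_psi_double[of "m + 1"] by linarith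
    also have "cheb_psi (m + 1) \<le> 4 * real (m + 1)" using 4 by (intro less) auto
    \<comment> \<open>For n = 2m + 1 the bound obtained is 6 (m + 1), which is at most 4 n once m >=
      1; hence the separate case n = 1.\<close>
    finally show ?thesis using 4 by simp
  qed simp
qed

lemma abs_cheb_psi_diff_le: "\<bar>cheb_psi n - real n\<bar> \<le> 5 * real n"
  using cheb_psi_le[of n] cheb_psi_nonneg[of n] by linarith

text \<open>The Dirichlet series of \<open>\<psi>(n) - n\<close> is obtained from \<open>\<Sum> (\<Lambda>(n) - 1) n\<^sup>-\<^sup>s\<close> by partial
  summation, after replacing \<open>n\<^sup>-\<^sup>s - (n+1)\<^sup>-\<^sup>s\<close> by \<open>s n\<^sup>-\<^sup>s\<^sup>-\<^sup>1\<close> up to a series that converges on \<open>Re s > 0\<close>.\<close>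

abbreviation psi_kernel :: "nat \<Rightarrow> complex \<Rightarrow> complex" where
  "psi_kernel n s \<equiv> of_nat (Suc (Suc n)) powr (-s) - of_nat (Suc n) powr (-s) + s * of_nat (Suc n) powr (-1 - s)"

definition psi_error_series :: "complex \<Rightarrow> complex" where
  "psi_error_series s = (\<Sum>n. of_real (cheb_psi (Suc n) - real (Suc n)) * psi_kernel n s)"

lemma psi_error_holomorphic: "psi_error_series holomorphic_on {s. Re s > 0}"
  and psi_error_summable: "Re s > 0 \<Longrightarrow> summable (\<lambda>n. of_real (cheb_psi (Suc n) - real (Suc n)) * psi_kernel n s :: complex)"
proof -
  have "norm (of_real (cheb_psi (Suc n) - real (Suc n)) :: complex) \<le> 5 * real (Suc n) ^ 1" for n
    unfolding norm_of_real using abs_cheb_psi_diff_le[of "Suc n"] by simp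
  note * = Taylor_series_holomorphic[OF this]
  have "1 - of_nat 1 - s = - s" "- of_nat 1 - s = - 1 - s" for s :: complex by simp_all
  note * = *[unfolded this]
  show "psi_error_series holomorphic_on {s. Re s > 0}"
    and "Re s > 0 \<Longrightarrow> summable (\<lambda>n. of_real (cheb_psi (Suc n) - real (Suc n)) * psi_kernel n s :: complex)"
    using * by (simp_all add: psi_error_series_def[abs_def] del: of_nat_Suc)
qed

lemma psi_dirichlet_sums:
  assumes s: "Re s > 1"
  shows "(\<lambda>n. of_real (cheb_psi (Suc n) - real (Suc n)) * of_nat (Suc n) powr (-1 - s)) sums
           ((psi_error_series s + (mangoldt_series s - zeta_series s)) / s)"
proof -
  define c :: "nat \<Rightarrow> complex" where "c = (\<lambda>n. of_real (cheb_psi n - real n))"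
  define f :: "nat \<Rightarrow> complex" where "f = (\<lambda>n. c (Suc n) * (of_nat (Suc (Suc n)) powr (-s) - of_nat (Suc n) powr (-s)))"
  have partial: "(\<Sum>n<N. f n) = c N * of_nat (Suc N) powr (-s) - (\<Sum>n<N. (mangoldt (Suc n) - 1) * of_nat (Suc n) powr (-s))" for N
  proof (induction N)
    case (Suc N)
    have cS: "c (Suc N) = c N + (mangoldt (Suc N) - 1)"
      by (simp add: c_def cheb_psi_Suc of_real_mangoldt algebra_simps)
    show ?case
      by (simp only: sum.lessThan_Suc Suc.IH, simp only: f_def cS, simp add: algebra_simps del: of_nat_Suc)
  qed (simp add: c_def)
  have D: "(\<lambda>n. (mangoldt (Suc n) - 1) * of_nat (Suc n) powr (-s)) sums (mangoldt_series s - zeta_series s)"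
  proof -
    have "(\<lambda>n. of_nat n powr (-s)) sums zeta_series s"
      unfolding zeta_series_def by (rule summable_sums[OF summable_norm_cancel[OF summable_norm_nat_powr[OF s]]])
    from sums_diff[OF mangoldt_series_sums[OF s] this]
    have "(\<lambda>n. (mangoldt n - 1) * of_nat n powr (-s)) sums (mangoldt_series s - zeta_series s)"
      by (simp add: algebra_simps)
    thus ?thesis by (subst sums_Suc_iff) simp
  qed
  \<comment> \<open>The boundary term of the partial summation is O(N^(1 - Re s)) since psi(N) =
    O(N).\<close>
  have "(\<lambda>N. c N * of_nat (Suc N) powr (-s)) \<longlonglongrightarrow> 0"
  proof (rule Lim_null_comparison)
    show "\<forall>\<^sub>F N in sequentially. norm (c N * of_nat (Suc N) powr (-s)) \<le> 5 * real N * real (Suc N) powr (- Re s)"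
    proof (intro always_eventually allI)
      fix N
      have "norm (c N) \<le> 5 * real N" unfolding c_def norm_of_real by (rule abs_cheb_psi_diff_le)
      thus "norm (c N * of_nat (Suc N) powr (-s)) \<le> 5 * real N * real (Suc N) powr (- Re s)"
        unfolding norm_mult norm_nat_powr by (intro mult_mono) auto
    qed
    show "(\<lambda>N. 5 * real N * real (Suc N) powr (- Re s)) \<longlonglongrightarrow> 0" using s by real_asymp
  qed
  hence "(\<lambda>N. \<Sum>n<N. f n) \<longlonglongrightarrow> 0 - (mangoldt_series s - zeta_series s)"
    unfolding partial by (intro tendsto_diff D[unfolded sums_def])
  hence f_sums: "f sums (- (mangoldt_series s - zeta_series s))" by (simp add: sums_def)
  have "(\<lambda>n. c (Suc n) * psi_kernel n s) sums psi_error_series s"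
    unfolding psi_error_series_def c_def by (rule summable_sums[OF psi_error_summable]) (use s in simp)
  from sums_diff[OF this f_sums]
  have "(\<lambda>n. s * (c (Suc n) * of_nat (Suc n) powr (-1 - s))) sums (psi_error_series s + (mangoldt_series s - zeta_series s))"
    by (simp add: f_def algebra_simps del: of_nat_Suc)
  moreover have "s \<noteq> 0" using s by auto
  ultimately show ?thesis using sums_divide[of _ _ s] by (fastforce simp: c_def simp del: of_nat_Suc)
qed

text \<open>Newman's theorem for c n = (psi(n) - n) / n^2, which is O(1/n) by Chebyshev. The poles
  of - zeta'/zeta and of zeta at 1 cancel: the difference is - zeta1'/zeta1 - q, holomorphic where
  \<open>zeta1\<close> is nonzero, hence near Re s >= 1. The shift w = s - 1 moves that line to the
  imaginary axis.\<close>

theorem summable_psi_diff: "summable (\<lambda>n. (cheb_psi n - real n) / (real n)\<^sup>2)"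
proof -
  define c :: "nat \<Rightarrow> complex" where "c = (\<lambda>n. of_real ((cheb_psi n - real n) / (real n)\<^sup>2))"
  \<comment> \<open>This is zeta(s) - 1/(s - 1) with its removable singularity filled in.\<close>
  define q where "q = (\<lambda>s. if s = 1 then deriv zeta1 1 else (zeta1 s - zeta1 1) / (s - 1))"
  define X where "X = {s. Re s > 0}"
  have oX: "open X" unfolding X_def by (rule open_halfspace_Re_gt)
  have zX: "zeta1 holomorphic_on X" unfolding X_def by (rule zeta1_holomorphic)
  have qX: "q holomorphic_on X" unfolding q_def by (rule pole_lemma_open[OF zX oX])
  define H where "H = (\<lambda>s. (psi_error_series s + (- (deriv zeta1 s / zeta1 s) - q s)) / s)"
  define Y where "Y = X \<inter> zeta1 -` (- {0})"
  have "open Y" unfolding Y_def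
    by (rule continuous_open_preimage[OF holomorphic_on_imp_continuous_on[OF zX] oX]) auto
  have YX: "Y \<subseteq> X" by (auto simp: Y_def)
  have HY: "H holomorphic_on Y" unfolding H_def
    using YX by (intro holomorphic_intros holomorphic_on_subset[OF _ YX] zX qX holomorphic_deriv[OF zX oX]
        psi_error_holomorphic[folded X_def]) (auto simp: Y_def X_def)
  define U where "U = (\<lambda>w. 1 + w) -` Y"
  have "open U" unfolding U_def by (intro open_vimage \<open>open Y\<close> continuous_intros)
  define G where "G = (\<lambda>w. H (1 + w))"
  have "(H \<circ> (\<lambda>w. 1 + w)) holomorphic_on U"
    by (rule holomorphic_on_compose_gen[OF _ HY]) (auto intro!: holomorphic_intros simp: U_def)
  hence GU: "G holomorphic_on U" by (simp add: G_def o_def)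
  have "c sums G 0"
  proof (rule newman_tauberian[OF _ _ \<open>open U\<close> _ GU])
    fix n :: nat
    have "norm (c n) * real n = \<bar>cheb_psi n - real n\<bar> / real n"
      unfolding c_def norm_of_real by (simp add: power2_eq_square)
    also have "\<dots> \<le> 5" using abs_cheb_psi_diff_le[of n] by (cases "n = 0") (auto simp: divide_le_eq)
    finally show "norm (c n) * real n \<le> 5" .
    show "c 0 = 0" by (simp add: c_def)
    show "{w. Re w \<ge> 0} \<subseteq> U"
      using zeta1_nonzero by (auto simp: U_def Y_def X_def)
    fix w :: complex assume w: "Re w > 0"
    define s where "s = 1 + w"
    have s: "Re s > 1" using w by (simp add: s_def)
    have s1: "s \<noteq> 1" using s by auto
    have "H s = (psi_error_series s + (mangoldt_series s - zeta_series s)) / s"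
    proof -
      have nz: "zeta1 s \<noteq> 0" by (rule zeta1_nonzero) (use s in simp)
      have "deriv zeta1 s = zeta1 s * (1 - (s - 1) * mangoldt_series s) / (s - 1)"
        using zeta1_logderiv[OF s] s1 by (simp add: eq_divide_eq)
      hence "deriv zeta1 s / zeta1 s = 1 / (s - 1) - mangoldt_series s"
        using s1 nz by (simp add: field_simps)
      moreover have "q s = zeta_series s - 1 / (s - 1)"
        using s1 by (simp add: q_def zeta1_1 zeta1_eq[OF s] diff_divide_distrib)
      ultimately show ?thesis by (simp add: H_def)
    qed
    with psi_dirichlet_sums[OF s]
    have "(\<lambda>n. of_real (cheb_psi (Suc n) - real (Suc n)) * of_nat (Suc n) powr (-1 - s)) sums H s" by simp
    moreover have "of_real (cheb_psi (Suc n) - real (Suc n)) * of_nat (Suc n) powr (-1 - s) = c (Suc n) * of_nat (Suc n) powr (-w)" for n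
    proof -
      have "-1 - s = -w - of_nat 2" by (simp add: s_def)
      hence "of_nat (Suc n) powr (-1 - s) = of_nat (Suc n) powr (-w) / (of_nat (Suc n))\<^sup>2"
        by (simp only: powr_diff powr_nat) (simp del: of_nat_Suc)
      thus ?thesis by (simp add: c_def del: of_nat_Suc)
    qed
    ultimately have "(\<lambda>n. c (Suc n) * of_nat (Suc n) powr (-w)) sums H s" by simp
    thus "(\<lambda>n. c n * of_nat n powr (-w)) sums G w"
      unfolding G_def s_def[symmetric] by (subst (asm) sums_Suc_iff) simp
  qed
  hence "summable c" by (rule sums_summable)
  thus ?thesis unfolding c_def by (simp only: summable_of_real_iff)
qed


lemma sum_diff_bound_of_summable:
  fixes f :: "nat \<Rightarrow> real"
  assumes "summable f" "e > 0"
  obtains N where "\<And>m n. m \<ge> N \<Longrightarrow> \<bar>\<Sum>k=m..<n. f k\<bar> < e"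
  using assms by (auto simp: summable_Cauchy) metis

text \<open>If \<open>\<psi>(n) > (1 + \<epsilon>) n\<close>, then monotonicity keeps \<open>\<psi>(k) - k\<close> above \<open>\<epsilon> n / 2\<close> on an interval of
  length about \<open>\<epsilon> n / 2\<close>, contradicting the Cauchy criterion; similarly from below.\<close>

theorem psi_asymptotics: "(\<lambda>n. cheb_psi n / real n) \<longlonglongrightarrow> 1"
proof (rule tendstoI)
  fix \<epsilon>' :: real assume "\<epsilon>' > 0"
  define \<epsilon> where "\<epsilon> = min (\<epsilon>' / 2) (1 / 2)"
  have \<epsilon>: "\<epsilon> > 0" "\<epsilon> < 1" "\<epsilon> < \<epsilon>'" using \<open>\<epsilon>' > 0\<close> by (auto simp: \<epsilon>_def min_def)
  define f where "f = (\<lambda>n. (cheb_psi n - real n) / (real n)\<^sup>2)"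
  obtain N where N: "\<And>m n. m \<ge> N \<Longrightarrow> \<bar>\<Sum>k=m..<n. f k\<bar> < \<epsilon>\<^sup>2 / 32"
    using sum_diff_bound_of_summable[OF summable_psi_diff, of "\<epsilon>\<^sup>2 / 32"] \<epsilon> unfolding f_def by auto
  have "\<forall>\<^sub>F n in sequentially. real n \<ge> 2 * real N + 4 / \<epsilon> + 2" by real_asymp
  thus "\<forall>\<^sub>F n in sequentially. dist (cheb_psi n / real n) 1 < \<epsilon>'"
  proof eventually_elim
    case (elim n)
    have "4 / \<epsilon> > 0" using \<epsilon> by simp
    hence n: "real n > 0" "n \<ge> N" "real n \<ge> 4 / \<epsilon>" "real N \<le> real n / 2" using elim by linarith+
    \<comment> \<open>On the \<open>L\<close> integers following (or preceding) n every term has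
      absolute value at least \<epsilon> / (8 n), since k <= 2 n. As L >= \<epsilon> n / 4, they add
      up to \<epsilon>^2 / 32, the Cauchy bound chosen above.\<close>
    define L where "L = nat \<lfloor>\<epsilon> * n / 2\<rfloor>"
    have "\<epsilon> * n \<ge> 4" using n(3) \<epsilon> by (simp add: field_simps)
    hence L: "real L \<le> \<epsilon> * n / 2" "real L \<ge> \<epsilon> * n / 4"
      unfolding L_def using \<epsilon> n by linarith+
    have Ln: "real L \<le> real n / 2" using L(1) mult_right_mono[of \<epsilon> 1 "real n"] \<epsilon> by simp
    have "cheb_psi n \<le> (1 + \<epsilon>) * n"
    proof (rule ccontr)
      assume "\<not> ?thesis"
      hence *: "cheb_psi n > (1 + \<epsilon>) * n" by simp
      have "\<epsilon>\<^sup>2 / 32 \<le> real L * (\<epsilon> / (8 * n))"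
      proof -
        have "\<epsilon>\<^sup>2 / 32 = (\<epsilon> * n / 4) * (\<epsilon> / (8 * n))" using n by (simp add: power2_eq_square)
        also have "\<dots> \<le> real L * (\<epsilon> / (8 * n))" using L \<epsilon> by (intro mult_right_mono) auto
        finally show ?thesis .
      qed
      also have "\<dots> = (\<Sum>k=n..<n+L. \<epsilon> / (8 * n))" by simp
      also have "\<dots> \<le> (\<Sum>k=n..<n+L. f k)"
      proof (rule sum_mono)
        fix k assume k: "k \<in> {n..<n+L}"
        hence k2: "real k \<le> real n + \<epsilon> * n / 2" "real k \<le> 2 * n" "real k > 0" using L Ln n(1) by auto
        have "cheb_psi k \<ge> cheb_psi n" using k by (intro cheb_psi_mono) auto
        hence 1: "cheb_psi k - k \<ge> \<epsilon> * n / 2" using * k2 by (simp add: algebra_simps)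
        have "\<epsilon> / (8 * n) = (\<epsilon> * n / 2) / (2 * n)\<^sup>2" using n by (simp add: power2_eq_square)
        also have "\<dots> \<le> (\<epsilon> * n / 2) / (real k)\<^sup>2"
          using k2 n \<epsilon> power_mono[OF k2(2), of 2] by (intro divide_left_mono mult_pos_pos) auto
        also have "\<dots> \<le> f k" unfolding f_def using 1 k2 by (intro divide_right_mono) auto
        finally show "\<epsilon> / (8 * n) \<le> f k" .
      qed
      finally show False using N[of n "n + L"] n by simp
    qed
    moreover have "cheb_psi n \<ge> (1 - \<epsilon>) * n"
    proof (rule ccontr)
      assume "\<not> ?thesis"
      hence *: "cheb_psi n < (1 - \<epsilon>) * n" by simp
      have LN: "L \<le> n" "n - L \<ge> N" using Ln n(4) by linarith+
      have "\<epsilon>\<^sup>2 / 32 \<le> \<epsilon>\<^sup>2 / 8" by simp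
      also have "\<dots> = (\<epsilon> * n / 4) * (\<epsilon> / (2 * n))" using n by (simp add: power2_eq_square)
      also have "\<dots> \<le> real L * (\<epsilon> / (2 * n))" using L \<epsilon> by (intro mult_right_mono) auto
      also have "\<dots> = (\<Sum>k=n-L..<n. \<epsilon> / (2 * n))" using LN by simp
      also have "\<dots> \<le> (\<Sum>k=n-L..<n. - f k)"
      proof (rule sum_mono)
        fix k assume k: "k \<in> {n-L..<n}"
        hence k2: "real k \<ge> real n - \<epsilon> * n / 2" "real k \<le> n" "real k > 0" using L Ln LN n(1) by auto
        have "cheb_psi k \<le> cheb_psi n" using k by (intro cheb_psi_mono) auto
        hence 1: "k - cheb_psi k \<ge> \<epsilon> * n / 2" using * k2 by (simp add: algebra_simps)
        have "\<epsilon> / (2 * n) = (\<epsilon> * n / 2) / (real n)\<^sup>2" using n by (simp add: power2_eq_square)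
        also have "\<dots> \<le> (\<epsilon> * n / 2) / (real k)\<^sup>2"
          using k2 n \<epsilon> by (intro divide_left_mono power_mono mult_pos_pos) auto
        also have "\<dots> \<le> (k - cheb_psi k) / (real k)\<^sup>2" using 1 k2 by (intro divide_right_mono) auto
        also have "\<dots> = - f k" by (simp add: f_def minus_divide_left)
        finally show "\<epsilon> / (2 * n) \<le> - f k" .
      qed
      finally show False using N[of "n - L" n] LN by (simp add: sum_negf)
    qed
    ultimately have "\<bar>cheb_psi n - n\<bar> \<le> \<epsilon> * n" by (simp add: algebra_simps abs_le_iff)
    hence "\<bar>cheb_psi n / n - 1\<bar> \<le> \<epsilon>"
      using n by (simp add: field_simps abs_le_iff)
    thus ?case using \<epsilon> by (simp add: dist_real_def)
  qed
qed

section \<open>From psi to the number of primes\<close>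

definition primes_upto :: "nat \<Rightarrow> nat set" where
  "primes_upto n = {p. prime p \<and> p \<le> n}"

lemma finite_primes_upto [simp]: "finite (primes_upto n)"
  by (rule finite_subset[of _ "{..n}"]) (auto simp: primes_upto_def)

text \<open>A prime p contributes ln p for each power p^j <= n. There are at most ln n / ln p such
  powers, so p contributes at most ln n.\<close>

lemma cheb_psi_le_card_primes: "cheb_psi n \<le> card (primes_upto n) * ln (real n)"
proof (cases "n = 0")
  case n: False
  define Q where "Q = {k\<in>{1..n}. primepow k}"
  have apd: "prime (aprimedivisor k) \<and> (\<exists>j>0. k = aprimedivisor k ^ j)" if "primepow k" for k :: nat
    using that by (metis primepow_def aprimedivisor_prime_power(1) aprimedivisor_prime_power)
  have "cheb_psi n = (\<Sum>k\<in>Q. ln (real (aprimedivisor k)))"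
    unfolding cheb_psi_def Q_def by (rule sum.mono_neutral_cong_right) (auto simp: mangoldt_def)
  also have "\<dots> = (\<Sum>p\<in>primes_upto n. \<Sum>k | k \<in> Q \<and> aprimedivisor k = p. ln (real (aprimedivisor k)))"
  proof (rule sum.group[symmetric])
    show "aprimedivisor ` Q \<subseteq> primes_upto n"
    proof
      fix p assume "p \<in> aprimedivisor ` Q"
      then obtain k where k: "k \<in> Q" "p = aprimedivisor k" by auto
      moreover obtain j where "j > 0" "k = aprimedivisor k ^ j" using apd[of k] k by (auto simp: Q_def)
      ultimately have "prime p" "p dvd k" using apd[of k] dvd_power[of j p] by (auto simp: Q_def)
      thus "p \<in> primes_upto n" using k by (auto simp: primes_upto_def Q_def dest!: dvd_imp_le)
    qed
  qed (auto simp: Q_def)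
  also have "\<dots> \<le> (\<Sum>p\<in>primes_upto n. ln (real n))"
  proof (rule sum_mono)
    fix p assume "p \<in> primes_upto n"
    hence p: "prime p" "p \<le> n" by (auto simp: primes_upto_def)
    hence p1: "p > 1" using prime_gt_1_nat[of p] by simp
    define J where "J = nat \<lfloor>log (real p) (real n)\<rfloor>"
    have "{k. k \<in> Q \<and> aprimedivisor k = p} \<subseteq> (\<lambda>j. p ^ j) ` {1..J}"
    proof
      fix k assume k: "k \<in> {k. k \<in> Q \<and> aprimedivisor k = p}"
      then obtain j where j: "j > 0" "k = p ^ j" using apd[of k] by (auto simp: Q_def)
      have "real p ^ j \<le> real n" using k j by (auto simp: Q_def simp flip: of_nat_power)
      hence "real j \<le> log (real p) (real n)" using p1 n
        by (subst le_log_iff) (auto simp: powr_realpow)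
      hence "j \<le> J" unfolding J_def by linarith
      thus "k \<in> (\<lambda>j. p ^ j) ` {1..J}" using j by auto
    qed
    hence "card {k. k \<in> Q \<and> aprimedivisor k = p} \<le> card ((\<lambda>j. p ^ j) ` {1..J})"
      by (intro card_mono) simp_all
    also have "\<dots> \<le> card {1..J}" by (rule card_image_le) simp
    finally have "card {k. k \<in> Q \<and> aprimedivisor k = p} \<le> J" by simp
    moreover have "real J \<le> log (real p) (real n)"
      unfolding J_def using p1 n by (intro of_nat_floor) simp
    ultimately have "real (card {k. k \<in> Q \<and> aprimedivisor k = p}) * ln p \<le> log (real p) (real n) * ln p"
      using p1 by (intro mult_right_mono) auto
    also have "\<dots> = ln n" using p1 by (simp add: log_def)
    finally show "(\<Sum>k | k \<in> Q \<and> aprimedivisor k = p. ln (real (aprimedivisor k))) \<le> ln (real n)"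
      by simp
  qed
  finally show ?thesis by simp
qed simp

text \<open>Primes above n^(1-e) have weight at least (1-e) ln n in psi, and at most n^(1-e) primes
  are smaller.\<close>

lemma card_primes_le_cheb_psi:
  assumes "0 < e" "e < 1" "n > 0"
  shows "(1 - e) * ln (real n) * (card (primes_upto n) - real n powr (1 - e)) \<le> cheb_psi n"
proof -
  define y where "y = nat \<lfloor>real n powr (1 - e)\<rfloor>"
  define P where "P = {p\<in>primes_upto n. real p > real n powr (1 - e)}"
  have "primes_upto n \<subseteq> P \<union> {1..y}"
  proof
    fix p assume p: "p \<in> primes_upto n"
    hence "p \<ge> 1" using prime_ge_1_nat[of p] by (simp add: primes_upto_def)
    moreover have "p \<le> y" if "real p \<le> real n powr (1 - e)"
      using that unfolding y_def by (rule le_nat_floor)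
    ultimately show "p \<in> P \<union> {1..y}"
      using p by (cases "real p \<le> real n powr (1 - e)") (auto simp: P_def)
  qed
  hence "card (primes_upto n) \<le> card (P \<union> {1..y})"
    by (intro card_mono) (auto simp: P_def)
  also have "\<dots> \<le> card P + y"
    using card_Un_le[of P "{1..y}"] by simp
  finally have "real (card (primes_upto n)) \<le> card P + real (y)" by linarith
  also have "real (y) \<le> real n powr (1 - e)" by (simp add: y_def)
  finally have "card (primes_upto n) - real n powr (1 - e) \<le> card P" by simp
  hence "(1 - e) * ln (real n) * (card (primes_upto n) - real n powr (1 - e)) \<le> (1 - e) * ln (real n) * card P"
    using assms by (intro mult_left_mono) auto
  also have "\<dots> = (\<Sum>p\<in>P. (1 - e) * ln (real n))" by simp
  also have "\<dots> \<le> (\<Sum>p\<in>P. mangoldt p)"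
  proof (rule sum_mono)
    fix p assume p: "p \<in> P"
    hence "ln (real n powr (1 - e)) \<le> ln (real p)"
      using assms by (subst ln_le_cancel_iff) (auto simp: P_def primes_upto_def prime_gt_0_nat)
    thus "(1 - e) * ln (real n) \<le> mangoldt p"
      using p assms by (simp add: P_def primes_upto_def ln_powr)
  qed
  also have "\<dots> \<le> cheb_psi n" unfolding cheb_psi_def
    by (rule sum_mono2) (auto simp: P_def primes_upto_def mangoldt_nonneg prime_gt_0_nat Suc_le_eq)
  finally show ?thesis .
qed

theorem prime_number_theorem: "(\<lambda>n. card (primes_upto n) * ln (real n) / real n) \<longlonglongrightarrow> 1"
proof (rule tendstoI)
  fix e :: real assume e: "e > 0"
  \<comment> \<open>\<epsilon> <= 1/2 gives 1 / (1 - \<epsilon>) <= 1 + 2 \<epsilon>; the total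
    error 2 d + 4 \<epsilon> is then at most 3 e / 4.\<close>
  define \<epsilon> where "\<epsilon> = min (1/2) (e / 8)"
  have \<epsilon>: "0 < \<epsilon>" "\<epsilon> \<le> 1/2" "\<epsilon> \<le> e / 8" using e by (auto simp: \<epsilon>_def)
  define d where "d = min (e / 8) 1"
  have d: "d > 0" "d \<le> e / 8" "d \<le> 1" using e by (auto simp: d_def)
  have "\<forall>\<^sub>F n in sequentially. cheb_psi n / n > 1 - d" "\<forall>\<^sub>F n in sequentially. cheb_psi n / n < 1 + d"
    using psi_asymptotics d by (auto intro: order_tendstoD)
  moreover have "(\<lambda>n. real n powr (- \<epsilon>) * ln n) \<longlonglongrightarrow> 0" using \<epsilon> by real_asymp
  hence "\<forall>\<^sub>F n in sequentially. real n powr (- \<epsilon>) * ln n < d" using d by (auto intro: order_tendstoD)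
  moreover have "\<forall>\<^sub>F n in sequentially. (n::nat) > 0" by (rule eventually_gt_at_top)
  ultimately show "\<forall>\<^sub>F n in sequentially. dist (card (primes_upto n) * ln (real n) / real n) 1 < e"
  proof eventually_elim
    case (elim n)
    define x where "x = card (primes_upto n) * ln (real n) / real n"
    have "x \<ge> cheb_psi n / n" unfolding x_def by (intro divide_right_mono cheb_psi_le_card_primes) auto
    hence 1: "x > 1 - d" using elim by linarith
    have "(1 - \<epsilon>) * ln (real n) * (card (primes_upto n) - real n powr (1 - \<epsilon>)) / n \<le> cheb_psi n / n"
      using \<epsilon> elim by (intro divide_right_mono card_primes_le_cheb_psi) auto
    moreover have "(1 - \<epsilon>) * ln (real n) * (card (primes_upto n) - real n powr (1 - \<epsilon>)) / n
        = (1 - \<epsilon>) * (x - real n powr (- \<epsilon>) * ln n)"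
      using elim by (simp add: x_def powr_diff powr_minus field_simps)
    ultimately have "(1 - \<epsilon>) * (x - real n powr (- \<epsilon>) * ln n) < 1 + d" using elim by linarith
    hence "x - real n powr (- \<epsilon>) * ln n < (1 + d) / (1 - \<epsilon>)" using \<epsilon> by (simp add: field_simps)
    also have "1 / (1 - \<epsilon>) \<le> 1 + 2 * \<epsilon>"
    proof -
      have "1 \<le> (1 + 2 * \<epsilon>) * (1 - \<epsilon>)" using \<epsilon> mult_left_mono[of \<epsilon> "1/2" "2 * \<epsilon>"] by (simp add: algebra_simps)
      thus ?thesis using \<epsilon> by (simp add: field_simps)
    qed
    hence "(1 + d) / (1 - \<epsilon>) \<le> (1 + d) * (1 + 2 * \<epsilon>)"
      using d mult_left_mono[of "1 / (1 - \<epsilon>)" "1 + 2 * \<epsilon>" "1 + d"] by simp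
    also have "\<dots> \<le> 1 + d + 4 * \<epsilon>" using d \<epsilon> mult_right_mono[of d 1 "2 * \<epsilon>"] by (simp add: algebra_simps)
    finally have "x < 1 + 2 * d + 4 * \<epsilon>" using elim by linarith
    hence "x < 1 + e" using d \<epsilon> e by linarith
    thus ?case using 1 d e unfolding x_def[symmetric] dist_real_def by linarith
  qed
qed

section \<open>Product-free graphs and lifted Sidon sets\<close>

text \<open>Expresses without division that some product of k ratios along edges is 1. Edges may
  repeat, and in a symmetric graph each can be used in either direction.\<close>

definition balanced :: "nat \<Rightarrow> (nat \<Rightarrow> nat \<Rightarrow> bool) \<Rightarrow> bool" where
  "balanced k E \<longleftrightarrow> (\<exists>x y :: nat \<Rightarrow> nat. (\<forall>i<k. E (x i) (y i)) \<and> (\<Prod>i<k. x i) = (\<Prod>i<k. y i))"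

definition kfree :: "nat \<Rightarrow> (nat \<Rightarrow> nat \<Rightarrow> bool) \<Rightarrow> bool" where
  "kfree k E \<longleftrightarrow> graph_on_pos E \<and> \<not> balanced k E"

definition nbhds :: "(nat \<Rightarrow> nat \<Rightarrow> bool) \<Rightarrow> nat \<Rightarrow> nat set set" where
  "nbhds E i = {N. N \<subseteq> {1..i} \<and> (N = {} \<or> (\<exists>a. N = {a}) \<or> (\<exists>a b. E a b \<and> N = {a, b}))}"

lemma finite_nbhds [simp]: "finite (nbhds E i)"
  by (rule finite_subset[of _ "Pow {1..i}"]) (auto simp: nbhds_def)

lemma card_nbhds:
  assumes E: "graph_on_pos E"
  shows "card (nbhds E i) = edges_upto E i + i + 1"
proof -
  define X where "X = {(a, b). 1 \<le> a \<and> a < b \<and> b \<le> i \<and> E a b}"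
  have fX: "finite X" by (rule finite_subset[of _ "{1..i} \<times> {1..i}"]) (auto simp: X_def)
  have eq: "nbhds E i = insert {} ((\<lambda>a. {a}) ` {1..i} \<union> (\<lambda>(a, b). {a, b}) ` X)"
  proof (intro equalityI subsetI)
    fix N assume N: "N \<in> nbhds E i"
    consider "N = {}" | a where "N = {a}" | a b where "E a b" "N = {a, b}"
      using N by (auto simp: nbhds_def)
    thus "N \<in> insert {} ((\<lambda>a. {a}) ` {1..i} \<union> (\<lambda>(a, b). {a, b}) ` X)"
    proof cases
      case (3 a b)
      have "E b a" "a \<noteq> b" using 3 E by (auto simp: graph_on_pos_def)
      have "(min a b, max a b) \<in> X"
        using 3 N \<open>E b a\<close> \<open>a \<noteq> b\<close> by (auto simp: X_def nbhds_def min_def max_def)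
      moreover have "N = {min a b, max a b}" using 3 by (auto simp: min_def max_def)
      ultimately show ?thesis by (auto intro!: image_eqI[of _ _ "(min a b, max a b)"])
    qed (use N in \<open>auto simp: nbhds_def\<close>)
  qed (auto simp: nbhds_def X_def)
  have i1: "inj_on (\<lambda>a. {a}) {1..i}" by (auto simp: inj_on_def)
  have i2: "inj_on (\<lambda>(a, b). {a, b}) X" by (auto simp: inj_on_def X_def doubleton_eq_iff)
  have d: "(\<lambda>a. {a}) ` {1..i} \<inter> (\<lambda>(a, b). {a, b}) ` X = {}"
    by (auto simp: X_def singleton_insert_inj_eq)
  have ne: "{} \<notin> (\<lambda>a. {a}) ` {1..i} \<union> (\<lambda>(a, b). {a, b}) ` X" by auto
  have "card ((\<lambda>a. {a}) ` {1..i}) = i" using card_image[OF i1] by simp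
  moreover have "edges_upto E i = card X" by (simp add: edges_upto_def X_def)
  ultimately show ?thesis unfolding eq using fX ne d
    by (simp add: card_Un_disjoint card_image[OF i2] del: One_nat_def)
qed

lemma edges_upto_le: "edges_upto E i + i + 1 \<le> (i + 1)\<^sup>2"
proof -
  have "edges_upto E i \<le> card ({1..i} \<times> {1..i})"
    unfolding edges_upto_def by (rule card_mono) auto
  thus ?thesis by (simp add: power2_eq_square)
qed

lemma finite_S_sets: "finite {A. A \<subseteq> {1..n} \<and> mult_k_Sidon k A}"
  by (rule finite_subset[of _ "Pow {1..n}"]) auto

text \<open>The cofactors are too small to be divisible by the primes, so p divides q. Hence i * p
  with a large prime p determines both factors.\<close>

lemma lift_mult_unique:
  fixes a p :: nat
  assumes "prime p" "prime q" "0 < a" "0 < b" "a < q" "b < p" "a < p" "b < q" "a * p = b * q"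
  shows "a = b \<and> p = q"
proof -
  have "p dvd b * q" using assms by (metis dvd_triv_right)
  moreover have "\<not> p dvd b" using assms by (auto dest: dvd_imp_le)
  ultimately have "p dvd q" using assms prime_dvd_mult_iff by blast
  hence "p = q" using assms by (simp add: primes_dvd_imp_eq)
  thus ?thesis using assms prime_gt_0_nat[of p] by auto
qed

section \<open>Sidon sets lifted from a graph\<close>

definition lift_set :: "nat set \<Rightarrow> (nat \<Rightarrow> nat set) \<Rightarrow> nat set" where
  "lift_set Q f = (\<Union>p\<in>Q. (\<lambda>a. a * p) ` f p)"

text \<open>A prime in \<open>Q\<close> divides at most two elements of the lifted set, so in a \<open>k\<close>-solution the primes
  of the left side are distinct and are those of the right side; cancelling them leaves a
  relation among \<open>k\<close> edges of \<open>E\<close>.\<close>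

lemma lift_set_Sidon:
  assumes E: "kfree k E" and Q: "\<And>p. p \<in> Q \<Longrightarrow> prime p \<and> K \<le> p"
    and f: "\<And>p. p \<in> Q \<Longrightarrow> f p \<in> nbhds E (d p) \<and> d p < K"
  shows "mult_k_Sidon k (lift_set Q f)"
  unfolding mult_k_Sidon_def
proof (rule notI, elim exE conjE)
  fix a b :: "nat \<Rightarrow> nat"
  assume inj: "inj_on a {..<k}" "inj_on b {..<k}"
    and sub: "a ` {..<k} \<subseteq> lift_set Q f" "b ` {..<k} \<subseteq> lift_set Q f"
    and disj: "a ` {..<k} \<inter> b ` {..<k} = {}" and eq: "(\<Prod>i<k. a i) = (\<Prod>i<k. b i)"
  have "\<exists>p \<alpha>. p \<in> Q \<and> \<alpha> \<in> f p \<and> \<alpha> * p = m" if "m \<in> lift_set Q f" for m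
    using that by (auto simp: lift_set_def)
  then obtain P r where Pr: "\<And>m. m \<in> lift_set Q f \<Longrightarrow> P m \<in> Q \<and> r m \<in> f (P m) \<and> r m * P m = m"
    by metis
  have PQ: "P m \<in> Q" and rf: "r m \<in> f (P m)" and rP: "r m * P m = m" if "m \<in> lift_set Q f" for m
    using Pr[OF that] by simp_all
  have aL: "a i \<in> lift_set Q f" if "i < k" for i using sub that by auto
  have bL: "b i \<in> lift_set Q f" if "i < k" for i using sub that by auto
  have small: "0 < x \<and> x < K" if "p \<in> Q" "x \<in> f p" for p x
  proof -
    have "f p \<subseteq> {1..d p}" "d p < K" using f[OF that(1)] unfolding nbhds_def by blast+
    thus ?thesis using that(2) by fastforce
  qed
  \<comment> \<open>Cofactors are below \<open>K\<close> and primes of \<open>Q\<close> at least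
    \<open>K\<close>, so \<open>P m\<close> is the only prime divisor of m in
    \<open>Q\<close>.\<close>
  have dvdP: "P m = p" if m: "m \<in> lift_set Q f" and p: "p \<in> Q" "p dvd m" for m p
  proof -
    have "0 < r m" "r m < K" using small[OF PQ[OF m] rf[OF m]] by auto
    hence "\<not> p dvd r m" using Q[OF p(1)] by (auto dest: dvd_imp_le)
    moreover have "p dvd r m * P m" using rP[OF m] p by simp
    ultimately have "p dvd P m" using Q[OF p(1)] prime_dvd_mult_iff by blast
    thus ?thesis using Q[OF PQ[OF m]] Q[OF p(1)] primes_dvd_imp_eq by metis
  qed
  have three: False if "x \<in> lift_set Q f" "y \<in> lift_set Q f" "z \<in> lift_set Q f" "P x = P y" "P y = P z"
     "x \<noteq> y" "y \<noteq> z" "x \<noteq> z" for x y z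
  proof -
    have "r x \<noteq> r y" "r y \<noteq> r z" "r x \<noteq> r z" using rP that by metis+
    moreover have "{r x, r y, r z} \<subseteq> f (P x)"
      using rf[OF that(1)] rf[OF that(2)] rf[OF that(3)] that(4,5) by auto
    moreover have "P x \<in> Q" using PQ that by auto
    hence "f (P x) = {} \<or> (\<exists>a. f (P x) = {a}) \<or> (\<exists>a b. f (P x) = {a, b})"
      using f[of "P x"] by (auto simp: nbhds_def)
    ultimately show False by auto
  qed
  have match: "\<exists>j<k. P (v j) = P (u i)"
    if uv: "\<And>i. i < k \<Longrightarrow> u i \<in> lift_set Q f" "\<And>i. i < k \<Longrightarrow> v i \<in> lift_set Q f" "(\<Prod>i<k. u i) = (\<Prod>i<k. v i)" "i < k" for u v i
  proof -
    have "P (u i) dvd u i" using rP[OF uv(1)[OF uv(4)]] by (metis dvd_triv_right)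
    also have "u i dvd (\<Prod>i<k. u i)" using uv(4) by (intro dvd_prodI) auto
    finally have "P (u i) dvd (\<Prod>i<k. v i)" using uv(3) by simp
    moreover have "prime (P (u i))" using PQ[OF uv(1)[OF uv(4)]] Q by blast
    ultimately obtain j where "j < k" "P (u i) dvd v j" by (auto simp: prime_dvd_prod_iff)
    thus ?thesis using dvdP[OF uv(2)] PQ[OF uv(1)[OF uv(4)]] by blast
  qed
  have ab_ne: "a i \<noteq> b j" if "i < k" "j < k" for i j using disj that by blast
  \<comment> \<open>If a i and a j shared a prime, it would divide some b l as well, and three
    distinct elements would lie over one prime.\<close>
  have injP: "inj_on (\<lambda>i. P (a i)) {..<k}"
  proof (rule inj_onI, rule ccontr)
    fix i j assume ij: "i \<in> {..<k}" "j \<in> {..<k}" "P (a i) = P (a j)" "i \<noteq> j"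
    have "\<exists>l<k. P (b l) = P (a j)" by (rule match[OF aL bL eq]) (use ij in auto)
    then obtain l where l: "l < k" "P (b l) = P (a j)" by metis
    have "a i \<noteq> a j" using ij inj_onD[OF inj(1)] by blast
    thus False using three[OF aL[of i] aL[of j] bL[of l] ij(3) l(2)[symmetric]] ij(1,2) l(1)
        ab_ne[of i l] ab_ne[of j l] by simp
  qed
  have "\<exists>j<k. P (b j) = P (a i)" if "i < k" for i by (rule match[OF aL bL eq that])
  then obtain \<sigma> where \<sigma>: "\<And>i. i < k \<Longrightarrow> \<sigma> i < k \<and> P (b (\<sigma> i)) = P (a i)" by metis
  have "inj_on \<sigma> {..<k}"
  proof (rule inj_onI)
    fix i j assume ij: "i \<in> {..<k}" "j \<in> {..<k}" "\<sigma> i = \<sigma> j"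
    hence "P (a i) = P (a j)" using \<sigma>[of i] \<sigma>[of j] by simp
    thus "i = j" using inj_onD[OF injP] ij by blast
  qed
  moreover from this have "\<sigma> ` {..<k} = {..<k}" by (intro endo_inj_surj) (use \<sigma> in auto)
  ultimately have bij: "bij_betw \<sigma> {..<k} {..<k}" by (simp add: bij_betw_def)
  have "(\<Prod>i<k. r (a i)) * (\<Prod>i<k. P (a i)) = (\<Prod>i<k. a i)"
    unfolding prod.distrib[symmetric] by (intro prod.cong refl rP aL) simp
  also have "\<dots> = (\<Prod>i<k. b (\<sigma> i))" unfolding eq by (rule prod.reindex_bij_betw[OF bij, symmetric])
  also have "\<dots> = (\<Prod>i<k. r (b (\<sigma> i))) * (\<Prod>i<k. P (a i))"
    unfolding prod.distrib[symmetric]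
  proof (intro prod.cong refl)
    fix i assume "i \<in> {..<k}"
    thus "b (\<sigma> i) = r (b (\<sigma> i)) * P (a i)" using rP[OF bL, of "\<sigma> i"] \<sigma>[of i] by simp
  qed
  finally have "(\<Prod>i<k. r (a i)) * (\<Prod>i<k. P (a i)) = (\<Prod>i<k. r (b (\<sigma> i))) * (\<Prod>i<k. P (a i))" .
  moreover have "P (a i) \<noteq> 0" if "i < k" for i
  proof -
    have "prime (P (a i))" using Q[OF PQ[OF aL[OF that]]] by simp
    thus ?thesis by (metis not_prime_0)
  qed
  hence "(\<Prod>i<k. P (a i)) \<noteq> 0" by simp
  ultimately have prods: "(\<Prod>i<k. r (a i)) = (\<Prod>i<k. r (b (\<sigma> i)))" by simp
  \<comment> \<open>Two different elements, a i and b (\<sigma> i), lie over the same prime, so its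
    cofactor set has two members and must be an edge.\<close>
  have "E (r (a i)) (r (b (\<sigma> i)))" if i: "i < k" for i
  proof -
    have in1: "r (a i) \<in> f (P (a i))" "r (b (\<sigma> i)) \<in> f (P (a i))" "P (a i) \<in> Q"
      using rf[OF aL[OF i]] rf[OF bL, of "\<sigma> i"] PQ[OF aL[OF i]] \<sigma>[OF i] by auto
    have ne: "r (a i) \<noteq> r (b (\<sigma> i))"
      using rP[OF aL[OF i]] rP[OF bL, of "\<sigma> i"] \<sigma>[OF i] ab_ne[OF i, of "\<sigma> i"] by metis
    from f[OF in1(3)] in1 ne obtain x y where xy: "E x y" "f (P (a i)) = {x, y}"
      by (auto simp: nbhds_def)
    have "E y x" using xy E by (auto simp: kfree_def graph_on_pos_def)
    thus ?thesis using in1 ne xy by auto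
  qed
  with prods have "balanced k E" unfolding balanced_def
    by (intro exI[of _ "\<lambda>i. r (a i)"] exI[of _ "\<lambda>i. r (b (\<sigma> i))"]) simp
  thus False using E by (simp add: kfree_def)
qed

text \<open>Since K^2 <= n, every prime above n div K exceeds K, while its cofactors are below K. So
  a family of cofactor sets can be read back from its lifted set, and there are at least as many
  Sidon sets as families.\<close>

lemma lower_bound:
  assumes E: "kfree k E" and K: "K > 0" "K\<^sup>2 \<le> n"
  shows "(\<Prod>p\<in>{p\<in>primes_upto n. n div K < p}. edges_upto E (n div p) + n div p + 1) \<le> S k n"
proof -
  define Q where "Q = {p\<in>primes_upto n. n div K < p}"
  have fQ: "finite Q" by (simp add: Q_def)
  have "K * K div K \<le> n div K" using K by (intro div_le_mono) (simp add: power2_eq_square)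
  hence nK: "K \<le> n div K" using K by simp
  have Q: "prime p" "K < p" "p \<le> n" "n div p < K" if "p \<in> Q" for p
  proof -
    show "prime p" "K < p" "p \<le> n" using that nK by (auto simp: Q_def primes_upto_def)
    have "n < K * p" using that K by (simp add: Q_def div_less_iff_less_mult mult.commute)
    thus "n div p < K" using \<open>K < p\<close> by (simp add: div_less_iff_less_mult)
  qed
  define F where "F = (\<lambda>p. nbhds E (n div p))"
  have fF: "0 < x \<and> x \<le> n div p \<and> x < K" if "f \<in> PiE Q F" "p \<in> Q" "x \<in> f p" for f p x
    using PiE_mem[OF that(1,2)] that(3) Q[OF that(2)] by (auto simp: F_def nbhds_def subset_iff Suc_le_eq)
  have recover: "f p = {x. 0 < x \<and> x < K \<and> x * p \<in> lift_set Q f}" if f: "f \<in> PiE Q F" and p: "p \<in> Q" for f p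
  proof (intro equalityI subsetI)
    fix x assume "x \<in> {x. 0 < x \<and> x < K \<and> x * p \<in> lift_set Q f}"
    then obtain q y where qy: "0 < x" "x < K" "q \<in> Q" "y \<in> f q" "x * p = y * q"
      by (auto simp: lift_set_def)
    have "0 < y" "y < K" using fF[OF f qy(3,4)] by auto
    hence "x = y \<and> p = q" using qy Q[OF p] Q[OF qy(3)] by (intro lift_mult_unique) auto
    thus "x \<in> f p" using qy by auto
  qed (use fF[OF f p] p in \<open>auto simp: lift_set_def\<close>)
  have inj: "inj_on (lift_set Q) (PiE Q F)"
  proof (rule inj_onI)
    fix f g assume fg: "f \<in> PiE Q F" "g \<in> PiE Q F" "lift_set Q f = lift_set Q g"
    show "f = g"
    proof (rule PiE_ext[OF fg(1,2)])
      fix p assume "p \<in> Q"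
      thus "f p = g p" using recover[OF fg(1)] recover[OF fg(2)] fg(3) by simp
    qed
  qed
  have "(\<Prod>p\<in>Q. edges_upto E (n div p) + n div p + 1) = (\<Prod>p\<in>Q. card (F p))"
    unfolding F_def by (intro prod.cong refl card_nbhds[symmetric]) (use E in \<open>simp add: kfree_def\<close>)
  also have "\<dots> = card (PiE Q F)" by (rule card_PiE[OF fQ, symmetric])
  also have "\<dots> = card (lift_set Q ` PiE Q F)" by (rule card_image[OF inj, symmetric])
  also have "\<dots> \<le> S k n" unfolding S_def
  proof (rule card_mono[OF finite_S_sets], safe)
    fix f assume f: "f \<in> PiE Q F"
    show "mult_k_Sidon k (lift_set Q f)"
      by (rule lift_set_Sidon[OF E, where K = K and d = "\<lambda>p. n div p"])
         (use Q PiE_mem[OF f] in \<open>auto simp: F_def less_imp_le\<close>)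
    fix m assume "m \<in> lift_set Q f"
    then obtain p x where px: "p \<in> Q" "x \<in> f p" "m = x * p" by (auto simp: lift_set_def)
    have "0 < x" "x \<le> n div p" using fF[OF f px(1,2)] by auto
    hence "x * p \<le> n" using Q[OF px(1)] by (simp add: less_eq_div_iff_mult_less_eq)
    thus "m \<in> {1..n}" using px \<open>0 < x\<close> Q(2)[OF px(1)] by (auto simp: Suc_le_eq)
  qed
  finally show ?thesis by (simp add: Q_def)
qed

section \<open>Counting elements without large prime factors\<close>

lemma balanced_0: "balanced 0 E"
  by (auto simp: balanced_def)

text \<open>An edge followed by its reverse multiplies both sides by a * b. So a relation can be
  lengthened at will within its parity class.\<close>

lemma balanced_add2:
  assumes "balanced k E" "E a b" "E b a"
  shows "balanced (k + 2) E"
proof -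
  obtain x y :: "nat \<Rightarrow> nat" where xy: "\<forall>i<k. E (x i) (y i)" "(\<Prod>i<k. x i) = (\<Prod>i<k. y i)"
    using assms(1) by (auto simp: balanced_def)
  define x' where "x' = (\<lambda>i. if i < k then x i else if i = k then a else b)"
  define y' where "y' = (\<lambda>i. if i < k then y i else if i = k then b else a)"
  have "(\<Prod>i<k+2. x' i) = (\<Prod>i<k. x i) * (a * b)" "(\<Prod>i<k+2. y' i) = (\<Prod>i<k. y i) * (a * b)"
    by (simp_all add: x'_def y'_def numeral_2_eq_2)
  moreover have "\<forall>i<k+2. E (x' i) (y' i)" using xy assms by (auto simp: x'_def y'_def)
  ultimately show ?thesis unfolding balanced_def using xy by metis
qed

lemma balanced_add_even: "balanced k E \<Longrightarrow> E a b \<Longrightarrow> E b a \<Longrightarrow> balanced (k + 2 * m) E"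
proof (induction m)
  case (Suc m)
  from balanced_add2[OF Suc.IH[OF Suc.prems] Suc.prems(2,3)] show ?case by (simp add: add_ac)
qed simp

lemma balanced_3:
  assumes "E a b" "E b c" "E c a"
  shows "balanced 3 E"
  unfolding balanced_def
proof (intro exI conjI)
  let ?x = "\<lambda>i::nat. if i = 0 then a else if i = 1 then b else c"
  let ?y = "\<lambda>i::nat. if i = 0 then b else if i = 1 then c else a"
  show "\<forall>i<3. E (?x i) (?y i)" using assms by auto
  show "(\<Prod>i<3. ?x i) = (\<Prod>i<3. ?y i)" by (simp add: numeral_3_eq_3)
qed

text \<open>Even lengths extend the empty relation, odd ones the cycle a, b, c of length 3.\<close>

lemma balanced_triangle:
  assumes "k \<ge> 3" "a \<noteq> b" "b \<noteq> c" "a \<noteq> c"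
  shows "balanced k (\<lambda>x y. x \<noteq> y \<and> x \<in> {a, b, c} \<and> y \<in> {a, b, c})"
proof (cases "even k")
  case True
  then obtain m where m: "k = 0 + 2 * m" by auto
  show ?thesis unfolding m by (rule balanced_add_even[OF balanced_0, where a = a and b = b]) (use assms in auto)
next
  case False
  then obtain m where "k = 2 * m + 1" by (auto elim: oddE)
  with assms(1) have m: "k = 3 + 2 * (m - 1)" by auto
  show ?thesis unfolding m
    by (rule balanced_add_even[OF balanced_3[of _ a b c], where a = a and b = b]) (use assms in auto)
qed

text \<open>Elements of \<open>A\<close> are edges (u, v) of a bipartite graph, valued u * v.
  Multiplying the relation by the v i gives a solution in \<open>A\<close>. Its 2k members are
  distinct because products determine edges, the v i are distinct, and x i differs from y i.\<close>

lemma not_Sidon_of_balanced: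
  fixes R :: "(nat \<times> nat) set"
  assumes inj: "inj_on (\<lambda>(u, v). u * v) R" and sub: "(\<lambda>(u, v). u * v) ` R \<subseteq> A"
    and v: "inj_on v {..<k}" and xR: "\<And>i. i < k \<Longrightarrow> (x i, v i) \<in> R" and yR: "\<And>i. i < k \<Longrightarrow> (y i, v i) \<in> R"
    and ne: "\<And>i. i < k \<Longrightarrow> x i \<noteq> y i" and prods: "(\<Prod>i<k. x i) = (\<Prod>i<k. y i)"
  shows "\<not> mult_k_Sidon k A"
proof -
  have eqD: "(u, w) = (u', w')" if "(u, w) \<in> R" "(u', w') \<in> R" "u * w = u' * w'" for u w u' w'
    using inj_onD[OF inj, of "(u, w)" "(u', w')"] that by auto
  have vD: "i = j" if "i < k" "j < k" "v i = v j" for i j using v that by (auto simp: inj_on_def)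
  have "inj_on (\<lambda>i. x i * v i) {..<k}" "inj_on (\<lambda>i. y i * v i) {..<k}"
    using eqD[OF xR xR] eqD[OF yR yR] vD by (auto intro!: inj_onI)
  moreover have "(\<lambda>i. x i * v i) ` {..<k} \<inter> (\<lambda>i. y i * v i) ` {..<k} = {}"
  proof -
    have False if "i < k" "j < k" "x i * v i = y j * v j" for i j
      using eqD[OF xR yR, of i j] that vD[of i j] ne[of i] by auto
    thus ?thesis by blast
  qed
  moreover have "(\<lambda>i. x i * v i) ` {..<k} \<subseteq> A" "(\<lambda>i. y i * v i) ` {..<k} \<subseteq> A"
    using sub xR yR by auto
  moreover have "(\<Prod>i<k. x i * v i) = (\<Prod>i<k. y i * v i)" by (simp add: prod.distrib prods)
  ultimately show ?thesis unfolding mult_k_Sidon_def by metis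
qed

lemma inj_nat_into_set:
  assumes "finite F" "card F \<ge> k"
  obtains v :: "nat \<Rightarrow> 'a" where "inj_on v {..<k}" "v ` {..<k} \<subseteq> F"
proof -
  have "card {..<k} \<le> card F" using assms by simp
  from card_le_inj[OF _ assms(1) this] show ?thesis using that by auto
qed

text \<open>Greedy choice: fewer than k values are in use at any time, so a set of at least k
  elements still offers a new one.\<close>

lemma inj_choice:
  assumes "\<And>i. i < k \<Longrightarrow> finite (F i) \<and> card (F i) \<ge> k"
  obtains v :: "nat \<Rightarrow> 'a" where "inj_on v {..<k}" "\<And>i. i < k \<Longrightarrow> v i \<in> F i"
proof -
  have "m \<le> k \<Longrightarrow> \<exists>v. inj_on v {..<m} \<and> (\<forall>i<m. v i \<in> F i)" for m
  proof (induction m)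
    case (Suc m)
    then obtain v where v: "inj_on v {..<m}" "\<forall>i<m. v i \<in> F i" by auto
    have "card (v ` {..<m}) \<le> m" using card_image_le[of "{..<m}" v] by simp
    hence "card (v ` {..<m}) < card (F m)" using assms[of m] Suc.prems by auto
    hence "\<not> F m \<subseteq> v ` {..<m}" using card_mono[of "v ` {..<m}" "F m"] by auto
    then obtain z where z: "z \<in> F m" "z \<notin> v ` {..<m}" by auto
    have "inj_on (v(m := z)) {..<Suc m}" using v z by (auto simp: inj_on_def less_Suc_eq)
    moreover have "\<forall>i<Suc m. (v(m := z)) i \<in> F i" using v z by (auto simp: less_Suc_eq)
    ultimately show ?case by blast
  qed auto
  from this[of k] show ?thesis using that by auto
qed

lemma card_le_of_fibres:
  assumes "finite X" "finite Y" "f ` X \<subseteq> Y" "\<And>y. y \<in> Y \<Longrightarrow> card {x\<in>X. f x = y} \<le> k"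
  shows "card X \<le> k * card Y"
proof -
  have "card X = (\<Sum>y\<in>Y. card {x\<in>X. f x = y})"
    using sum.group[OF assms(1-3), of "\<lambda>_. 1::nat"] by simp
  also have "\<dots> \<le> (\<Sum>y\<in>Y. k)" by (intro sum_mono assms)
  finally show ?thesis by (simp add: mult.commute)
qed

text \<open>Assign to each rich v a triple of its neighbours. A triple assigned more than k times
  would carry the relation of \<open>balanced_triangle\<close>, and there are at most T^3
  triples.\<close>

lemma few_rich_vertices:
  fixes R :: "(nat \<times> nat) set"
  assumes inj: "inj_on (\<lambda>(u, v). u * v) R" and sub: "(\<lambda>(u, v). u * v) ` R \<subseteq> A"
    and A: "mult_k_Sidon k A" and k: "k \<ge> 3" and R: "R \<subseteq> B \<times> V" and fin: "finite B" "finite V" and T: "card B \<le> T"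
  shows "card {v\<in>V. 3 \<le> card {u. (u, v) \<in> R}} \<le> k * T ^ 3"
proof -
  define X where "X = {v\<in>V. 3 \<le> card {u. (u, v) \<in> R}}"
  define Y where "Y = {W. W \<subseteq> B \<and> card W = 3}"
  have "\<exists>W. W \<subseteq> {u. (u, v) \<in> R} \<and> card W = 3" if "v \<in> X" for v
    using that by (auto simp: X_def intro: obtain_subset_with_card_n)
  then obtain W where W: "\<And>v. v \<in> X \<Longrightarrow> W v \<subseteq> {u. (u, v) \<in> R} \<and> card (W v) = 3" by metis
  have "card {v\<in>X. W v = w} \<le> k" for w
  proof (rule ccontr)
    assume "\<not> ?thesis"
    hence gt: "card {v\<in>X. W v = w} > k" by simp
    hence "{v\<in>X. W v = w} \<noteq> {}" by (metis card.empty not_less0)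
    then obtain v0 where "v0 \<in> X" "W v0 = w" by auto
    hence "card w = 3" using W by auto
    then obtain a b c where abc: "w = {a, b, c}" "a \<noteq> b" "b \<noteq> c" "a \<noteq> c" by (auto simp: card_3_iff)
    have "finite {v\<in>X. W v = w}" using fin by (simp add: X_def)
    then obtain v where v: "inj_on v {..<k}" "v ` {..<k} \<subseteq> {v\<in>X. W v = w}"
      by (rule inj_nat_into_set[where k = k]) (use gt in simp)
    obtain x y :: "nat \<Rightarrow> nat" where xy: "\<forall>i<k. x i \<noteq> y i \<and> x i \<in> w \<and> y i \<in> w" "(\<Prod>i<k. x i) = (\<Prod>i<k. y i)"
      using balanced_triangle[OF k abc(2-4)] unfolding balanced_def abc(1) by blast
    have wR: "(u, v i) \<in> R" if "i < k" "u \<in> w" for i u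
    proof -
      have "v i \<in> {v\<in>X. W v = w}" using v(2) that(1) by blast
      thus ?thesis using W[of "v i"] that(2) by auto
    qed
    have "\<not> mult_k_Sidon k A"
      by (rule not_Sidon_of_balanced[OF inj sub v(1), of x y]) (use xy wR in auto)
    thus False using A by simp
  qed
  moreover have "W ` X \<subseteq> Y" using W R by (fastforce simp: Y_def)
  ultimately have "card X \<le> k * card Y"
    using fin by (intro card_le_of_fibres) (auto simp: X_def Y_def)
  also have "card Y \<le> T ^ 3"
  proof -
    have "card Y = card B choose 3" unfolding Y_def by (rule n_subsets[OF fin(1)])
    also have "\<dots> \<le> card B ^ 3" by (cases "3 \<le> card B") (auto simp: binomial_le_pow binomial_eq_0)
    also have "\<dots> \<le> T ^ 3" using T by (rule power_mono) simp
    finally show ?thesis .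
  qed
  finally show ?thesis by (simp add: X_def)
qed

text \<open>A vertex that is not rich has at most two edges, a rich one at most T; so the main cost
  is 2 per vertex of \<open>V\<close> instead of the trivial T.\<close>

lemma card_block_le:
  fixes R :: "(nat \<times> nat) set"
  assumes inj: "inj_on (\<lambda>(u, v). u * v) R" and sub: "(\<lambda>(u, v). u * v) ` R \<subseteq> A"
    and A: "mult_k_Sidon k A" and k: "k \<ge> 3" and R: "R \<subseteq> B \<times> V" and fin: "finite B" "finite V" and T: "card B \<le> T"
  shows "card R \<le> 2 * card V + k * T ^ 4"
proof -
  define X where "X = {v\<in>V. 3 \<le> card {u. (u, v) \<in> R}}"
  have fU: "finite {u. (u, v) \<in> R}" for v
    by (rule finite_subset[OF _ fin(1)]) (use R in auto)
  have "card R = card (Sigma V (\<lambda>v. {u. (u, v) \<in> R}))"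
    by (rule bij_betw_same_card[of "\<lambda>(u, v). (v, u)"], rule bij_betwI[of _ _ _ "\<lambda>(u, v). (v, u)"]) (use R in auto)
  also have "\<dots> = (\<Sum>v\<in>V. card {u. (u, v) \<in> R})" using fin fU by simp
  also have "\<dots> \<le> (\<Sum>v\<in>V. 2 + (if v \<in> X then T else 0))"
  proof (rule sum_mono)
    fix v assume v: "v \<in> V"
    have "card {u. (u, v) \<in> R} \<le> card B" using R by (intro card_mono fin) auto
    thus "card {u. (u, v) \<in> R} \<le> 2 + (if v \<in> X then T else 0)"
      using T v by (auto simp: X_def)
  qed
  also have "\<dots> = 2 * card V + card X * T"
  proof -
    have "V \<inter> {v. v \<in> X} = X" by (auto simp: X_def)
    thus ?thesis unfolding sum.distrib using fin by (simp add: sum.If_cases)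
  qed
  also have "card X * T \<le> k * T ^ 3 * T"
    using few_rich_vertices[OF assms] by (intro mult_right_mono) (auto simp: X_def)
  finally show ?thesis by (simp add: power_numeral_reduce mult_ac)
qed

section \<open>Elements all of whose prime factors are small\<close>

text \<open>Take v as the largest divisor of m up to n div T, and u = m / v. If u <= n div T,
  maximality gives u <= v. Otherwise v < T, a prime q of u satisfies q <= v, and v * q <= T^2 <= n
  div T contradicts maximality.\<close>

lemma smooth_factorization:
  fixes m n T :: nat
  assumes m: "1 \<le> m" "m \<le> n" and T: "T \<ge> 1" "T ^ 3 \<le> n" and sm: "\<And>p. prime p \<Longrightarrow> p dvd m \<Longrightarrow> p \<le> n div T"
  obtains u v where "m = u * v" "v \<le> n div T" "u * u \<le> n"
proof -
  define D where "D = {v. v dvd m \<and> v \<le> n div T}"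
  have T2: "T * T \<le> n div T" using T by (simp add: less_eq_div_iff_mult_less_eq power3_eq_cube)
  have "1 * 1 \<le> T * T" using T by (intro mult_le_mono) auto
  hence nT: "1 \<le> n div T" using T2 by linarith
  have finD: "finite D" by (rule finite_subset[of _ "{..n div T}"]) (auto simp: D_def)
  have "1 \<in> D" using nT by (simp add: D_def)
  define v where "v = Max D"
  have vD: "v \<in> D" unfolding v_def using \<open>1 \<in> D\<close> finD by (intro Max_in) auto
  have vmax: "w \<le> v" if "w \<in> D" for w unfolding v_def using that finD by simp
  obtain u where u: "m = v * u" using vD by (auto simp: D_def)
  have v1: "v \<ge> 1" using vmax[OF \<open>1 \<in> D\<close>] .
  show ?thesis
  proof (cases "u \<le> n div T")
    case True
    hence "u \<le> v" using u by (intro vmax) (auto simp: D_def)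
    hence "u * u \<le> u * v" by simp
    also have "\<dots> \<le> n" using u m by (simp add: mult.commute)
    finally have "u * u \<le> n" .
    moreover have "m = u * v" "v \<le> n div T" using u vD by (auto simp: D_def)
    ultimately show ?thesis using that by blast
  next
    case False
    have "u \<noteq> 1" using False nT by auto
    then obtain q where q: "prime q" "q dvd u" by (metis prime_factor_nat)
    have "q dvd m" using q u by auto
    hence "q \<in> D" using sm q by (auto simp: D_def)
    hence "q \<le> v" by (rule vmax)
    have "n < u * T" using False T by (simp add: div_less_iff_less_mult not_le)
    moreover have "u * v = m" using u by (simp add: mult.commute)
    ultimately have "u * v < u * T" using m by linarith
    hence "v < T" by simp
    hence "v * q \<le> T * T" using \<open>q \<le> v\<close> by (intro mult_le_mono) auto
    hence "v * q \<in> D" using T2 q u by (auto simp: D_def intro: mult_dvd_mono)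
    hence "v * q \<le> v" by (rule vmax)
    hence "q \<le> 1" using v1 by (simp add: mult_le_cancel1)
    thus ?thesis using q prime_gt_1_nat[of q] by auto
  qed
qed

text \<open>Factor m = u * v with u <= r and cut the range of u into blocks of length T. In block j,
  u >= j T forces v <= n / (T j), whereas block 0 only has v <= n / T; hence \<open>max 1 j\<close>.
  The first terms sum to about (n / T) ln n instead of n.\<close>

lemma card_smooth_part:
  fixes n T r :: nat
  assumes A: "mult_k_Sidon k A" "A \<subseteq> {1..n}" and k: "k \<ge> 3" and T: "T \<ge> 1" "T ^ 3 \<le> n" and r: "n < (r + 1) * (r + 1)"
  shows "card {m\<in>A. \<forall>p\<in>primes_upto n. n div T < p \<longrightarrow> \<not> p dvd m} \<le> (\<Sum>j\<le>r. 2 * (n div (T * max 1 j)) + k * T ^ 4)"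
proof -
  define Z where "Z = {m\<in>A. \<forall>p\<in>primes_upto n. n div T < p \<longrightarrow> \<not> p dvd m}"
  have "\<exists>u v. m = u * v \<and> v \<le> n div T \<and> u * u \<le> n" if mZ: "m \<in> Z" for m
  proof -
    have m: "1 \<le> m" "m \<le> n" using mZ A by (auto simp: Z_def)
    have "p \<le> n div T" if p: "prime p" "p dvd m" for p
    proof -
      have "p \<le> n" using p m by (auto dest: dvd_imp_le)
      thus ?thesis using mZ p by (auto simp: Z_def primes_upto_def not_less)
    qed
    from smooth_factorization[OF m T this] show ?thesis by blast
  qed
  then obtain U V where UV: "\<And>m. m \<in> Z \<Longrightarrow> m = U m * V m \<and> V m \<le> n div T \<and> U m * U m \<le> n" by metis
  have fZ: "finite Z" by (rule finite_subset[of _ "{1..n}"]) (use A in \<open>auto simp: Z_def\<close>)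
  define Zj where "Zj = (\<lambda>j. {m\<in>Z. U m div T = j})"
  have "Z \<subseteq> (\<Union>j\<in>{..r}. Zj j)"
  proof
    fix m assume m: "m \<in> Z"
    have "U m \<le> r"
    proof (rule ccontr)
      assume "\<not> ?thesis"
      hence "(r + 1) * (r + 1) \<le> U m * U m" by (intro mult_le_mono) auto
      thus False using UV[OF m] r by linarith
    qed
    \<comment> \<open>A crude range for j: only about r / T blocks can be nonempty, but r + 1 terms
      are still affordable.\<close>
    hence "U m div T \<le> r" using div_le_dividend order_trans by blast
    thus "m \<in> (\<Union>j\<in>{..r}. Zj j)" using m by (auto simp: Zj_def)
  qed
  hence "card Z \<le> card (\<Union>j\<in>{..r}. Zj j)"
    by (intro card_mono) (auto intro: finite_subset[OF _ fZ] simp: Zj_def)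
  also have "\<dots> \<le> (\<Sum>j\<le>r. card (Zj j))" by (rule card_UN_le) simp
  also have "\<dots> \<le> (\<Sum>j\<le>r. 2 * (n div (T * max 1 j)) + k * T ^ 4)"
  proof (rule sum_mono)
    fix j
    define R where "R = (\<lambda>m. (U m, V m)) ` Zj j"
    have injUV: "inj_on (\<lambda>m. (U m, V m)) (Zj j)" using UV by (intro inj_onI) (metis (mono_tags, lifting) Pair_inject Zj_def mem_Collect_eq)
    have prod: "U m * V m = m" if "m \<in> Zj j" for m using UV that by (auto simp: Zj_def)
    have "inj_on (\<lambda>(u, v). u * v) R" unfolding R_def by (intro inj_onI) (auto simp: prod)
    moreover have "(\<lambda>(u, v). u * v) ` R \<subseteq> A" unfolding R_def using prod by (auto simp: Zj_def Z_def)
    moreover have "R \<subseteq> {j * T..<j * T + T} \<times> {1..n div (T * max 1 j)}"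
    proof -
      have "U m \<in> {j * T..<j * T + T} \<and> V m \<in> {1..n div (T * max 1 j)}" if m: "m \<in> Zj j" for m
      proof -
        have mZ: "m \<in> Z" and j: "U m div T = j" using m by (auto simp: Zj_def)
        have Uj: "j * T \<le> U m" "U m < j * T + T"
        proof -
          have "U m = j * T + U m mod T" using div_mult_mod_eq[of "U m" T] j by simp
          moreover have "U m mod T < T" using T by simp
          ultimately show "j * T \<le> U m" "U m < j * T + T" by linarith+
        qed
        have m1: "1 \<le> m" "m \<le> n" using mZ A by (auto simp: Z_def)
        have V1: "V m \<ge> 1" using UV[OF mZ] m1 by (cases "V m") auto
        have "V m \<le> n div (T * max 1 j)"
        proof (cases "j = 0")
          case False
          have "V m * (T * j) \<le> V m * U m" using Uj by (simp add: mult.commute)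
          also have "\<dots> \<le> n" using UV[OF mZ] m1 by (simp add: mult.commute)
          finally show ?thesis using False T by (simp add: less_eq_div_iff_mult_less_eq max_def)
        qed (use UV[OF mZ] in simp)
        thus ?thesis using Uj V1 by auto
      qed
      thus ?thesis unfolding R_def by auto
    qed
    ultimately have "card R \<le> 2 * card {1..n div (T * max 1 j)} + k * T ^ 4"
      by (intro card_block_le[OF _ _ A(1) k]) auto
    moreover have "card R = card (Zj j)" unfolding R_def by (rule card_image[OF injUV])
    ultimately show "card (Zj j) \<le> 2 * (n div (T * max 1 j)) + k * T ^ 4" by simp
  qed
  finally show ?thesis by (simp add: Z_def)
qed

text \<open>Write the elements of the set into \<open>s\<close> slots and mark the surplus slots
  with \<open>None\<close>; the set is recovered from the values.\<close>

lemma card_subsets_le: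
  assumes "finite X"
  shows "card {B. B \<subseteq> X \<and> card B \<le> s} \<le> (card X + 1) ^ s"
proof -
  define F where "F = PiE {..<s} (\<lambda>_. insert None (Some ` X))"
  have "{B. B \<subseteq> X \<and> card B \<le> s} \<subseteq> (\<lambda>f. {x. Some x \<in> f ` {..<s}}) ` F"
  proof
    fix B assume "B \<in> {B. B \<subseteq> X \<and> card B \<le> s}"
    hence B: "B \<subseteq> X" "card B \<le> s" by auto
    have "finite B" using B assms finite_subset by auto
    then obtain h where h: "bij_betw h {0..<card B} B" using ex_bij_betw_nat_finite by blast
    define f where "f = (\<lambda>i\<in>{..<s}. if i < card B then Some (h i) else None)"
    have hB: "h i \<in> B" if "i < card B" for i using h that by (auto simp: bij_betw_def)
    have hX: "h i \<in> X" if "i < card B" for i using hB[OF that] B by blast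
    have "f \<in> F" unfolding F_def f_def using hX by (auto intro!: PiE_I)
    moreover have "B = {x. Some x \<in> f ` {..<s}}"
    proof (intro equalityI subsetI)
      fix x assume "x \<in> B"
      hence "x \<in> h ` {0..<card B}" using bij_betw_imp_surj_on[OF h] by simp
      then obtain i where i: "i < card B" "x = h i" by auto
      hence "Some x = f i" "i < s" using B by (auto simp: f_def)
      thus "x \<in> {x. Some x \<in> f ` {..<s}}" by auto
    next
      fix x assume "x \<in> {x. Some x \<in> f ` {..<s}}"
      then obtain i where "i < s" "Some x = f i" by auto
      thus "x \<in> B" using hB by (auto simp: f_def split: if_splits)
    qed
    ultimately show "B \<in> (\<lambda>f. {x. Some x \<in> f ` {..<s}}) ` F" by blast
  qed
  hence "card {B. B \<subseteq> X \<and> card B \<le> s} \<le> card ((\<lambda>f. {x. Some x \<in> f ` {..<s}}) ` F)"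
    using assms by (intro card_mono finite_imageI) (auto simp: F_def intro!: finite_PiE)
  also have "\<dots> \<le> card F" using assms by (intro card_image_le) (auto simp: F_def intro!: finite_PiE)
  also have "\<dots> = (card X + 1) ^ s"
    using assms by (simp add: F_def card_PiE card_insert_if card_image)
  finally show ?thesis .
qed

section \<open>Elements with a large prime factor\<close>

locale large_prime_split =
  fixes n T k :: nat
  assumes T1: "T \<ge> 1" and T3: "T ^ 3 \<le> n" and k3: "k \<ge> 3"
begin

definition large_primes :: "nat set" where
  "large_primes = {p\<in>primes_upto n. n div T < p}"

definition cofactors :: "nat set \<Rightarrow> nat \<Rightarrow> nat set" where
  "cofactors A p = {i\<in>{1..n div p}. i * p \<in> A}"

abbreviation pair_primes :: "nat set \<Rightarrow> nat \<Rightarrow> nat \<Rightarrow> nat set" where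
  "pair_primes A a b \<equiv> {p\<in>large_primes. cofactors A p = {a, b}}"

text \<open>With threshold k, distinct primes can be chosen for any k popular pairs, even if pairs
  repeat.\<close>

definition popular :: "nat set \<Rightarrow> nat \<Rightarrow> nat \<Rightarrow> bool" where
  "popular A a b \<longleftrightarrow> a \<noteq> b \<and> k \<le> card (pair_primes A a b)"

definition typical :: "nat set \<Rightarrow> nat set" where
  "typical A = {p\<in>large_primes. cofactors A p \<in> nbhds (popular A) (n div p)}"

definition cofactor_pairs :: "nat set \<Rightarrow> (nat \<times> nat) set" where
  "cofactor_pairs A = {(i, p). p \<in> large_primes \<and> i \<in> cofactors A p}"

lemma finite_large_primes [simp]: "finite large_primes"
  by (simp add: large_primes_def)

text \<open>The purpose of T^3 <= n: a large prime exceeds n div T >= T^2 >= T and therefore all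
  cofactors, which are below T.\<close>

lemma T_le: "T * T \<le> n div T"
  using T1 T3 by (simp add: less_eq_div_iff_mult_less_eq power3_eq_cube)

lemma large_primes_props:
  assumes "p \<in> large_primes"
  shows "prime p" "T < p" "n div p < T" "p \<le> n"
proof -
  have "T \<le> T * T" using T1 by simp
  moreover have "n div T < p" using assms by (simp add: large_primes_def)
  ultimately show Tp: "T < p" using T_le by linarith
  have "n < p * T" using assms T1 by (simp add: large_primes_def div_less_iff_less_mult)
  thus "n div p < T" using Tp by (simp add: div_less_iff_less_mult mult.commute)
  show "prime p" "p \<le> n" using assms by (auto simp: large_primes_def primes_upto_def)
qed

lemma cofactors_props:
  assumes "i \<in> cofactors A p" "p \<in> large_primes"
  shows "0 < i" "i < T" "i \<le> n div p" "i * p \<in> A" "i < p"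
  using assms large_primes_props[OF assms(2)] by (auto simp: cofactors_def)

lemma finite_cofactors [simp]: "finite (cofactors A p)"
  by (simp add: cofactors_def)

lemma inj_cofactor_pairs: "inj_on (\<lambda>(u, v). u * v) (cofactor_pairs A)"
proof (rule inj_onI, clarify)
  fix i p j q assume "(i, p) \<in> cofactor_pairs A" "(j, q) \<in> cofactor_pairs A" and eq: "i * p = j * q"
  hence *: "p \<in> large_primes" "i \<in> cofactors A p" "q \<in> large_primes" "j \<in> cofactors A q" by (auto simp: cofactor_pairs_def)
  have "i < T" "j < T" "T < p" "T < q" using cofactors_props[OF *(2,1)] cofactors_props[OF *(4,3)] large_primes_props(2)[OF *(1)] large_primes_props(2)[OF *(3)] by auto
  thus "i = j \<and> p = q"
    using cofactors_props[OF *(2,1)] cofactors_props[OF *(4,3)] large_primes_props[OF *(1)] large_primes_props[OF *(3)] eq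
    by (intro lift_mult_unique) auto
qed

lemma cofactor_pairs_sub: "(\<lambda>(u, v). u * v) ` cofactor_pairs A \<subseteq> A"
  by (auto simp: cofactor_pairs_def cofactors_def)

lemma popular_witness:
  assumes "popular A a b"
  shows "\<exists>p\<in>large_primes. cofactors A p = {a, b}"
proof (rule ccontr)
  assume "\<not> ?thesis"
  hence e: "(pair_primes A a b) = {}" by auto
  have "k \<le> card (pair_primes A a b)" using assms by (simp add: popular_def)
  hence "k \<le> 0" unfolding e by simp
  thus False using k3 by simp
qed

text \<open>A relation among popular pairs, multiplied by k distinct primes, one from each pair,
  becomes a solution in \<open>A\<close>.\<close>

lemma popular_kfree:
  assumes A: "mult_k_Sidon k A"
  shows "kfree k (popular A)"
  unfolding kfree_def
proof
  have "0 < a \<and> 0 < b" if "popular A a b" for a b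
    using popular_witness[OF that] cofactors_props(1)[of a A] cofactors_props(1)[of b A] by blast
  moreover have "popular A b a" if "popular A a b" for a b
    using that by (simp add: popular_def insert_commute)
  ultimately show "graph_on_pos (popular A)"
    by (auto simp: graph_on_pos_def popular_def)
next
  show "\<not> balanced k (popular A)"
  proof
    assume "balanced k (popular A)"
    then obtain x y :: "nat \<Rightarrow> nat" where xy: "\<forall>i<k. popular A (x i) (y i)" "(\<Prod>i<k. x i) = (\<Prod>i<k. y i)"
      by (auto simp: balanced_def)
    have "finite (pair_primes A (x i) (y i)) \<and> k \<le> card (pair_primes A (x i) (y i))" if "i < k" for i
      using xy that by (auto simp: popular_def)
    then obtain v where v: "inj_on v {..<k}" "\<And>i. i < k \<Longrightarrow> v i \<in> (pair_primes A (x i) (y i))"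
      by (rule inj_choice[of k "\<lambda>i. (pair_primes A (x i) (y i))"]) auto
    have "\<not> mult_k_Sidon k A"
      by (rule not_Sidon_of_balanced[OF inj_cofactor_pairs cofactor_pairs_sub v(1), of x A y])
         (use v xy in \<open>auto simp: cofactor_pairs_def popular_def\<close>)
    thus False using A by simp
  qed
qed

text \<open>Either an atypical prime has at least three cofactors, which the triangle argument
  allows for at most k T^3 primes, or its cofactors form one of at most T^2 unpopular pairs, each
  occurring for fewer than k primes.\<close>

lemma card_atypical:
  assumes A: "mult_k_Sidon k A"
  shows "card (large_primes - typical A) \<le> k * T ^ 3 + k * T ^ 2"
proof -
  define X where "X = {p\<in>large_primes. 3 \<le> card (cofactors A p)}"
  define P where "P = {(a, b). a < T \<and> b < T \<and> a \<noteq> b \<and> \<not> popular A a b}"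
  define Y where "Y = (\<lambda>(a, b). (pair_primes A a b))"
  have "large_primes - typical A \<subseteq> X \<union> (\<Union>ab\<in>P. Y ab)"
  proof
    fix p assume p: "p \<in> large_primes - typical A"
    have sub: "cofactors A p \<subseteq> {1..n div p}" by (auto simp: cofactors_def)
    show "p \<in> X \<union> (\<Union>ab\<in>P. Y ab)"
    proof (cases "3 \<le> card (cofactors A p)")
      case False
      hence "card (cofactors A p) = 0 \<or> card (cofactors A p) = 1 \<or> card (cofactors A p) = 2" by linarith
      moreover have "card (cofactors A p) \<noteq> 0"
        using p sub by (auto simp: typical_def nbhds_def)
      moreover have "card (cofactors A p) \<noteq> 1"
        using p sub by (auto simp: typical_def nbhds_def card_1_singleton_iff)
      ultimately obtain a b where ab: "cofactors A p = {a, b}" "a \<noteq> b" by (auto simp: card_2_iff)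
      hence "\<not> popular A a b" using p sub by (auto simp: typical_def nbhds_def)
      moreover have "a < T" "b < T" using ab cofactors_props[of _ A p] p by auto
      ultimately show ?thesis using ab p by (auto simp: P_def Y_def)
    qed (use p in \<open>auto simp: X_def\<close>)
  qed
  moreover have finP: "finite P" by (rule finite_subset[of _ "{..<T} \<times> {..<T}"]) (auto simp: P_def)
  ultimately have "card (large_primes - typical A) \<le> card (X \<union> (\<Union>ab\<in>P. Y ab))"
    by (intro card_mono) (auto simp: X_def Y_def)
  also have "\<dots> \<le> card X + card (\<Union>ab\<in>P. Y ab)" by (rule card_Un_le)
  also have "card (\<Union>ab\<in>P. Y ab) \<le> (\<Sum>ab\<in>P. card (Y ab))" by (rule card_UN_le[OF finP])
  also have "\<dots> \<le> (\<Sum>ab\<in>P. k)" by (rule sum_mono) (auto simp: P_def Y_def popular_def not_le)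
  also have "\<dots> \<le> k * T ^ 2"
  proof -
    have "card P \<le> card ({..<T} \<times> {..<T})" by (rule card_mono) (auto simp: P_def)
    thus ?thesis by (simp add: power2_eq_square mult.commute)
  qed
  also have "card X \<le> k * T ^ 3"
  proof -
    have "card {v\<in>large_primes. 3 \<le> card {u. (u, v) \<in> cofactor_pairs A}} \<le> k * T ^ 3"
      by (rule few_rich_vertices[OF inj_cofactor_pairs cofactor_pairs_sub A k3, where B = "{..<T}" and V = large_primes])
         (use cofactors_props in \<open>auto simp: cofactor_pairs_def\<close>)
    moreover have "{u. (u, v) \<in> cofactor_pairs A} = cofactors A v" if "v \<in> large_primes" for v using that by (auto simp: cofactor_pairs_def)
    hence "{v\<in>large_primes. 3 \<le> card {u. (u, v) \<in> cofactor_pairs A}} = X" by (auto simp: X_def)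
    ultimately show ?thesis by simp
  qed
  finally show ?thesis by simp
qed

text \<open>Atypical primes get the empty set, so that \<open>core A\<close> lies in the product of
  the \<open>nbhds\<close> of the popular graph; the elements lost in this way go to
  \<open>rest A\<close>.\<close>

definition core :: "nat set \<Rightarrow> nat \<Rightarrow> nat set" where
  "core A = (\<lambda>p\<in>large_primes. if p \<in> typical A then cofactors A p else {})"

definition rest :: "nat set \<Rightarrow> nat set" where
  "rest A = A - lift_set large_primes (core A)"

lemma decompose:
  assumes "A \<subseteq> {1..n}"
  shows "A = rest A \<union> lift_set large_primes (core A)"
  by (auto simp: rest_def lift_set_def core_def cofactors_def typical_def split: if_splits)

text \<open>Apart from elements without large prime factors only multiples of atypical primes
  remain, at most T for each such prime.\<close>

lemma card_rest:
  assumes A: "mult_k_Sidon k A" "A \<subseteq> {1..n}" and r: "n < (r + 1) * (r + 1)"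
  shows "card (rest A) \<le> (\<Sum>j\<le>r. 2 * (n div (T * max 1 j)) + k * T ^ 4) + (k * T ^ 3 + k * T ^ 2) * T"
proof -
  define Z where "Z = {m\<in>A. \<forall>p\<in>primes_upto n. n div T < p \<longrightarrow> \<not> p dvd m}"
  have fA: "finite A" using A finite_subset by blast
  have "rest A \<subseteq> Z \<union> (\<Union>p\<in>large_primes - typical A. (\<lambda>i. i * p) ` cofactors A p)"
  proof
    fix m assume m: "m \<in> rest A"
    hence mA: "m \<in> A" by (simp add: rest_def)
    show "m \<in> Z \<union> (\<Union>p\<in>large_primes - typical A. (\<lambda>i. i * p) ` cofactors A p)"
    proof (cases "m \<in> Z")
      case False
      then obtain p where p: "p \<in> large_primes" "p dvd m" using mA by (auto simp: Z_def large_primes_def)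
      then obtain i where i: "m = i * p" by (metis dvd_def mult.commute)
      have "1 \<le> m" "m \<le> n" using mA A by auto
      hence "1 \<le> i" "i \<le> n div p" using i large_primes_props(2)[OF p(1)]
        by (auto simp: less_eq_div_iff_mult_less_eq Suc_le_eq)
      hence iN: "i \<in> cofactors A p" using mA i by (simp add: cofactors_def)
      moreover have "p \<notin> typical A"
      proof
        assume "p \<in> typical A"
        hence "i \<in> core A p" using iN p by (simp add: core_def)
        hence "m \<in> lift_set large_primes (core A)" using i p by (auto simp: lift_set_def)
        thus False using m by (simp add: rest_def)
      qed
      ultimately show ?thesis using p i by auto
    qed simp
  qed
  hence "card (rest A) \<le> card (Z \<union> (\<Union>p\<in>large_primes - typical A. (\<lambda>i. i * p) ` cofactors A p))"
    using fA by (intro card_mono) (auto simp: Z_def)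
  also have "\<dots> \<le> card Z + card (\<Union>p\<in>large_primes - typical A. (\<lambda>i. i * p) ` cofactors A p)" by (rule card_Un_le)
  also have "card Z \<le> (\<Sum>j\<le>r. 2 * (n div (T * max 1 j)) + k * T ^ 4)"
    unfolding Z_def by (rule card_smooth_part[OF A k3 T1 T3 r])
  also have "card (\<Union>p\<in>large_primes - typical A. (\<lambda>i. i * p) ` cofactors A p) \<le> (\<Sum>p\<in>large_primes - typical A. card ((\<lambda>i. i * p) ` cofactors A p))"
    by (rule card_UN_le) simp
  also have "\<dots> \<le> (\<Sum>p\<in>large_primes - typical A. T)"
  proof (rule sum_mono)
    fix p assume "p \<in> large_primes - typical A"
    hence "cofactors A p \<subseteq> {..<T}" using cofactors_props by auto
    hence "card (cofactors A p) \<le> card {..<T}" by (intro card_mono) auto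
    moreover have "card ((\<lambda>i. i * p) ` cofactors A p) \<le> card (cofactors A p)" by (rule card_image_le) simp
    ultimately show "card ((\<lambda>i. i * p) ` cofactors A p) \<le> T" by simp
  qed
  also have "\<dots> = card (large_primes - typical A) * T" by simp
  also have "\<dots> \<le> (k * T ^ 3 + k * T ^ 2) * T"
    by (intro mult_right_mono card_atypical A) simp
  finally show ?thesis by simp
qed

text \<open>Encode A by \<open>rest A\<close>, \<open>popular A\<close> and \<open>core A\<close>.
  The first and last determine A; the graph is recorded because the possible cores are counted graph
  by graph. It lives on vertices below T, which leaves at most 2^(T * T) graphs.\<close>

lemma upper_bound:
  assumes r: "n < (r + 1) * (r + 1)"
    and s: "(\<Sum>j\<le>r. 2 * (n div (T * max 1 j)) + k * T ^ 4) + (k * T ^ 3 + k * T ^ 2) * T \<le> s"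
    and M: "\<And>G. kfree k G \<Longrightarrow> (\<Prod>p\<in>large_primes. edges_upto G (n div p) + n div p + 1) \<le> M"
  shows "S k n \<le> (n + 1) ^ s * (2 ^ (T * T) * M)"
proof -
  define \<A> where "\<A> = {A. A \<subseteq> {1..n} \<and> mult_k_Sidon k A}"
  define \<G> where "\<G> = {G. kfree k G \<and> (\<forall>a b. G a b \<longrightarrow> a < T \<and> b < T)}"
  define F where "F = (\<lambda>G. PiE large_primes (\<lambda>p. nbhds G (n div p)))"
  define \<B> where "\<B> = {B. B \<subseteq> {1..n} \<and> card B \<le> s}"
  define \<phi> where "\<phi> = (\<lambda>A. (rest A, popular A, core A))"
  have inj\<G>: "inj_on (\<lambda>G. {(a, b). G a b}) \<G>" by (auto simp: inj_on_def fun_eq_iff)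
  have sub\<G>: "(\<lambda>G. {(a, b). G a b}) ` \<G> \<subseteq> Pow ({..<T} \<times> {..<T})" by (auto simp: \<G>_def)
  have fin\<G>: "finite \<G>"
    by (rule finite_imageD[OF finite_subset[OF sub\<G>] inj\<G>]) simp
  have card\<G>: "card \<G> \<le> 2 ^ (T * T)"
  proof -
    have "card \<G> = card ((\<lambda>G. {(a, b). G a b}) ` \<G>)" by (rule card_image[OF inj\<G>, symmetric])
    also have "\<dots> \<le> card (Pow ({..<T} \<times> {..<T}))" by (intro card_mono sub\<G>) simp
    finally show ?thesis by (simp add: card_Pow)
  qed
  have finF: "finite (F G)" for G unfolding F_def by (intro finite_PiE) auto
  have fin\<B>: "finite \<B>" by (rule finite_subset[of _ "Pow {1..n}"]) (auto simp: \<B>_def)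
  have "\<phi> ` \<A> \<subseteq> \<B> \<times> Sigma \<G> F"
  proof
    fix z assume "z \<in> \<phi> ` \<A>"
    then obtain A where A: "A \<subseteq> {1..n}" "mult_k_Sidon k A" "z = \<phi> A" by (auto simp: \<A>_def)
    have "card (rest A) \<le> s" using card_rest[OF A(2,1) r] s by linarith
    hence "rest A \<in> \<B>" using A by (auto simp: \<B>_def rest_def)
    moreover have "a < T \<and> b < T" if pop: "popular A a b" for a b
    proof -
      obtain p where "p \<in> large_primes" "cofactors A p = {a, b}" using popular_witness[OF pop] by blast
      thus ?thesis using cofactors_props(2)[of a A p] cofactors_props(2)[of b A p] by simp
    qed
    hence "popular A \<in> \<G>" using popular_kfree[OF A(2)] by (auto simp: \<G>_def)
    moreover have "core A \<in> F (popular A)"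
      unfolding F_def core_def by (rule restrict_PiE_iff[THEN iffD2]) (auto simp: typical_def nbhds_def)
    ultimately show "z \<in> \<B> \<times> Sigma \<G> F" by (simp add: A(3) \<phi>_def)
  qed
  moreover have "inj_on \<phi> \<A>"
  proof (rule inj_onI)
    fix A A' assume AA: "A \<in> \<A>" "A' \<in> \<A>" "\<phi> A = \<phi> A'"
    have "A = rest A \<union> lift_set large_primes (core A)" by (rule decompose) (use AA(1) in \<open>simp add: \<A>_def\<close>)
    moreover have "A' = rest A' \<union> lift_set large_primes (core A')" by (rule decompose) (use AA(2) in \<open>simp add: \<A>_def\<close>)
    moreover have "rest A = rest A'" "core A = core A'" using AA(3) by (auto simp: \<phi>_def)
    ultimately show "A = A'" by simp
  qed
  ultimately have "card \<A> \<le> card (\<B> \<times> Sigma \<G> F)"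
    using fin\<B> fin\<G> finF by (intro card_inj_on_le[of \<phi>]) auto
  also have "\<dots> = card \<B> * (\<Sum>G\<in>\<G>. card (F G))"
    using fin\<G> finF by (simp add: card_cartesian_product)
  also have "card \<B> \<le> (n + 1) ^ s"
    using card_subsets_le[of "{1..n}" s] by (simp add: \<B>_def)
  also have "(\<Sum>G\<in>\<G>. card (F G)) \<le> (\<Sum>G\<in>\<G>. M)"
  proof (rule sum_mono)
    fix G assume "G \<in> \<G>"
    hence G: "kfree k G" by (simp add: \<G>_def)
    have "card (F G) = (\<Prod>p\<in>large_primes. card (nbhds G (n div p)))" unfolding F_def by (rule card_PiE) simp
    also have "\<dots> = (\<Prod>p\<in>large_primes. edges_upto G (n div p) + n div p + 1)"
      using G by (intro prod.cong refl card_nbhds) (simp add: kfree_def)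
    also have "\<dots> \<le> M" by (rule M[OF G])
    finally show "card (F G) \<le> M" .
  qed
  also have "(\<Sum>G\<in>\<G>. M) \<le> 2 ^ (T * T) * M" using card\<G> by simp
  finally show ?thesis unfolding S_def \<A>_def by simp
qed

end

section \<open>Sums over primes\<close>

definition prime_count :: "nat \<Rightarrow> real" where
  "prime_count n = real (card (primes_upto n))"

abbreviation prime_layer :: "nat \<Rightarrow> nat \<Rightarrow> real" where
  "prime_layer n i \<equiv> prime_count (n div i) - prime_count (n div Suc i)"

lemma prime_count_mono: "m \<le> n \<Longrightarrow> prime_count m \<le> prime_count n"
  unfolding prime_count_def by (intro of_nat_mono card_mono) (auto simp: primes_upto_def)

lemma prime_count_nonneg [simp]: "prime_count n \<ge> 0"
  by (simp add: prime_count_def)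

lemma prime_count_asymptotics: "(\<lambda>n. prime_count n * ln (real n) / real n) \<longlonglongrightarrow> 1"
  using prime_number_theorem by (simp add: prime_count_def)

lemma prime_count_pos: "\<forall>\<^sub>F n in sequentially. prime_count n > 0"
proof -
  have "\<forall>\<^sub>F n in sequentially. prime_count n * ln (real n) / real n > 0"
    using order_tendstoD(1)[OF prime_count_asymptotics, of 0] by simp
  thus ?thesis
  proof eventually_elim
    case (elim n)
    hence "prime_count n \<noteq> 0" by auto
    thus ?case using prime_count_nonneg[of n] by linarith
  qed
qed

lemma prime_count_bounds:
  "\<forall>\<^sub>F n in sequentially. real n / (2 * ln n) \<le> prime_count n \<and> prime_count n \<le> 2 * real n / ln n"
proof -
  have "\<forall>\<^sub>F n in sequentially. prime_count n * ln (real n) / real n > 1 / 2"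
    "\<forall>\<^sub>F n in sequentially. prime_count n * ln (real n) / real n < 2"
    by (rule order_tendstoD[OF prime_count_asymptotics], simp)+
  with eventually_gt_at_top[of 1] show ?thesis
  proof eventually_elim
    case (elim n)
    have "ln (real n) > 0" using elim by simp
    thus ?case using elim by (simp add: field_simps)
  qed
qed

lemma real_div_nat_bounds:
  fixes n i :: nat
  assumes "i > 0"
  shows "real (n div i) \<le> real n / real i" "real n / real i - 1 \<le> real (n div i)"
proof -
  have "real (n div i * i) \<le> real n" by (intro of_nat_mono) simp
  thus "real (n div i) \<le> real n / real i" using assms by (simp add: field_simps)
  have "n < (n div i + 1) * i" using assms by (metis Suc_eq_plus1 dividend_less_div_times mult.commute mult_Suc add.commute)
  hence "real n < (real (n div i) + 1) * real i" by (metis of_nat_1 of_nat_add of_nat_less_iff of_nat_mult)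
  thus "real n / real i - 1 \<le> real (n div i)" using assms by (simp add: field_simps)
qed

text \<open>The quotient splits into factors with known limits: the prime number theorem at n div i
  and at n, (n div i) / n -> 1 / i, and ln n / ln (n div i) -> 1.\<close>

lemma prime_count_ratio:
  assumes i: "i > 0"
  shows "(\<lambda>n. prime_count (n div i) / prime_count n) \<longlonglongrightarrow> 1 / real i"
proof -
  have lim: "filterlim (\<lambda>n. n div i) at_top sequentially"
    using i by (rule filterlim_at_top_div_const_nat)
  have A: "(\<lambda>n. prime_count (n div i) * ln (real (n div i)) / real (n div i)) \<longlonglongrightarrow> 1"
    using filterlim_compose[OF prime_count_asymptotics lim] by simp
  have B: "(\<lambda>n. real (n div i) / real n) \<longlonglongrightarrow> 1 / real i"
  proof (rule tendsto_sandwich)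
    have "\<forall>n. (real n / real i - 1) / real n \<le> real (n div i) / real n"
      using real_div_nat_bounds(2)[OF i] by (intro allI divide_right_mono) auto
    thus "\<forall>\<^sub>F n in sequentially. (real n / real i - 1) / real n \<le> real (n div i) / real n" by simp
    have "\<forall>n. real (n div i) / real n \<le> (real n / real i) / real n"
      using real_div_nat_bounds(1)[OF i] by (intro allI divide_right_mono) auto
    thus "\<forall>\<^sub>F n in sequentially. real (n div i) / real n \<le> (real n / real i) / real n" by simp
    have "(\<lambda>n. (real n / real i - 1) / real n) \<longlonglongrightarrow> inverse (real i)" using i by real_asymp
    thus "(\<lambda>n. (real n / real i - 1) / real n) \<longlonglongrightarrow> 1 / real i" by (simp add: inverse_eq_divide)
    have "(\<lambda>n. (real n / real i) / real n) \<longlonglongrightarrow> inverse (real i)" using i by real_asymp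
    thus "(\<lambda>n. (real n / real i) / real n) \<longlonglongrightarrow> 1 / real i" by (simp only: inverse_eq_divide)
  qed
  have C: "(\<lambda>n. ln (real n) / ln (real (n div i))) \<longlonglongrightarrow> 1"
  proof -
    have "(\<lambda>n. 1 + ln (real (n div i) / real n) / ln (real n)) \<longlonglongrightarrow> 1 + 0"
    proof (intro tendsto_add tendsto_const)
      have "(\<lambda>n. ln (real (n div i) / real n)) \<longlonglongrightarrow> ln (1 / real i)" using i by (intro tendsto_ln B) auto
      moreover have "filterlim (\<lambda>n. ln (real n)) at_top sequentially" by real_asymp
      hence "filterlim (\<lambda>n. ln (real n)) at_infinity sequentially" by (rule filterlim_at_top_imp_at_infinity)
      ultimately show "(\<lambda>n. ln (real (n div i) / real n) / ln (real n)) \<longlonglongrightarrow> 0" by (rule tendsto_divide_0)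
    qed
    from tendsto_inverse[OF this]
    have "(\<lambda>n. inverse (1 + ln (real (n div i) / real n) / ln (real n))) \<longlonglongrightarrow> 1" by simp
    thus ?thesis
    proof (rule Lim_transform_eventually)
      have "\<forall>\<^sub>F n in sequentially. n \<ge> 2 * i + 2" by (rule eventually_ge_at_top)
      thus "\<forall>\<^sub>F n in sequentially. inverse (1 + ln (real (n div i) / real n) / ln (real n)) = ln (real n) / ln (real (n div i))"
      proof eventually_elim
        case (elim n)
        have "1 \<le> n div i" using elim i by (simp add: less_eq_div_iff_mult_less_eq)
        hence "ln (real (n div i) / real n) = ln (real (n div i)) - ln (real n)" using elim by (simp add: ln_div)
        moreover have "ln (real n) > 0" using elim by simp
        ultimately show ?case by (simp add: field_simps)
      qed
    qed
  qed
  have "(\<lambda>n. (prime_count (n div i) * ln (real (n div i)) / real (n div i)) * (real (n div i) / real n) *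
           (ln (real n) / ln (real (n div i))) / (prime_count n * ln (real n) / real n)) \<longlonglongrightarrow> 1 * (1 / real i) * 1 / 1"
    by (intro tendsto_intros A B C prime_count_asymptotics) auto
  moreover have "\<forall>\<^sub>F n in sequentially. (prime_count (n div i) * ln (real (n div i)) / real (n div i)) * (real (n div i) / real n) *
           (ln (real n) / ln (real (n div i))) / (prime_count n * ln (real n) / real n) = prime_count (n div i) / prime_count n"
    using eventually_ge_at_top[of "2 * i + 2"]
  proof eventually_elim
    case (elim n)
    have "2 \<le> n div i" using elim i by (simp add: less_eq_div_iff_mult_less_eq)
    hence "ln (real (n div i)) > 0" "real (n div i) > 0" by simp_all
    moreover have "ln (real n) > 0" "real n > 0" using elim by simp_all
    ultimately show ?case by (simp add: field_simps)
  qed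
  ultimately show ?thesis by (simp add: Lim_transform_eventually)
qed

text \<open>The limits for fixed i are not uniform in i. For i <= sqrt n one has n div i >= n^(1/3),
  so ln (n div i) >= (ln n) / 3; the constant is 12 = 2 * 3 * 2, with both factors 2 from
  \<open>prime_count_bounds\<close>.\<close>

lemma prime_count_quotient_bound:
  "\<forall>\<^sub>F n in sequentially. \<forall>i. 0 < i \<and> i * i \<le> n \<longrightarrow> prime_count (n div i) \<le> 12 * prime_count n / real i"
proof -
  obtain m0 where m0: "\<And>m. m \<ge> m0 \<Longrightarrow> real m / (2 * ln m) \<le> prime_count m \<and> prime_count m \<le> 2 * real m / ln m"
    using prime_count_bounds unfolding eventually_sequentially by auto
  have "\<forall>\<^sub>F n in sequentially. sqrt (real n) - 1 \<ge> real n powr (1 / 3)" by real_asymp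
  moreover have "\<forall>\<^sub>F n in sequentially. sqrt (real n) - 1 \<ge> real m0" by real_asymp
  ultimately show ?thesis using eventually_ge_at_top[of "max 2 m0"]
  proof eventually_elim
    case (elim n)
    show ?case
    proof (intro allI impI)
      fix i :: nat assume i: "0 < i \<and> i * i \<le> n"
      define m where "m = n div i"
      have "(real i)\<^sup>2 \<le> real n" using i by (metis of_nat_le_iff of_nat_mult power2_eq_square)
      hence "real i \<le> sqrt (real n)" by (rule real_le_rsqrt)
      hence "sqrt n * real i \<le> sqrt n * sqrt n" by (intro mult_left_mono) auto
      hence "sqrt n \<le> real n / real i" using i by (simp add: field_simps)
      hence m: "real m \<ge> sqrt n - 1" using real_div_nat_bounds(2)[of i n] i by (simp add: m_def)
      hence mm0: "m \<ge> m0" using elim by linarith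
      have n2: "real n \<ge> 2" using elim by simp
      have "real m \<ge> real n powr (1 / 3)" using m elim by linarith
      moreover have np: "real n powr (1 / 3) > 0" using n2 by simp
      ultimately have mp: "real m > 0" by linarith
      have "ln (real n powr (1 / 3)) \<le> ln (real m)"
        using \<open>real m \<ge> real n powr (1 / 3)\<close> np mp by (subst ln_le_cancel_iff) auto
      hence lm: "ln m \<ge> ln n / 3" "real m > 0" using n2 mp by (auto simp: ln_powr)
      have ln: "ln n > 0" using n2 by simp
      have "prime_count m \<le> 2 * real m / ln m" using m0[OF mm0] by simp
      also have "\<dots> \<le> 2 * real m / (ln n / 3)"
      proof -
        have "ln m > 0" using lm ln by linarith
        thus ?thesis using lm ln by (intro divide_left_mono) (auto intro: mult_pos_pos)
      qed
      also have "\<dots> \<le> 2 * (real n / real i) / (ln n / 3)"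
        using real_div_nat_bounds(1)[of i n] i ln by (intro divide_right_mono mult_left_mono) (auto simp: m_def)
      also have "\<dots> = 12 * (real n / (2 * ln n)) / real i" using ln i by (simp add: field_simps)
      also have "\<dots> \<le> 12 * prime_count n / real i"
        using m0[of n] elim by (intro divide_right_mono mult_left_mono) auto
      finally show "prime_count (n div i) \<le> 12 * prime_count n / real i" by (simp add: m_def)
    qed
  qed
qed

lemma sum_over_primes_by_quotient:
  fixes c :: "nat \<Rightarrow> real"
  assumes K: "K > 0"
  shows "(\<Sum>p\<in>{p\<in>primes_upto n. n div K < p}. c (n div p)) = (\<Sum>i=1..<K. c i * prime_layer n i)"
proof -
  define Q where "Q = {p\<in>primes_upto n. n div K < p}"
  have le_swap: "i \<le> n div p \<longleftrightarrow> p \<le> n div i" if "i > 0" "p > 0" for i p :: nat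
    using that by (simp add: less_eq_div_iff_mult_less_eq mult.commute)
  have Q: "p > 0" "p \<le> n" "n div p \<in> {1..<K}" if "p \<in> Q" for p
  proof -
    show p: "p > 0" "p \<le> n" using that by (auto simp: Q_def primes_upto_def prime_gt_0_nat)
    have "n < K * p" using that K by (simp add: Q_def div_less_iff_less_mult mult.commute)
    hence "n div p < K" using p by (simp add: div_less_iff_less_mult)
    moreover have "1 \<le> n div p" using p by (simp add: less_eq_div_iff_mult_less_eq)
    ultimately show "n div p \<in> {1..<K}" by simp
  qed
  have "(\<Sum>p\<in>Q. c (n div p)) = (\<Sum>i=1..<K. \<Sum>p | p \<in> Q \<and> n div p = i. c (n div p))"
    by (rule sum.group[symmetric]) (use Q in \<open>auto simp: Q_def\<close>)
  also have "\<dots> = (\<Sum>i=1..<K. c i * prime_layer n i)"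
  proof (rule sum.cong[OF refl])
    fix i assume i: "i \<in> {1..<K}"
    have "{p. p \<in> Q \<and> n div p = i} = primes_upto (n div i) - primes_upto (n div Suc i)"
    proof (intro equalityI subsetI)
      fix p assume "p \<in> {p. p \<in> Q \<and> n div p = i}"
      hence p: "p \<in> Q" "n div p = i" by auto
      have "p \<le> n div i" using le_swap[of i p] p i Q(1)[OF p(1)] by auto
      moreover have "\<not> p \<le> n div Suc i" using le_swap[of "Suc i" p] p i Q(1)[OF p(1)] by auto
      ultimately show "p \<in> primes_upto (n div i) - primes_upto (n div Suc i)"
        using p by (auto simp: Q_def primes_upto_def)
    next
      fix p assume "p \<in> primes_upto (n div i) - primes_upto (n div Suc i)"
      hence p: "prime p" "p \<le> n div i" "\<not> p \<le> n div Suc i" by (auto simp: primes_upto_def)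
      hence p0: "p > 0" using prime_gt_0_nat by blast
      have "i \<le> n div p" using le_swap[of i p] p i p0 by auto
      moreover have "\<not> Suc i \<le> n div p" using le_swap[of "Suc i" p] p i p0 by auto
      ultimately have eq: "n div p = i" by linarith
      moreover have "p \<le> n" using p(2) div_le_dividend order_trans by blast
      moreover have "\<not> p \<le> n div K" using le_swap[of K p] K p0 eq i by auto
      ultimately show "p \<in> {p. p \<in> Q \<and> n div p = i}" using p by (auto simp: Q_def primes_upto_def)
    qed
    moreover have "primes_upto (n div Suc i) \<subseteq> primes_upto (n div i)"
      using div_le_mono2[of i "Suc i" n] i by (auto simp: primes_upto_def)
    ultimately have "real (card {p. p \<in> Q \<and> n div p = i}) = prime_layer n i"
      unfolding prime_count_def by (simp add: card_Diff_subset of_nat_diff card_mono)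
    thus "(\<Sum>p | p \<in> Q \<and> n div p = i. c (n div p)) = c i * prime_layer n i"
      by (simp add: mult.commute)
  qed
  finally show ?thesis by (simp add: Q_def)
qed

text \<open>Abel summation. The weight h t = 2 ln (t + 1) has increments at most 2 / t, and
  prime_count (n div t) <= 12 P / t; the resulting sum of 1 / t^2 is compared with 1 / (t (t - 1)),
  which telescopes.\<close>

lemma tail_bound:
  assumes K: "K \<ge> 1" and B: "\<And>i. K \<le> i \<Longrightarrow> i \<le> T \<Longrightarrow> prime_count (n div i) \<le> 12 * prime_count n / real i"
  shows "T > K \<Longrightarrow> (\<Sum>i=K..<T. 2 * ln (real i + 1) * prime_layer n i)
    \<le> 12 * prime_count n * (2 * ln (real K + 1) / K + 2 / K)"
proof -
  define P where "P = prime_count n"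
  have P: "P \<ge> 0" by (simp add: P_def)
  define h where "h = (\<lambda>i::nat. 2 * ln (real i + 1))"
  assume "T > K"
  \<comment> \<open>The subtracted boundary term carries the Abel summation through the induction
    and is dropped at the end.\<close>
  have "Suc K \<le> t \<Longrightarrow> t \<le> T \<Longrightarrow> (\<Sum>i=K..<t. h i * prime_layer n i)
       \<le> 12 * P * (h K / K + 2 / K - 2 / (real t - 1)) - h (t - 1) * prime_count (n div t)" for t
  proof (induction t rule: dec_induct)
    case base
    have "h K * prime_count (n div K) \<le> h K * (12 * P / K)"
      using B[of K] base by (intro mult_left_mono) (auto simp: h_def P_def)
    thus ?case by (simp add: algebra_simps)
  next
    case (step t)
    have t: "real t > 1" "t \<ge> 1" "t \<le> T" "real t > 0" using step K by auto
    have "h t - h (t - 1) = 2 * ln ((real t + 1) / real t)" using t by (simp add: h_def ln_div of_nat_diff algebra_simps)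
    also have "\<dots> = 2 * ln (1 + 1 / real t)" using t by (simp add: field_simps)
    also have "\<dots> \<le> 2 * (1 / real t)" using t by (intro mult_left_mono ln_add_one_self_le_self) auto
    finally have "(h t - h (t - 1)) * prime_count (n div t) \<le> (2 * (1 / real t)) * (12 * P / real t)"
      using B[of t] step t P by (intro mult_mono) (auto simp: P_def)
    also have "\<dots> = 24 * P * (1 / (real t * real t))" by simp
    also have "\<dots> \<le> 24 * P * (1 / (real t * (real t - 1)))"
      using t P by (intro mult_left_mono divide_left_mono) auto
    also have "1 / (real t * (real t - 1)) = 1 / (real t - 1) - 1 / real t" using t by (simp add: field_simps)
    finally have *: "(h t - h (t - 1)) * prime_count (n div t) \<le> 24 * P * (1 / (real t - 1) - 1 / real t)" .
    have "(\<Sum>i=K..<Suc t. h i * prime_layer n i) =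
       (\<Sum>i=K..<t. h i * prime_layer n i) + h t * prime_layer n t"
      using step by simp
    also have "\<dots> \<le> 12 * P * (h K / K + 2 / K - 2 / (real t - 1)) - h (t - 1) * prime_count (n div t)
        + h t * prime_layer n t" using step t by simp
    also have "\<dots> = 12 * P * (h K / K + 2 / K - 2 / (real t - 1)) + (h t - h (t - 1)) * prime_count (n div t) - h t * prime_count (n div Suc t)"
      by (simp add: algebra_simps)
    also have "\<dots> \<le> 12 * P * (h K / K + 2 / K - 2 / (real t - 1)) + 24 * P * (1 / (real t - 1) - 1 / real t) - h t * prime_count (n div Suc t)"
      using * by simp
    also have "\<dots> = 12 * P * (h K / K + 2 / K - 2 / (real (Suc t) - 1)) - h (Suc t - 1) * prime_count (n div Suc t)"
      by (simp add: algebra_simps)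
    finally show ?case .
  qed
  from this[of T] \<open>T > K\<close>
  have "(\<Sum>i=K..<T. h i * prime_layer n i)
       \<le> 12 * P * (h K / K + 2 / K - 2 / (real T - 1)) - h (T - 1) * prime_count (n div T)" by simp
  also have "\<dots> \<le> 12 * P * (h K / K + 2 / K)"
  proof -
    have "12 * P * (h K / K + 2 / K - 2 / (real T - 1)) \<le> 12 * P * (h K / K + 2 / K)"
      using P \<open>T > K\<close> K by (intro mult_left_mono) auto
    moreover have "h (T - 1) * prime_count (n div T) \<ge> 0" by (simp add: h_def)
    ultimately show ?thesis by linarith
  qed
  finally show ?thesis by (simp add: h_def P_def)
qed

section \<open>The logarithm of the infinite product attached to a graph\<close>

abbreviation ln_nbhds :: "(nat \<Rightarrow> nat \<Rightarrow> bool) \<Rightarrow> nat \<Rightarrow> real" where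
  "ln_nbhds E i \<equiv> ln (real (edges_upto E i) + real i + 1)"

text \<open>Logarithm of one factor of the product in \<open>beta\<close>, with the index shifted so
  that i = 0 stands for k = 1.\<close>

definition graph_term :: "(nat \<Rightarrow> nat \<Rightarrow> bool) \<Rightarrow> nat \<Rightarrow> real" where
  "graph_term E i = ln (real (edges_upto E (Suc i)) + real (Suc i) + 1) / (real (Suc i) ^ 2 + real (Suc i))"

definition graph_value :: "(nat \<Rightarrow> nat \<Rightarrow> bool) \<Rightarrow> real" where
  "graph_value E = (\<Sum>i. graph_term E i)"

lemma ln_edges_bounds:
  "0 \<le> ln_nbhds E i" "ln_nbhds E i \<le> 2 * ln (real i + 1)"
proof -
  show "0 \<le> ln_nbhds E i" by simp
  have "real (edges_upto E i + i + 1) \<le> real ((i + 1)\<^sup>2)" using edges_upto_le of_nat_le_iff by blast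
  hence "real (edges_upto E i) + real i + 1 \<le> (real i + 1)\<^sup>2"
    by (simp only: of_nat_add of_nat_1 of_nat_power)
  hence "ln_nbhds E i \<le> ln ((real i + 1)\<^sup>2)" by (intro ln_mono) auto
  thus "ln_nbhds E i \<le> 2 * ln (real i + 1)" by (simp add: ln_realpow)
qed

definition graph_term_bound :: "nat \<Rightarrow> real" where
  "graph_term_bound i = 2 * ln (real (Suc i) + 1) / (real (Suc i) ^ 2 + real (Suc i))"

lemma graph_term_bounds: "0 \<le> graph_term E i" "graph_term E i \<le> graph_term_bound i"
  unfolding graph_term_def graph_term_bound_def using ln_edges_bounds[of E "Suc i"]
  by (auto intro!: divide_nonneg_nonneg divide_right_mono simp del: of_nat_Suc)

lemma summable_graph_term_bound: "summable graph_term_bound"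
proof (rule summable_comparison_test_bigo)
  show "graph_term_bound \<in> O(\<lambda>i. real i powr (-3/2))"
    unfolding graph_term_bound_def by real_asymp
  show "summable (\<lambda>i. norm (real i powr (-3/2)))" by (simp add: summable_real_powr_iff)
qed

lemma summable_graph_term: "summable (graph_term E)"
  by (rule summable_comparison_test'[OF summable_graph_term_bound, of 0])
     (use graph_term_bounds in auto)

lemma graph_value_le: "graph_value E \<le> suminf graph_term_bound"
  unfolding graph_value_def by (intro suminf_le graph_term_bounds summable_graph_term summable_graph_term_bound)

text \<open>Partial fractions: 1 / (i^2 + i) = 1 / i - 1 / (i + 1), the limiting share of the primes
  with n div p = i.\<close>

lemma sum_graph_term_eq:
  "(\<Sum>i=1..<K. ln_nbhds E i * (1 / real i - 1 / real (Suc i))) = (\<Sum>i<K-1. graph_term E i)"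
proof -
  have "(\<Sum>i=1..<K. ln_nbhds E i * (1 / real i - 1 / real (Suc i))) =
     (\<Sum>i<K-1. ln (real (edges_upto E (Suc i)) + real (Suc i) + 1) * (1 / real (Suc i) - 1 / real (Suc (Suc i))))"
    by (rule sum.reindex_bij_witness[of _ Suc "\<lambda>i. i - 1"]) auto
  also have "\<dots> = (\<Sum>i<K-1. graph_term E i)"
    by (intro sum.cong refl) (simp add: graph_term_def field_simps power2_eq_square)
  finally show ?thesis .
qed

lemma prime_count_layer:
  assumes "i > 0"
  shows "(\<lambda>n. prime_layer n i / prime_count n) \<longlonglongrightarrow> 1 / real i - 1 / real (Suc i)"
  unfolding diff_divide_distrib using assms by (intro tendsto_diff prime_count_ratio) auto

lemma main_sum_limit:
  "(\<lambda>n. (\<Sum>i=1..<K. c i * prime_layer n i) / prime_count n)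
     \<longlonglongrightarrow> (\<Sum>i=1..<K. c i * (1 / real i - 1 / real (Suc i)))"
  unfolding sum_divide_distrib times_divide_eq_right[symmetric]
  by (intro tendsto_sum tendsto_mult tendsto_const prime_count_layer) auto

section \<open>The growth rate\<close>

text \<open>The parameter T. For T = n^c both n / T and sqrt n * T^4 must fall below n by a power,
  that is 0 < c < 1/8.\<close>

definition root16 :: "nat \<Rightarrow> nat" where
  "root16 n = nat \<lfloor>real n powr (1 / 16)\<rfloor>"

lemma root16_le: "real (root16 n) \<le> real n powr (1 / 16)"
  by (simp add: root16_def)

lemma root16_power_le:
  assumes "n > 0"
  shows "real (root16 n) ^ m \<le> real n powr (real m / 16)"
proof -
  have "real (root16 n) ^ m \<le> (real n powr (1 / 16)) ^ m" by (intro power_mono root16_le) simp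
  also have "\<dots> = real n powr (real m / 16)" using assms by (simp add: powr_power)
  finally show ?thesis .
qed

lemma root16_ge: "\<forall>\<^sub>F n in sequentially. real (root16 n) \<ge> real n powr (1 / 16) / 2"
proof -
  have "\<forall>\<^sub>F n in sequentially. real n powr (1 / 16) - 1 \<ge> real n powr (1 / 16) / 2" by real_asymp
  thus ?thesis
  proof eventually_elim
    case (elim n)
    have "real (root16 n) \<ge> real n powr (1 / 16) - 1" unfolding root16_def by linarith
    thus ?case using elim by linarith
  qed
qed

lemma root16_gt: "\<forall>\<^sub>F n in sequentially. root16 n > K"
proof -
  have "\<forall>\<^sub>F n in sequentially. real n powr (1 / 16) / 2 > real K" by real_asymp
  with root16_ge show ?thesis by eventually_elim linarith
qed

lemma root16_powers:
  assumes "n > 0"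
  shows "root16 n ^ 3 \<le> n" "root16 n * root16 n \<le> n"
proof -
  have n1: "real n \<ge> 1" using assms by simp
  have "real (root16 n ^ 3) \<le> real n powr (3 / 16)" using root16_power_le[OF assms, of 3] by simp
  also have "\<dots> \<le> real n powr 1" using n1 by (intro powr_mono) auto
  finally show "root16 n ^ 3 \<le> n" using n1 by (simp only: powr_one of_nat_le_iff)
  have "real (root16 n ^ 2) \<le> real n powr (2 / 16)" using root16_power_le[OF assms, of 2] by simp
  also have "\<dots> \<le> real n powr 1" using n1 by (intro powr_mono) auto
  finally have "root16 n ^ 2 \<le> n" using n1 by (simp only: powr_one of_nat_le_iff)
  thus "root16 n * root16 n \<le> n" by (simp add: power2_eq_square)
qed

text \<open>The graph is quantified after n because the graphs that occur change with n. Finitely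
  many layers i < K are treated by their limits; those from K on are bounded through ln ((i + 1)^2),
  whatever the graph.\<close>

lemma uniform_upper:
  assumes e: "e > 0"
  shows "\<forall>\<^sub>F n in sequentially. \<forall>G. (\<Sum>p\<in>{p\<in>primes_upto n. n div root16 n < p}.
           ln_nbhds G (n div p)) \<le> prime_count n * (graph_value G + e)"
proof -
  have "(\<lambda>K. 12 * (2 * ln (real K + 1) / K + 2 / K)) \<longlonglongrightarrow> 0" by real_asymp
  hence "\<forall>\<^sub>F K in sequentially. 12 * (2 * ln (real K + 1) / K + 2 / K) < e / 2"
    using e by (intro order_tendstoD) auto
  with eventually_ge_at_top[of 1] have "\<forall>\<^sub>F K in sequentially. K \<ge> 1 \<and> 12 * (2 * ln (real K + 1) / K + 2 / K) < e / 2"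
    by eventually_elim auto
  then obtain K where K: "K \<ge> 1" "12 * (2 * ln (real K + 1) / K + 2 / K) < e / 2"
    unfolding eventually_sequentially by auto
  \<comment> \<open>Bounds the sum of the weights of the layers below K for every graph, so an error
    \<open>\<delta>\<close> = e / (2 B) in each layer costs e / 2 in total. The 1 makes B
    positive.\<close>
  define B where "B = real K * (2 * ln (real K + 1)) + 1"
  have B: "B > 0" using K by (simp add: B_def add_nonneg_pos)
  define \<delta> where "\<delta> = e / (2 * B)"
  have \<delta>: "\<delta> > 0" using e B by (simp add: \<delta>_def)
  have "\<forall>\<^sub>F n in sequentially. \<forall>i\<in>{1..<K}. prime_layer n i / prime_count n < (1 / real i - 1 / real (Suc i)) + \<delta>"
    by (intro eventually_ball_finite ballI order_tendstoD(2)[OF prime_count_layer]) (use \<delta> in auto)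
  with prime_count_pos root16_gt[of K] prime_count_quotient_bound eventually_gt_at_top[of 0] show ?thesis
  proof eventually_elim
    case (elim n)
    define T where "T = root16 n"
    define D where "D = prime_layer n"
    have D0: "D i \<ge> 0" if "i \<ge> 1" for i
      using that div_le_mono2[of i "Suc i" n] by (simp add: D_def prime_count_mono)
    show ?case
    proof
      fix G
      define c where "c = (\<lambda>i. ln_nbhds G i)"
      have c: "0 \<le> c i" "c i \<le> 2 * ln (real i + 1)" for i using ln_edges_bounds[of G i] by (auto simp: c_def)
      have "(\<Sum>p\<in>{p\<in>primes_upto n. n div T < p}. c (n div p)) = (\<Sum>i=1..<T. c i * D i)"
        unfolding D_def by (rule sum_over_primes_by_quotient) (use elim in \<open>simp add: T_def\<close>)
      also have "\<dots> = (\<Sum>i=1..<K. c i * D i) + (\<Sum>i=K..<T. c i * D i)"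
        by (rule sum.atLeastLessThan_concat[symmetric]) (use K elim in \<open>auto simp: T_def\<close>)
      also have "(\<Sum>i=K..<T. c i * D i) \<le> (\<Sum>i=K..<T. 2 * ln (real i + 1) * D i)"
        using K by (intro sum_mono mult_right_mono c D0) auto
      also have "\<dots> \<le> 12 * prime_count n * (2 * ln (real K + 1) / K + 2 / K)"
        unfolding D_def
      proof (rule tail_bound[OF K(1)])
        fix i assume i: "K \<le> i" "i \<le> T"
        have "i * i \<le> T * T" using i by (intro mult_le_mono)
        also have "\<dots> \<le> n" unfolding T_def using elim by (intro root16_powers) auto
        finally show "prime_count (n div i) \<le> 12 * prime_count n / real i" using elim i K by simp
      qed (use elim in \<open>simp add: T_def\<close>)
      also have "\<dots> = prime_count n * (12 * (2 * ln (real K + 1) / K + 2 / K))" by simp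
      also have "\<dots> \<le> prime_count n * (e / 2)" using K(2) elim by (intro mult_left_mono) auto
      also have "(\<Sum>i=1..<K. c i * D i) \<le> (\<Sum>i=1..<K. prime_count n * (c i * (1 / real i - 1 / real (Suc i)) + 2 * ln (real K + 1) * \<delta>))"
      proof (rule sum_mono)
        fix i assume i: "i \<in> {1..<K}"
        have "D i / prime_count n \<le> (1 / real i - 1 / real (Suc i)) + \<delta>" using elim i by (auto simp: D_def less_imp_le)
        hence "D i \<le> prime_count n * ((1 / real i - 1 / real (Suc i)) + \<delta>)"
          using elim by (simp add: field_simps)
        hence "c i * D i \<le> c i * (prime_count n * ((1 / real i - 1 / real (Suc i)) + \<delta>))"
          by (intro mult_left_mono c)
        also have "\<dots> = prime_count n * (c i * (1 / real i - 1 / real (Suc i)) + c i * \<delta>)" by (simp add: algebra_simps)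
        also have "c i * \<delta> \<le> 2 * ln (real K + 1) * \<delta>"
        proof (intro mult_right_mono)
          have "ln (real i + 1) \<le> ln (real K + 1)" using i by (intro ln_mono) auto
          thus "c i \<le> 2 * ln (real K + 1)" using c(2)[of i] by linarith
        qed (use \<delta> in simp)
        finally show "c i * D i \<le> prime_count n * (c i * (1 / real i - 1 / real (Suc i)) + 2 * ln (real K + 1) * \<delta>)"
          using elim by (simp add: mult_left_mono)
      qed
      also have "\<dots> = prime_count n * ((\<Sum>i=1..<K. c i * (1 / real i - 1 / real (Suc i))) + real (K - 1) * (2 * ln (real K + 1) * \<delta>))"
        by (simp add: sum_distrib_left[symmetric] sum.distrib)
      also have "(\<Sum>i=1..<K. c i * (1 / real i - 1 / real (Suc i))) = (\<Sum>i<K-1. graph_term G i)"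
        unfolding c_def by (rule sum_graph_term_eq)
      also have "\<dots> \<le> graph_value G"
        unfolding graph_value_def by (intro sum_le_suminf summable_graph_term graph_term_bounds) auto
      also have "real (K - 1) * (2 * ln (real K + 1) * \<delta>) \<le> B * \<delta>"
      proof -
        have "real (K - 1) * (2 * ln (real K + 1)) \<le> real K * (2 * ln (real K + 1))" by (intro mult_right_mono) auto
        hence "real (K - 1) * (2 * ln (real K + 1)) \<le> B" by (simp add: B_def)
        from mult_right_mono[OF this, of \<delta>] \<delta> show ?thesis by (simp add: mult.assoc)
      qed
      also have "B * \<delta> = e / 2" using B by (simp add: \<delta>_def)
      finally show "(\<Sum>p\<in>{p\<in>primes_upto n. n div root16 n < p}. ln_nbhds G (n div p))
          \<le> prime_count n * (graph_value G + e)"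
        using elim by (simp add: c_def T_def algebra_simps mult_left_mono)
    qed
  qed
qed

text \<open>The terms j = 0 and j = 1 are both 1; afterwards 1 / (j + 1) <= ln (j + 1) - ln
  j.\<close>

lemma sum_inverse_le: "(\<Sum>j\<le>r. 1 / real (max 1 j)) \<le> 2 + ln (real r + 1)"
proof (cases "r = 0")
  case False
  have "(\<Sum>j\<le>r. 1 / real (max 1 j)) \<le> 2 + ln (real r)" if "r > 0" for r
    using that
  proof (induction r rule: nat_induct_non_zero)
    case (Suc r)
    have "ln (real r / (real r + 1)) \<le> real r / (real r + 1) - 1" using Suc.hyps by (intro ln_le_minus_one) simp
    also have "real r / (real r + 1) - 1 = - (1 / (real r + 1))" by (simp add: field_simps)
    finally have "1 / (real r + 1) \<le> ln (real r + 1) - ln (real r)" using Suc.hyps by (simp add: ln_div)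
    thus ?case using Suc.IH by (simp add: add.commute)
  qed simp
  from this[of r] False have "(\<Sum>j\<le>r. 1 / real (max 1 j)) \<le> 2 + ln (real r)" by simp
  also have "ln (real r) \<le> ln (real r + 1)" using False by simp
  finally show ?thesis by simp
qed simp

definition smooth_bound :: "nat \<Rightarrow> nat \<Rightarrow> nat" where
  "smooth_bound k n = (\<Sum>j\<le>nat \<lfloor>sqrt n\<rfloor>. 2 * (n div (root16 n * max 1 j)) + k * root16 n ^ 4)
     + (k * root16 n ^ 3 + k * root16 n ^ 2) * root16 n"

text \<open>A leftover element costs ln (n + 1), the graphs T^2 ln 2. The orders are n^(15/16) ln n
  from the blocks, n^(3/4) from rich vertices and n^(1/8) from graphs, all o(n / (ln n)^2).\<close>

lemma smooth_bound_negligible: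
  assumes e: "e > 0" and k: "k \<ge> (3::nat)"
  shows "\<forall>\<^sub>F n in sequentially. real (smooth_bound k n) * ln (real n + 1) + (real (root16 n))\<^sup>2 * ln 2 \<le> e * prime_count n"
proof -
  \<comment> \<open>The 4 is 2 * 2 because T >= n^(1/16) / 2; the 3 counts one extra block and the
    two terms for atypical primes, each at most k T^4.\<close>
  define E where "E = (\<lambda>n::nat. 4 * real n powr (15 / 16) * (2 + ln (real n + 1)) + (sqrt n + 3) * real k * real n powr (1 / 4))"
  have kpos: "real k > 0" using k by simp
  have "(\<lambda>n. (E n * ln (real n + 1) + real n powr (1 / 8) * ln 2) / (real n / (2 * ln n))) \<longlonglongrightarrow> 0"
    unfolding E_def using kpos by real_asymp
  hence "\<forall>\<^sub>F n in sequentially. (E n * ln (real n + 1) + real n powr (1 / 8) * ln 2) / (real n / (2 * ln n)) < e"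
    using e by (intro order_tendstoD) auto
  with root16_ge prime_count_bounds eventually_gt_at_top[of 1] show ?thesis
  proof eventually_elim
    case (elim n)
    define T where "T = root16 n"
    define r where "r = nat \<lfloor>sqrt n\<rfloor>"
    have n1: "real n > 1" using elim by simp
    have "real n powr (1 / 16) > 0" using n1 by simp
    hence T: "real T \<ge> real n powr (1 / 16) / 2" "real T > 0" using elim unfolding T_def by linarith+
    have r: "real r \<le> sqrt n" by (simp add: r_def)
    have "sqrt n \<le> real n" using n1 by (simp add: real_le_lsqrt self_le_power sqrt_le_D real_sqrt_le_iff power2_eq_square)
    hence rn: "real r \<le> real n" using r by linarith
    have T4: "real T ^ 4 \<le> real n powr (1 / 4)" using root16_power_le[of n 4] n1 by (simp add: T_def)
    have "real (smooth_bound k n) = (\<Sum>j\<le>r. 2 * real (n div (T * max 1 j)) + real k * real T ^ 4) + (real k * real T ^ 3 + real k * real T ^ 2) * real T"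
      by (simp add: smooth_bound_def T_def r_def)
    also have "\<dots> = 2 * (\<Sum>j\<le>r. real (n div (T * max 1 j))) + (real r + 1) * (real k * real T ^ 4) + (real k * real T ^ 3 + real k * real T ^ 2) * real T"
      by (simp add: sum.distrib sum_distrib_left add.commute)
    also have "(\<Sum>j\<le>r. real (n div (T * max 1 j))) \<le> (\<Sum>j\<le>r. (real n / real T) * (1 / real (max 1 j)))"
    proof (rule sum_mono)
      fix j
      have "T * max 1 j > 0" using T by simp
      from real_div_nat_bounds(1)[OF this, of n]
      show "real (n div (T * max 1 j)) \<le> (real n / real T) * (1 / real (max 1 j))" by simp
    qed
    also have "\<dots> = (real n / real T) * (\<Sum>j\<le>r. 1 / real (max 1 j))" by (simp add: sum_distrib_left)
    also have "\<dots> \<le> (real n / (real n powr (1 / 16) / 2)) * (2 + ln (real n + 1))"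
    proof (intro mult_mono)
      show "real n / real T \<le> real n / (real n powr (1 / 16) / 2)"
        using T n1 by (intro divide_left_mono) auto
      have "ln (real r + 1) \<le> ln (real n + 1)" using rn by (intro ln_mono) auto
      thus "(\<Sum>j\<le>r. 1 / real (max 1 j)) \<le> 2 + ln (real n + 1)" using sum_inverse_le[of r] by linarith
    qed (auto intro: sum_nonneg)
    also have "(real n / (real n powr (1 / 16) / 2)) = 2 * real n powr (15 / 16)"
    proof -
      have "real n = real n powr (15 / 16) * real n powr (1 / 16)" using n1 by (simp add: powr_add[symmetric])
      thus ?thesis using n1 by (simp add: field_simps)
    qed
    also have "(real k * real T ^ 3 + real k * real T ^ 2) * real T \<le> 2 * (real k * real T ^ 4)"
    proof -
      have "T \<ge> 1" using T by simp
      hence "real T ^ 3 \<le> real T ^ 4" by (intro power_increasing) auto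
      hence "real k * real T ^ 3 \<le> real k * real T ^ 4" by (intro mult_left_mono) auto
      thus ?thesis by (simp add: algebra_simps power_numeral_reduce)
    qed
    finally have "real (smooth_bound k n) \<le> 4 * real n powr (15 / 16) * (2 + ln (real n + 1)) + (real r + 3) * (real k * real T ^ 4)"
      by (simp add: algebra_simps)
    also have "(real r + 3) * (real k * real T ^ 4) \<le> (sqrt n + 3) * (real k * real n powr (1 / 4))"
      using r T4 by (intro mult_mono mult_left_mono) auto
    finally have "real (smooth_bound k n) \<le> E n" by (simp add: E_def mult.assoc)
    hence "real (smooth_bound k n) * ln (real n + 1) \<le> E n * ln (real n + 1)" by (intro mult_right_mono) auto
    moreover have "(real T)\<^sup>2 * ln 2 \<le> real n powr (1 / 8) * ln 2"
      using root16_power_le[of n 2] n1 by (intro mult_right_mono) (auto simp: T_def)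
    ultimately have "real (smooth_bound k n) * ln (real n + 1) + (real T)\<^sup>2 * ln 2 \<le> E n * ln (real n + 1) + real n powr (1 / 8) * ln 2"
      by linarith
    also have "\<dots> \<le> e * (real n / (2 * ln n))"
    proof -
      have pos: "real n / (2 * ln n) > 0" using n1 by simp
      show ?thesis by (rule less_imp_le, subst pos_divide_less_eq[OF pos, symmetric]) (use elim in blast)
    qed
    also have "\<dots> \<le> e * prime_count n" using elim e by (intro mult_left_mono) auto
    finally show ?case by (simp add: T_def)
  qed
qed

lemma S_ge_1: "S k n \<ge> 1" if "k > 0"
proof -
  have "{} \<in> {A. A \<subseteq> {1..n} \<and> mult_k_Sidon k A}" using that by (auto simp: mult_k_Sidon_def)
  hence "card {A. A \<subseteq> {1..n} \<and> mult_k_Sidon k A} > 0"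
    unfolding card_gt_0_iff using finite_S_sets by blast
  thus ?thesis unfolding S_def by linarith
qed

lemma ln_S_upper:
  assumes k: "k \<ge> 3" and \<Lambda>: "\<And>G. kfree k G \<Longrightarrow> graph_value G \<le> \<Lambda>" and e: "e > 0"
  shows "\<forall>\<^sub>F n in sequentially. ln (real (S k n)) \<le> prime_count n * (\<Lambda> + e)"
proof -
  have "e / 2 > 0" using e by simp
  from uniform_upper[OF this] smooth_bound_negligible[OF this k] root16_gt[of 0] eventually_gt_at_top[of 0]
  show ?thesis
  proof eventually_elim
    case (elim n)
    define X where "X = prime_count n * (\<Lambda> + e / 2)"
    \<comment> \<open>\<open>upper_bound\<close> takes a natural number; the products are integers,
      so rounding exp X down still bounds them.\<close>
    define M where "M = nat \<lfloor>exp X\<rfloor>"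
    interpret large_prime_split n "root16 n" k
      by unfold_locales (use elim k root16_powers in auto)
    define r where "r = nat \<lfloor>sqrt n\<rfloor>"
    have "sqrt n < real (r + 1)" unfolding r_def by linarith
    hence "(sqrt n)\<^sup>2 < (real (r + 1))\<^sup>2" by (intro power_strict_mono) auto
    moreover have "(real (r + 1))\<^sup>2 = real ((r + 1) * (r + 1))" by (simp only: of_nat_mult power2_eq_square)
    ultimately have "real n < real ((r + 1) * (r + 1))" by simp
    hence r: "n < (r + 1) * (r + 1)" by (simp only: of_nat_less_iff)
    have "(\<Prod>p\<in>large_primes. edges_upto G (n div p) + n div p + 1) \<le> M" if G: "kfree k G" for G
    proof -
      have "real (\<Prod>p\<in>large_primes. edges_upto G (n div p) + n div p + 1) = (\<Prod>p\<in>large_primes. exp (ln_nbhds G (n div p)))"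
        by (simp add: add_nonneg_pos add_ac)
      also have "\<dots> = exp (\<Sum>p\<in>large_primes. ln_nbhds G (n div p))"
        by (simp add: exp_sum)
      also have "\<dots> \<le> exp X"
      proof -
        have "(\<Sum>p\<in>large_primes. ln_nbhds G (n div p)) \<le> prime_count n * (graph_value G + e / 2)"
          using elim by (simp add: large_primes_def)
        also have "\<dots> \<le> X" unfolding X_def using \<Lambda>[OF G] by (intro mult_left_mono) auto
        finally show ?thesis by simp
      qed
      finally show ?thesis unfolding M_def by (rule le_nat_floor)
    qed
    from upper_bound[OF r _ this, of "smooth_bound k n"]
    have "S k n \<le> (n + 1) ^ smooth_bound k n * (2 ^ (root16 n * root16 n) * M)"
      by (simp add: smooth_bound_def r_def)
    hence "real (S k n) \<le> real ((n + 1) ^ smooth_bound k n * (2 ^ (root16 n * root16 n) * M))" by (simp only: of_nat_le_iff)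
    also have "\<dots> = (real n + 1) ^ smooth_bound k n * (2 ^ (root16 n * root16 n) * real M)" by (simp add: add.commute)
    also have "\<dots> \<le> (real n + 1) ^ smooth_bound k n * (2 ^ (root16 n * root16 n) * exp X)"
      by (intro mult_left_mono) (auto simp: M_def)
    finally have "ln (real (S k n)) \<le> ln ((real n + 1) ^ smooth_bound k n * (2 ^ (root16 n * root16 n) * exp X))"
      using S_ge_1[of k n] k by (intro ln_mono) auto
    also have "\<dots> = real (smooth_bound k n) * ln (real n + 1) + (real (root16 n))\<^sup>2 * ln 2 + X"
      by (simp add: ln_mult ln_realpow power2_eq_square)
    also have "\<dots> \<le> e / 2 * prime_count n + X" using elim by simp
    also have "\<dots> = prime_count n * (\<Lambda> + e)" by (simp add: X_def algebra_simps)
    finally show ?case .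
  qed
qed

text \<open>Using only primes above n div (K + 1) loses the tail of the series for
  \<open>graph_value\<close>, which is below e for a suitable fixed K.\<close>

lemma ln_S_lower:
  assumes k: "k > 0" and G: "kfree k G" and e: "e > 0"
  shows "\<forall>\<^sub>F n in sequentially. ln (real (S k n)) \<ge> prime_count n * (graph_value G - e)"
proof -
  have "(\<lambda>K. \<Sum>i<K. graph_term G i) \<longlonglongrightarrow> graph_value G"
    unfolding graph_value_def by (rule summable_LIMSEQ[OF summable_graph_term])
  hence "\<forall>\<^sub>F K in sequentially. (\<Sum>i<K. graph_term G i) > graph_value G - e"
    using e by (intro order_tendstoD) auto
  then obtain K where K: "(\<Sum>i<K. graph_term G i) > graph_value G - e"
    unfolding eventually_sequentially by auto
  define c where "c = (\<lambda>i. ln_nbhds G i)"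
  have "(\<Sum>i=1..<Suc K. c i * (1 / real i - 1 / real (Suc i))) = (\<Sum>i<K. graph_term G i)"
    unfolding c_def sum_graph_term_eq by simp
  hence "\<forall>\<^sub>F n in sequentially. (\<Sum>i=1..<Suc K. c i * prime_layer n i) / prime_count n > graph_value G - e"
    using K by (intro order_tendstoD(1)[OF main_sum_limit]) auto
  with prime_count_pos eventually_ge_at_top[of "(Suc K)\<^sup>2"] show ?thesis
  proof eventually_elim
    case (elim n)
    define Q where "Q = {p\<in>primes_upto n. n div Suc K < p}"
    have "prime_count n * (graph_value G - e) \<le> (\<Sum>i=1..<Suc K. c i * prime_layer n i)"
      using elim by (simp add: pos_less_divide_eq mult.commute less_imp_le)
    also have "\<dots> = (\<Sum>p\<in>Q. c (n div p))" unfolding Q_def by (rule sum_over_primes_by_quotient[symmetric]) simp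
    also have "\<dots> = ln (\<Prod>p\<in>Q. real (edges_upto G (n div p)) + real (n div p) + 1)"
      unfolding c_def by (rule ln_prod[symmetric]) (auto simp: Q_def add_nonneg_pos)
    also have "(\<Prod>p\<in>Q. real (edges_upto G (n div p)) + real (n div p) + 1) = real (\<Prod>p\<in>Q. edges_upto G (n div p) + n div p + 1)"
      by (simp add: add_ac)
    also have "ln \<dots> \<le> ln (real (S k n))"
    proof (intro ln_mono)
      show "real (\<Prod>p\<in>Q. edges_upto G (n div p) + n div p + 1) \<le> real (S k n)"
        unfolding of_nat_le_iff Q_def by (rule lower_bound[OF G]) (use elim in auto)
      show "0 < real (\<Prod>p\<in>Q. edges_upto G (n div p) + n div p + 1)" unfolding of_nat_0_less_iff by (intro prod_pos) auto
    qed
    finally show ?case .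
  qed
qed

definition growth_exponent :: "nat \<Rightarrow> real" where
  "growth_exponent k = Sup (graph_value ` {G. kfree k G})"

lemma bdd_graph_values: "bdd_above (graph_value ` X)"
  by (rule bdd_aboveI2[of _ _ "suminf graph_term_bound"]) (rule graph_value_le)

lemma kfree_empty: "k > 0 \<Longrightarrow> kfree k (\<lambda>_ _. False)"
  by (auto simp: kfree_def graph_on_pos_def balanced_def)

lemma ln_S_limit:
  assumes k: "k \<ge> 3"
  shows "(\<lambda>n. ln (real (S k n)) / prime_count n) \<longlonglongrightarrow> growth_exponent k"
proof (rule tendstoI)
  fix e :: real assume e: "e > 0"
  hence e2: "e / 2 > 0" by simp
  have ne: "graph_value ` {G. kfree k G} \<noteq> {}" using kfree_empty[of k] k by auto
  have up: "graph_value G \<le> growth_exponent k" if "kfree k G" for G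
    unfolding growth_exponent_def by (rule cSup_upper[OF _ bdd_graph_values]) (use that in auto)
  have "growth_exponent k - e / 2 < Sup (graph_value ` {G. kfree k G})" using e by (simp add: growth_exponent_def)
  then obtain G where G: "kfree k G" "graph_value G > growth_exponent k - e / 2"
    using less_cSup_iff[OF ne bdd_graph_values] by auto
  have "k > 0" using k by simp
  note low = ln_S_lower[OF this G(1) e2]
  have "\<forall>\<^sub>F n in sequentially. ln (real (S k n)) \<le> prime_count n * (growth_exponent k + e / 2)"
    by (rule ln_S_upper[OF k _ e2]) (rule up)
  with low prime_count_pos
  show "\<forall>\<^sub>F n in sequentially. dist (ln (real (S k n)) / prime_count n) (growth_exponent k) < e"
  proof eventually_elim
    case (elim n)
    have "ln (real (S k n)) / prime_count n \<le> growth_exponent k + e / 2"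
      using elim by (simp add: pos_divide_le_eq mult.commute)
    moreover have "graph_value G - e / 2 \<le> ln (real (S k n)) / prime_count n"
      using elim by (simp add: pos_le_divide_eq mult.commute)
    ultimately show ?case using G(2) e by (simp add: dist_real_def abs_less_iff)
  qed
qed

lemma S_root_limit:
  assumes k: "k \<ge> 3"
  shows "(\<lambda>n. real (S k n) powr (1 / real (prime_pi n))) \<longlonglongrightarrow> exp (growth_exponent k)"
proof -
  have "prime_count n = real (prime_pi n)" for n by (simp add: prime_count_def prime_pi_def primes_upto_def)
  hence "(\<lambda>n. exp (ln (real (S k n)) / real (prime_pi n))) \<longlonglongrightarrow> exp (growth_exponent k)"
    using tendsto_exp[OF ln_S_limit[OF k]] by simp
  moreover have "real (S k n) powr (1 / real (prime_pi n)) = exp (ln (real (S k n)) / real (prime_pi n))" for n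
    using S_ge_1[of k n] k by (simp add: powr_def)
  ultimately show ?thesis by simp
qed

section \<open>The constants\<close>

text \<open>The logarithms of the factors form a convergent series, so the infinite product is a
  genuine limit.\<close>

lemma prodinf_graph:
  "(\<Prod>k. (real (edges_upto E (Suc k)) + real (Suc k) + 1) powr (1 / (real (Suc k) ^ 2 + real (Suc k)))) = exp (graph_value E)"
proof -
  have "(real (edges_upto E (Suc k)) + real (Suc k) + 1) powr (1 / (real (Suc k) ^ 2 + real (Suc k))) = exp (graph_term E k)" for k
  proof -
    have "real (edges_upto E (Suc k)) + real (Suc k) + 1 \<noteq> 0"
      using of_nat_0_le_iff[of "edges_upto E (Suc k)"] of_nat_0_le_iff[of "Suc k"] by linarith
    thus ?thesis by (simp only: powr_def graph_term_def if_False) simp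
  qed
  thus ?thesis by (simp only: prodinf_exp[OF summable_graph_term] graph_value_def)
qed

text \<open>Reversing the third edge turns a1/b1 * a2/b2 = a3/b3 into a relation of length 3; an
  edge taken back and forth extends it to length 5.\<close>

lemma kfree_5_product_free:
  assumes "kfree 5 E"
  shows "product_free E"
  unfolding product_free_def
proof (intro conjI allI impI notI)
  show g: "graph_on_pos E" using assms by (simp add: kfree_def)
  fix a1 b1 a2 b2 a3 b3
  assume E: "E a1 b1 \<and> E a2 b2 \<and> E a3 b3"
    and eq: "(of_nat a1 / of_nat b1) * (of_nat a2 / of_nat b2) = (of_nat a3 / of_nat b3 :: rat)"
  have pos: "0 < b1" "0 < b2" "0 < b3" and sym: "E b1 a1" "E b3 a3" using E g by (auto simp: graph_on_pos_def)
  have "(of_nat (a1 * a2 * b3) :: rat) = of_nat (b1 * b2 * a3)" using eq pos by (simp add: field_simps)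
  hence prods: "a1 * a2 * b3 = b1 * b2 * a3" by (simp only: of_nat_eq_iff)
  define x where "x = (\<lambda>i::nat. if i = 0 then a1 else if i = 1 then a2 else b3)"
  define y where "y = (\<lambda>i::nat. if i = 0 then b1 else if i = 1 then b2 else a3)"
  have "balanced 3 E" unfolding balanced_def
    by (intro exI[of _ x] exI[of _ y]) (use E sym prods in \<open>auto simp: x_def y_def numeral_3_eq_3\<close>)
  from balanced_add2[OF this, of a1 b1] E sym have "balanced 5 E" by simp
  thus False using assms by (simp add: kfree_def)
qed

lemma growth_exponent_5_le_beta: "exp (growth_exponent 5) \<le> beta"
proof -
  have beta: "beta = Sup {exp (graph_value E) | E. product_free E}"
    unfolding beta_def prodinf_graph ..
  have bdd: "bdd_above {exp (graph_value E) | E. product_free E}"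
    by (rule bdd_aboveI[of _ "exp (suminf graph_term_bound)"]) (auto simp: graph_value_le)
  have le: "exp (graph_value G) \<le> beta" if "kfree 5 G" for G
    unfolding beta by (rule cSup_upper[OF _ bdd]) (use kfree_5_product_free[OF that] in auto)
  have pos: "beta > 0" using le[OF kfree_empty] by (simp add: less_le_trans[OF exp_gt_zero])
  have "growth_exponent 5 \<le> ln beta"
    unfolding growth_exponent_def
  proof (rule cSup_least)
    show "graph_value ` {G. kfree 5 G} \<noteq> {}" using kfree_empty[of 5] by auto
    fix v assume "v \<in> graph_value ` {G. kfree 5 G}"
    then obtain G where "kfree 5 G" "v = graph_value G" by auto
    thus "v \<le> ln beta" using le[of G] pos by (simp add: ln_ge_iff)
  qed
  thus ?thesis using pos by (simp add: ln_ge_iff)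
qed

text \<open>A relation of length k extends to length k + 2 by one of its own edges taken back and
  forth, so a graph admissible for k + 2 is admissible for k.\<close>

lemma growth_exponent_antimono:
  assumes "k > 0"
  shows "growth_exponent (k + 2) \<le> growth_exponent k"
  unfolding growth_exponent_def
proof (rule cSup_subset_mono)
  show "graph_value ` {G. kfree (k + 2) G} \<noteq> {}" using kfree_empty[of "k + 2"] by auto
  have "kfree k G" if G: "kfree (k + 2) G" for G
    unfolding kfree_def
  proof
    show g: "graph_on_pos G" using G by (simp add: kfree_def)
    show "\<not> balanced k G"
    proof
      assume b: "balanced k G"
      then obtain x y :: "nat \<Rightarrow> nat" where "\<forall>i<k. G (x i) (y i)" by (auto simp: balanced_def)
      hence "G (x 0) (y 0)" using assms by auto
      moreover from this have "G (y 0) (x 0)" using g by (auto simp: graph_on_pos_def)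
      ultimately show False using balanced_add2[OF b] G by (auto simp: kfree_def)
    qed
  qed
  thus "graph_value ` {G. kfree (k + 2) G} \<subseteq> graph_value ` {G. kfree k G}" by auto
qed (rule bdd_graph_values)

section \<open>The Liouville graph and the lower bound \<open>beta_minus\<close>\<close>

definition liouville_graph :: "nat \<Rightarrow> nat \<Rightarrow> bool" where
  "liouville_graph a b \<longleftrightarrow> 0 < a \<and> 0 < b \<and> odd (Omega a + Omega b)"

lemma Omega_prod:
  assumes "\<And>i. i < (k::nat) \<Longrightarrow> 0 < x i"
  shows "Omega (\<Prod>i<k. x i) = (\<Sum>i<k. Omega (x i))"
  using assms
proof (induction k)
  case (Suc k)
  have "(\<Prod>i<k. x i) \<noteq> 0" "x k \<noteq> 0" using Suc.prems by auto
  thus ?case using Suc by (simp add: Omega_def prime_factorization_mult)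
qed (simp add: Omega_def)

lemma odd_sum_of_odds:
  assumes "\<And>i. i < (k::nat) \<Longrightarrow> odd (f i :: nat)"
  shows "odd (\<Sum>i<k. f i) \<longleftrightarrow> odd k"
  using assms by (induction k) auto

text \<open>Omega is additive and changes parity along each edge, so over an odd number of edges its
  values on the two products would differ in parity.\<close>

lemma liouville_graph_kfree:
  assumes "odd k"
  shows "kfree k liouville_graph"
  unfolding kfree_def
proof
  show "graph_on_pos liouville_graph" by (auto simp: graph_on_pos_def liouville_graph_def)
  show "\<not> balanced k liouville_graph"
  proof
    assume "balanced k liouville_graph"
    then obtain x y :: "nat \<Rightarrow> nat" where xy: "\<forall>i<k. liouville_graph (x i) (y i)" "(\<Prod>i<k. x i) = (\<Prod>i<k. y i)"
      by (auto simp: balanced_def)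
    have "(\<Sum>i<k. Omega (x i)) = Omega (\<Prod>i<k. x i)" by (rule Omega_prod[symmetric]) (use xy in \<open>auto simp: liouville_graph_def\<close>)
    moreover have "(\<Sum>i<k. Omega (y i)) = Omega (\<Prod>i<k. y i)" by (rule Omega_prod[symmetric]) (use xy in \<open>auto simp: liouville_graph_def\<close>)
    ultimately have "(\<Sum>i<k. Omega (x i)) = (\<Sum>i<k. Omega (y i))" using xy(2) by simp
    hence "even (\<Sum>i<k. Omega (x i) + Omega (y i))" by (simp add: sum.distrib)
    moreover have "odd (\<Sum>i<k. Omega (x i) + Omega (y i)) \<longleftrightarrow> odd k"
      by (rule odd_sum_of_odds) (use xy in \<open>auto simp: liouville_graph_def\<close>)
    ultimately show False using assms by simp
  qed
qed

text \<open>The graph is complete bipartite with parts \<open>A\<close> and \<open>B\<close>. Their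
  sizes have sum i and difference L(i), so their product is (i^2 - L(i)^2) / 4.\<close>

lemma edges_liouville_graph:
  "real (edges_upto liouville_graph i) = real i ^ 2 / 4 - (of_int (liouville_L i))^2 / 4"
proof -
  define A where "A = {a\<in>{1..i}. even (Omega a)}"
  define B where "B = {a\<in>{1..i}. odd (Omega a)}"
  define X where "X = {(a, b). 1 \<le> a \<and> a < b \<and> b \<le> i \<and> liouville_graph a b}"
  have AB: "{1..i} = A \<union> B" "A \<inter> B = {}" "finite A" "finite B" by (auto simp: A_def B_def)
  have "bij_betw (\<lambda>(a, b). if even (Omega a) then (a, b) else (b, a)) X (A \<times> B)"
    by (rule bij_betwI[where g = "\<lambda>(a, b). if a < b then (a, b) else (b, a)"])
       (auto simp: X_def A_def B_def liouville_graph_def not_less split: if_splits intro: le_neq_implies_less)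
  hence e: "edges_upto liouville_graph i = card A * card B"
    using bij_betw_same_card by (fastforce simp: edges_upto_def X_def card_cartesian_product)
  have i: "i = card A + card B" using card_Un_disjoint[OF AB(3,4,2)] AB(1) by (metis card_atLeastAtMost diff_Suc_1)
  have "liouville_L i = (\<Sum>a\<in>A. (-1) ^ Omega a) + (\<Sum>a\<in>B. (-1) ^ Omega a)"
    unfolding liouville_L_def AB(1) by (rule sum.union_disjoint[OF AB(3,4,2)])
  also have "(\<Sum>a\<in>A. (-1) ^ Omega a :: int) = (\<Sum>a\<in>A. 1)" by (rule sum.cong) (auto simp: A_def)
  also have "(\<Sum>a\<in>B. (-1) ^ Omega a :: int) = (\<Sum>a\<in>B. -1)" by (rule sum.cong) (auto simp: B_def)
  finally have l: "liouville_L i = int (card A) - int (card B)" by simp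
  have "real i = real (card A) + real (card B)" using i by simp
  thus ?thesis unfolding e l by (simp add: field_simps power2_eq_square)
qed

lemma beta_minus_le:
  assumes "odd k"
  shows "beta_minus \<le> exp (growth_exponent k)"
proof -
  have "beta_minus = exp (graph_value liouville_graph)"
    unfolding beta_minus_def edges_liouville_graph[symmetric] by (rule prodinf_graph)
  also have "\<dots> \<le> exp (growth_exponent k)"
    unfolding exp_le_cancel_iff growth_exponent_def
    by (rule cSup_upper[OF _ bdd_graph_values]) (use liouville_graph_kfree[OF assms] in auto)
  finally show ?thesis .
qed

lemma kfree_even:
  assumes "even k" "k > 0"
  shows "{G. kfree k G} = {\<lambda>_ _. False}"
proof -
  have empty: "G = (\<lambda>_ _. False)" if G: "kfree k G" for G
  proof (rule ccontr)
    assume "G \<noteq> (\<lambda>_ _. False)"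
    then obtain a b where ab: "G a b" by (auto simp: fun_eq_iff)
    hence ba: "G b a" using G by (auto simp: kfree_def graph_on_pos_def)
    have "balanced (0 + 2 * (k div 2)) G" by (rule balanced_add_even[where E = G, OF balanced_0 ab ba])
    thus False using G assms(1) by (simp add: kfree_def)
  qed
  show ?thesis
  proof (intro equalityI subsetI)
    fix G :: "nat \<Rightarrow> nat \<Rightarrow> bool" assume "G \<in> {G. kfree k G}"
    hence "kfree k G" by simp
    from empty[OF this] show "G \<in> {\<lambda>_ _. False}" by (simp only: singleton_iff)
  next
    fix G :: "nat \<Rightarrow> nat \<Rightarrow> bool" assume "G \<in> {\<lambda>_ _. False}"
    thus "G \<in> {G. kfree k G}" using kfree_empty[OF assms(2)] by simp
  qed
qed

text \<open>Subtracting the differences of f i = ln (i + 1) / (i + 1), which telescope to f 0 = 0,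
  turns ln (x + 1) / (x^2 + x) into (1 / x) ln (1 + 1 / x) at x = i + 1. So \<open>alpha\<close> is
  the value of the empty graph, up to the factor ln 2.\<close>

lemma alpha_sums: "(\<lambda>i. 1 / real (Suc i) * ln (1 + 1 / real (Suc i))) sums graph_value (\<lambda>_ _. False)"
proof -
  define f where "f = (\<lambda>i. ln (real i + 1) / (real i + 1))"
  have a: "graph_term (\<lambda>_ _. False) sums graph_value (\<lambda>_ _. False)"
    unfolding graph_value_def by (rule summable_sums[OF summable_graph_term])
  have "f \<longlonglongrightarrow> 0" unfolding f_def by real_asymp
  from telescope_sums'[OF this] have "(\<lambda>i. f i - f (Suc i)) sums 0" by (simp add: f_def)
  from sums_diff[OF a this]
  have "(\<lambda>i. graph_term (\<lambda>_ _. False) i - (f i - f (Suc i))) sums graph_value (\<lambda>_ _. False)" by simp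
  moreover have "graph_term (\<lambda>_ _. False) i - (f i - f (Suc i)) = 1 / real (Suc i) * ln (1 + 1 / real (Suc i))" for i
  proof -
    define x where "x = real (Suc i)"
    have x: "x > 0" by (simp add: x_def)
    have "1 + 1 / x = (x + 1) / x" using x by (simp add: field_simps)
    hence l: "ln (1 + 1 / x) = ln (x + 1) - ln x" using x by (simp add: ln_div)
    have "graph_term (\<lambda>_ _. False) i = ln (x + 1) / (x ^ 2 + x)"
      unfolding graph_term_def by (simp add: edges_upto_def x_def)
    also have "\<dots> = ln (x + 1) * (1 / x - 1 / (x + 1))" using x by (simp add: field_simps power2_eq_square)
    finally have g: "graph_term (\<lambda>_ _. False) i = ln (x + 1) * (1 / x - 1 / (x + 1))" .
    have "f i = ln x / x" "f (Suc i) = ln (x + 1) / (x + 1)" by (simp_all add: f_def x_def add_ac)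
    thus ?thesis unfolding g x_def[symmetric] l by (simp add: algebra_simps diff_divide_distrib)
  qed
  ultimately show ?thesis by simp
qed

lemma growth_exponent_even:
  assumes "even k" "k > 0"
  shows "exp (growth_exponent k) = 2 powr alpha"
proof -
  have "(\<lambda>i. 1 / real (Suc i) * ln (1 + 1 / real (Suc i)) / ln 2) sums (graph_value (\<lambda>_ _. False) / ln 2)"
    by (rule sums_divide[OF alpha_sums])
  hence *: "alpha = graph_value (\<lambda>_ _. False) / ln 2"
    unfolding alpha_def log_def by (simp add: sums_iff)
  have "2 powr (graph_value (\<lambda>_ _. False) / ln 2) = exp (graph_value (\<lambda>_ _. False))"
    by (simp add: powr_def)
  thus ?thesis unfolding * by (simp add: growth_exponent_def kfree_even[OF assms])
qed

theorem theorem1p3: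
  shows "(\<forall>k. even k \<and> 4 \<le> k \<longrightarrow>
            ((\<lambda>n. real (S k n) powr (1 / real (prime_pi n))) \<longlongrightarrow> 2 powr alpha) at_top)
       \<and> (\<exists>\<beta>k :: nat \<Rightarrow> real.
            (\<forall>k. odd k \<and> 5 \<le> k \<longrightarrow> \<beta>k k > 0 \<and>
               ((\<lambda>n. real (S k n) powr (1 / real (prime_pi n))) \<longlongrightarrow> \<beta>k k) at_top)
            \<and> beta \<ge> \<beta>k 5
            \<and> (\<forall>k. odd k \<and> 5 \<le> k \<longrightarrow> \<beta>k k \<ge> \<beta>k (k + 2))
            \<and> (\<forall>k. odd k \<and> 5 \<le> k \<longrightarrow> \<beta>k k \<ge> beta_minus))"
proof (intro conjI allI impI exI[of _ "\<lambda>k. exp (growth_exponent k)"])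
  fix k :: nat assume k: "even k \<and> 4 \<le> k"
  hence "k \<ge> 3" by simp
  from S_root_limit[OF this] growth_exponent_even[of k] k
  show "(\<lambda>n. real (S k n) powr (1 / real (prime_pi n))) \<longlonglongrightarrow> 2 powr alpha" by simp
next
  fix k :: nat assume "odd k \<and> 5 \<le> k"
  thus "(\<lambda>n. real (S k n) powr (1 / real (prime_pi n))) \<longlonglongrightarrow> exp (growth_exponent k)"
    by (intro S_root_limit) simp
qed (use growth_exponent_5_le_beta growth_exponent_antimono beta_minus_le in auto)

end
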